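(* For every $n\ge 3$ there exist smooth nonflat Riemannian metrics $g$ on $\mathbb{T}^n$ for which every primitive class in $H_{n-1}(\mathbb{T}^n,\mathbb{Z})$ admits a foliation of $\mathbb{T}^n$ by connected, homologically area-minimizing $(n-1)$-tori representing that class. Consequently, for every $n\ge3$ the following question has a negative answer: if $(\mathbb{T}^n,g)$ is a Riemannian torus such that for every primitive class $r\in H_{n-1}(\mathbb{T}^n,\mathbb{Z})$ there exists a foliation of $\mathbb{T}^n$ by $g$-minimal $(n-1)$-tori in the class $r$, must $g$ be flat?
   Context: $\mathbb{T}^n=\mathbb{R}^n/\mathbb{Z}^n$. A class in $H_{n-1}(\mathbb{T}^n,\mathbb{Z})\cong\mathbb{Z}^n$ is primitive if it is not a proper integer multiple of another integral class. An oriented closed hypersurface is $g$-minimal if its mean curvature vanishes, and homologically area-minimizing if its $g$-area is at most the mass of every closed real $(n-1)$-current in its real homology class. *)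

theory Defs
  imports "HOL-Analysis.Analysis" "HOL-Library.Disjoint_Sets"
begin

text \<open>
  The torus is \<open>\<real>\<^sup>n / \<int>\<^sup>n\<close>, with \<open>n = CARD('n)\<close>.  Functions, metrics and forms on it are
  \<open>\<int>\<^sup>n\<close>-periodic objects on \<open>real ^ 'n\<close>, its subsets are \<open>\<int>\<^sup>n\<close>-invariant subsets of \<open>real ^ 'n\<close>,
  and a map of tori is given by a lift to the universal covers.  The dimension \<open>n - 1\<close> is
  \<open>CARD('m)\<close>; the linear orders on the index types serve to fix orientations.
\<close>

definition int_lattice :: "(real ^ 'n) set" where
  "int_lattice = {z. \<forall>i. z $ i \<in> \<int>}"

definition saturation :: "(real ^ 'n) set \<Rightarrow> (real ^ 'n) set" where
  "saturation A = {x + z | x z. x \<in> A \<and> z \<in> int_lattice}"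


section \<open>Smoothness\<close>

primrec iter_deriv ::
    "'a list \<Rightarrow> ('a::real_normed_vector \<Rightarrow> 'b::real_normed_vector) \<Rightarrow> 'a \<Rightarrow> 'b" where
  "iter_deriv [] f = f"
| "iter_deriv (v # vs) f = (\<lambda>x. frechet_derivative (iter_deriv vs f) (at x) v)"

text \<open>For open sets in finite dimension this is \<open>C\<^sup>\<infinity>\<close>: all iterated directional derivatives
  exist and are differentiable, hence continuous.\<close>

definition smooth_on ::
    "'a::real_normed_vector set \<Rightarrow> ('a \<Rightarrow> 'b::real_normed_vector) \<Rightarrow> bool" where
  "smooth_on U f \<longleftrightarrow> (\<forall>vs. \<forall>x\<in>U. iter_deriv vs f differentiable (at x))"

definition partial :: "'n \<Rightarrow> (real ^ 'n \<Rightarrow> 'b::real_normed_vector) \<Rightarrow> real ^ 'n \<Rightarrow> 'b" where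
  "partial i f x = frechet_derivative f (at x) (axis i 1)"


section \<open>Riemannian metrics and curvature\<close>

definition Riemannian_metric :: "(real ^ 'n \<Rightarrow> real ^ 'n ^ 'n) \<Rightarrow> bool" where
  "Riemannian_metric g \<longleftrightarrow>
     smooth_on UNIV g \<and>
     (\<forall>x. \<forall>z\<in>int_lattice. g (x + z) = g x) \<and>
     (\<forall>x. transpose (g x) = g x) \<and>
     (\<forall>x v. v \<noteq> 0 \<longrightarrow> v \<bullet> (g x *v v) > 0)"

definition christoffel ::
    "(real ^ 'n \<Rightarrow> real ^ 'n ^ 'n) \<Rightarrow> 'n \<Rightarrow> 'n \<Rightarrow> 'n \<Rightarrow> real ^ 'n \<Rightarrow> real" where
  "christoffel g k i j x = 1 / 2 * (\<Sum>l\<in>UNIV. matrix_inv (g x) $ k $ l *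
     (partial i (\<lambda>y. g y $ j $ l) x + partial j (\<lambda>y. g y $ i $ l) x
       - partial l (\<lambda>y. g y $ i $ j) x))"

text \<open>The coefficient \<open>R\<^sup>l\<^sub>k\<^sub>i\<^sub>j\<close> in
  \<open>R(\<partial>\<^sub>i, \<partial>\<^sub>j) \<partial>\<^sub>k = \<Sum>\<^sub>l R\<^sup>l\<^sub>k\<^sub>i\<^sub>j \<partial>\<^sub>l\<close>.\<close>

definition riemann_curvature ::
    "(real ^ 'n \<Rightarrow> real ^ 'n ^ 'n) \<Rightarrow> 'n \<Rightarrow> 'n \<Rightarrow> 'n \<Rightarrow> 'n \<Rightarrow> real ^ 'n \<Rightarrow> real" where
  "riemann_curvature g l k i j x =
     partial i (christoffel g l j k) x - partial j (christoffel g l i k) x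
     + (\<Sum>p\<in>UNIV. christoffel g l i p x * christoffel g p j k x
                 - christoffel g l j p x * christoffel g p i k x)"

definition flat_metric :: "(real ^ 'n \<Rightarrow> real ^ 'n ^ 'n) \<Rightarrow> bool" where
  "flat_metric g \<longleftrightarrow> (\<forall>l k i j x. riemann_curvature g l k i j x = 0)"


section \<open>Differential forms and currents on the torus\<close>

text \<open>The value at a point of a \<open>k\<close>-form is a function on lists of \<open>k\<close> vectors, extended by zero
  to lists of any other length.\<close>

type_synonym 'n form = "real ^ 'n \<Rightarrow> (real ^ 'n) list \<Rightarrow> real"

definition alternating_form :: "nat \<Rightarrow> ((real ^ 'n) list \<Rightarrow> real) \<Rightarrow> bool" where
  "alternating_form k A \<longleftrightarrow>
     (\<forall>vs. length vs \<noteq> k \<longrightarrow> A vs = 0) \<and>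
     (\<forall>vs i. length vs = k \<and> i < k \<longrightarrow> linear (\<lambda>v. A (vs[i := v]))) \<and>
     (\<forall>vs. length vs = k \<and> \<not> distinct vs \<longrightarrow> A vs = 0)"

definition smooth_form :: "nat \<Rightarrow> 'n::finite form \<Rightarrow> bool" where
  "smooth_form k \<omega> \<longleftrightarrow>
     (\<forall>x. alternating_form k (\<omega> x)) \<and>
     (\<forall>vs. smooth_on UNIV (\<lambda>x. \<omega> x vs)) \<and>
     (\<forall>x. \<forall>z\<in>int_lattice. \<omega> (x + z) = \<omega> x)"

text \<open>\<open>d\<omega>(v\<^sub>0, \<dots>, v\<^sub>k) = \<Sum>\<^sub>i (-1)\<^sup>i D\<omega>(v\<^sub>i)(v\<^sub>0, \<dots>, v\<^sub>k without v\<^sub>i)\<close> for constant vector fields.\<close>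

definition ext_deriv :: "'n::finite form \<Rightarrow> 'n form" where
  "ext_deriv \<omega> = (\<lambda>x vs. \<Sum>i<length vs. (-1) ^ i *
     frechet_derivative (\<lambda>y. \<omega> y (take i vs @ drop (Suc i) vs)) (at x) (vs ! i))"

text \<open>A real \<open>k\<close>-current is a continuous linear functional on smooth \<open>k\<close>-forms; its values elsewhere
  are irrelevant.  The \<open>C\<^sup>\<infinity>\<close> topology is metrizable, so continuity is sequential continuity at 0.\<close>

definition current :: "nat \<Rightarrow> ('n::finite form \<Rightarrow> real) \<Rightarrow> bool" where
  "current k T \<longleftrightarrow>
     (\<forall>\<omega> \<eta>. smooth_form k \<omega> \<and> smooth_form k \<eta> \<longrightarrow> T (\<lambda>x vs. \<omega> x vs + \<eta> x vs) = T \<omega> + T \<eta>) \<and>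
     (\<forall>c \<omega>. smooth_form k \<omega> \<longrightarrow> T (\<lambda>x vs. c * \<omega> x vs) = c * T \<omega>) \<and>
     (\<forall>W. (\<forall>m. smooth_form k (W m)) \<and>
          (\<forall>ds vs. uniform_limit UNIV (\<lambda>m. iter_deriv ds (\<lambda>y. W m y vs)) (\<lambda>_. 0) sequentially)
        \<longrightarrow> (\<lambda>m. T (W m)) \<longlonglongrightarrow> 0)"

definition closed_current :: "nat \<Rightarrow> ('n::finite form \<Rightarrow> real) \<Rightarrow> bool" where
  "closed_current k T \<longleftrightarrow>
     current k T \<and> (\<forall>j \<omega>. k = Suc j \<and> smooth_form j \<omega> \<longrightarrow> T (ext_deriv \<omega>) = 0)"

definition homologous :: "nat \<Rightarrow> ('n::finite form \<Rightarrow> real) \<Rightarrow> ('n form \<Rightarrow> real) \<Rightarrow> bool" where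
  "homologous k S T \<longleftrightarrow>
     (\<exists>U. current (Suc k) U \<and> (\<forall>\<omega>. smooth_form k \<omega> \<longrightarrow> S \<omega> - T \<omega> = U (ext_deriv \<omega>)))"

definition orthonormal_frame :: "real ^ 'n ^ 'n \<Rightarrow> (real ^ 'n) list \<Rightarrow> bool" where
  "orthonormal_frame G vs \<longleftrightarrow>
     (\<forall>i<length vs. \<forall>j<length vs. vs ! i \<bullet> (G *v vs ! j) = (if i = j then 1 else 0))"

text \<open>The unit simple \<open>k\<close>-vectors are the exterior products of orthonormal \<open>k\<close>-frames.\<close>

definition comass :: "(real ^ 'n \<Rightarrow> real ^ 'n ^ 'n) \<Rightarrow> nat \<Rightarrow> 'n::finite form \<Rightarrow> ereal" where
  "comass g k \<omega> = Sup {ereal (\<omega> x vs) | x vs. length vs = k \<and> orthonormal_frame (g x) vs}"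

definition mass ::
    "(real ^ 'n \<Rightarrow> real ^ 'n ^ 'n) \<Rightarrow> nat \<Rightarrow> ('n::finite form \<Rightarrow> real) \<Rightarrow> ereal" where
  "mass g k T = Sup {ereal (T \<omega>) | \<omega>. smooth_form k \<omega> \<and> comass g k \<omega> \<le> 1}"


section \<open>Embedded hypertori\<close>

text \<open>\<open>F\<close> is a lift of a smooth embedding of the \<open>(n-1)\<close>-torus into the \<open>n\<close>-torus (an injective
  immersion of a compact manifold); the torus is oriented by the standard orientation of its
  parameter domain.\<close>

definition torus_embedding :: "(real ^ 'm \<Rightarrow> real ^ 'n) \<Rightarrow> bool" where
  "torus_embedding F \<longleftrightarrow>
     smooth_on UNIV F \<and>
     (\<forall>t. \<forall>z\<in>int_lattice. F (t + z) - F t \<in> int_lattice) \<and>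
     (\<forall>s t. F s - F t \<in> int_lattice \<longrightarrow> s - t \<in> int_lattice) \<and>
     (\<forall>t. inj (frechet_derivative F (at t)))"

definition torus_current ::
    "(real ^ 'm::{finite,linorder} \<Rightarrow> real ^ 'n) \<Rightarrow> 'n::finite form \<Rightarrow> real" where
  "torus_current F \<omega> = integral (cbox 0 One)
     (\<lambda>t. \<omega> (F t) (map (\<lambda>a. partial a F t) (sorted_list_of_set UNIV)))"

definition induced_metric ::
    "(real ^ 'n \<Rightarrow> real ^ 'n ^ 'n) \<Rightarrow> (real ^ 'm \<Rightarrow> real ^ 'n) \<Rightarrow> real ^ 'm \<Rightarrow> real ^ 'm ^ 'm" where
  "induced_metric g F t = (\<chi> a b. partial a F t \<bullet> (g (F t) *v partial b F t))"

definition area :: "(real ^ 'n \<Rightarrow> real ^ 'n ^ 'n) \<Rightarrow> (real ^ 'm \<Rightarrow> real ^ 'n) \<Rightarrow> real" where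
  "area g F = integral (cbox 0 One) (\<lambda>t. sqrt (det (induced_metric g F t)))"

definition homologically_area_minimizing ::
    "(real ^ 'n::finite \<Rightarrow> real ^ 'n ^ 'n) \<Rightarrow> (real ^ 'm::{finite,linorder} \<Rightarrow> real ^ 'n) \<Rightarrow> bool" where
  "homologically_area_minimizing g F \<longleftrightarrow>
     (\<forall>S. closed_current CARD('m) S \<and> homologous CARD('m) S (torus_current F) \<longrightarrow>
          ereal (area g F) \<le> mass g CARD('m) S)"

definition unit_normal ::
    "(real ^ 'n \<Rightarrow> real ^ 'n ^ 'n) \<Rightarrow> (real ^ 'm \<Rightarrow> real ^ 'n) \<Rightarrow> real ^ 'm \<Rightarrow> real ^ 'n \<Rightarrow> bool" where
  "unit_normal g F t N \<longleftrightarrow>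
     (\<forall>a. N \<bullet> (g (F t) *v partial a F t) = 0) \<and> N \<bullet> (g (F t) *v N) = 1"

text \<open>The covariant derivative of \<open>\<partial>\<^sub>b F\<close> along \<open>\<partial>\<^sub>a F\<close>.\<close>

definition cov_hessian ::
    "(real ^ 'n \<Rightarrow> real ^ 'n ^ 'n) \<Rightarrow> (real ^ 'm \<Rightarrow> real ^ 'n) \<Rightarrow> 'm \<Rightarrow> 'm \<Rightarrow> real ^ 'm \<Rightarrow> real ^ 'n" where
  "cov_hessian g F a b t = partial a (partial b F) t +
     (\<chi> k. \<Sum>i\<in>UNIV. \<Sum>j\<in>UNIV.
        christoffel g k i j (F t) * partial a F t $ i * partial b F t $ j)"

definition mean_curvature ::
    "(real ^ 'n \<Rightarrow> real ^ 'n ^ 'n) \<Rightarrow> (real ^ 'm \<Rightarrow> real ^ 'n) \<Rightarrow> real ^ 'm \<Rightarrow> real ^ 'n \<Rightarrow> real" where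
  "mean_curvature g F t N = (\<Sum>a\<in>UNIV. \<Sum>b\<in>UNIV.
     matrix_inv (induced_metric g F t) $ a $ b * (N \<bullet> (g (F t) *v cov_hessian g F a b t)))"

definition minimal_hypersurface ::
    "(real ^ 'n \<Rightarrow> real ^ 'n ^ 'n) \<Rightarrow> (real ^ 'm \<Rightarrow> real ^ 'n) \<Rightarrow> bool" where
  "minimal_hypersurface g F \<longleftrightarrow> (\<forall>t N. unit_normal g F t N \<longrightarrow> mean_curvature g F t N = 0)"


section \<open>Integral homology classes of codimension one\<close>

text \<open>The hypersurface \<open>x\<^sub>i = 0\<close>, parametrised by the remaining coordinates in increasing order:
  coordinate \<open>j \<noteq> i\<close> of the target is the parameter whose position is that of \<open>j\<close> in
  \<open>UNIV - {i}\<close>.\<close>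

definition coordinate_torus ::
    "'n::{finite,linorder} \<Rightarrow> real ^ 'm::{finite,linorder} \<Rightarrow> real ^ 'n::_" where
  "coordinate_torus i t =
     (\<chi> j. if j = i then 0 else t $ (sorted_list_of_set UNIV ! card {l. l < j \<and> l \<noteq> i}))"

text \<open>\<open>H\<^sub>n\<^sub>-\<^sub>1(T\<^sup>n, \<int>)\<close> is free with basis the classes of the coordinate tori, hence is identified with
  \<open>int ^ 'n\<close> and embeds into real homology, the homology of currents.  The sign makes the \<open>i\<close>-th
  basis class Poincare dual to \<open>dx\<^sub>i\<close>, so that \<open>r\<close> is the conormal of the linear tori in its class.\<close>

definition represents_class ::
    "(real ^ 'm::{finite,linorder} \<Rightarrow> real ^ 'n::{finite,linorder}) \<Rightarrow> int ^ 'n::_ \<Rightarrow> bool" where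
  "represents_class F r \<longleftrightarrow> homologous CARD('m) (torus_current F)
     (\<lambda>\<omega>. \<Sum>i\<in>UNIV. of_int (r $ i) * (-1) ^ card {l. l < i} *
        torus_current (coordinate_torus i :: real ^ 'm::_ \<Rightarrow> real ^ 'n::_) \<omega>)"

definition primitive_class :: "int ^ 'n \<Rightarrow> bool" where
  "primitive_class r \<longleftrightarrow> \<not> (\<exists>k s. k \<notin> {1, -1} \<and> r = k *s s)"


section \<open>Foliations of codimension one\<close>

text \<open>A smooth diffeomorphism from \<open>U\<close> onto the open cube with side 2 centred at the origin.\<close>

definition cubic_chart :: "(real ^ 'n) set \<Rightarrow> (real ^ 'n \<Rightarrow> real ^ 'n) \<Rightarrow> bool" where
  "cubic_chart U \<phi> \<longleftrightarrow>
     open U \<and> smooth_on U \<phi> \<and> inj_on \<phi> U \<and> \<phi> ` U = box (- One) One \<and>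
     smooth_on (box (- One) One) (inv_into U \<phi>)"

text \<open>A decomposition of the torus into connected leaves such that near every point there are
  coordinates for which the components of the traces of the leaves are coordinate hyperplanes.
  The leaves are given by their preimages in \<open>real ^ 'n\<close>; a leaf is connected in the torus,
  its preimage need not be.\<close>

definition foliation :: "(real ^ 'n) set set \<Rightarrow> bool" where
  "foliation \<F> \<longleftrightarrow>
     partition_on UNIV \<F> \<and>
     (\<forall>L\<in>\<F>. \<exists>C. connected C \<and> L = saturation C) \<and>
     (\<forall>p. \<exists>U \<phi> i. p \<in> U \<and> cubic_chart U \<phi> \<and>
        (\<forall>L\<in>\<F>. components (U \<inter> L) \<subseteq> {{q\<in>U. \<phi> q $ i = c} | c. True}))"

definition foliation_by_tori_in_class ::
    "((real ^ 'm::{finite,linorder} \<Rightarrow> real ^ 'n::{finite,linorder}) \<Rightarrow> bool) \<Rightarrow>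
      int ^ 'n::_ \<Rightarrow> (real ^ 'n::_) set set \<Rightarrow> bool" where
  "foliation_by_tori_in_class P r \<F> \<longleftrightarrow>
     foliation \<F> \<and>
     (\<forall>L\<in>\<F>. \<exists>F. torus_embedding F \<and> L = saturation (range F) \<and> represents_class F r \<and> P F)"

end

theory Submission
  imports Defs
begin

text \<open>
  The metric is \<open>g = dx\<^sub>a\<^sup>2 + \<Sum>\<^sub>i\<^sub>\<noteq>\<^sub>a \<gamma>\<^sub>i(x\<^sub>a) dx\<^sub>i\<^sup>2\<close> with \<open>\<Prod>\<^sub>i \<gamma>\<^sub>i = 1\<close>; for \<open>n \<ge> 3\<close> the weights
  \<open>w, 1/w, 1, \<dots>, 1\<close> with a nonconstant periodic \<open>w\<close> make it nonflat.

  Fix a primitive integral covector \<open>r\<close>.  The squared length of its part transverse to \<open>dx\<^sub>a\<close> is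
  \<open>q(x\<^sub>a) = \<Sum>\<^sub>i\<^sub>\<noteq>\<^sub>a r\<^sub>i\<^sup>2 / \<gamma>\<^sub>i(x\<^sub>a)\<close>, a function of \<open>x\<^sub>a\<close> alone.  Let \<open>h\<close> be the primitive of \<open>\<surd>q\<close>
  normalised to \<open>h(s + 1) = h(s) + 1\<close> (and \<open>h(s) = s\<close> if \<open>q = 0\<close>), so that \<open>q = \<kappa> h'\<^sup>2\<close> with a constant
  \<open>\<kappa>\<close>.  The leaves are the level sets modulo 1 of
  \<open>f(x) = r\<^sub>a h(x\<^sub>a) + \<Sum>\<^sub>i\<^sub>\<noteq>\<^sub>a r\<^sub>i x\<^sub>i\<close>: the linear tori with conormal \<open>r\<close>, bent by the diffeomorphism
  that replaces \<open>x\<^sub>a\<close> by \<open>h(x\<^sub>a)\<close>.  Then \<open>\<bar>df\<bar> = \<mu> h'(x\<^sub>a)\<close> with \<open>\<mu>\<^sup>2 = r\<^sub>a\<^sup>2 + \<kappa>\<close>, so the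
  unit normal field \<open>X = grad f / \<bar>df\<bar>\<close> has the constant component \<open>X\<^sub>a = r\<^sub>a / \<mu>\<close>, while its other
  components depend on \<open>x\<^sub>a\<close> only.  As \<open>det g = 1\<close>, the field \<open>X\<close> is divergence-free, hence
  \<open>\<iota>\<^sub>X vol\<close> is a closed form (\<open>calibration_closed\<close>).  It has comass at most one
  (\<open>calibration_comass\<close>, from Hadamard's inequality) and restricts to the area form on every leaf, so it
  calibrates all leaves at once and each of them minimizes mass in its homology class
  (\<open>leaf_minimizing\<close>).  The mean curvature is minus the divergence of \<open>X\<close> and vanishes for the same
  reason; \<open>leaf_minimal\<close> computes it in coordinates.

  That a leaf is an embedded torus in the class \<open>r\<close> needs a basis of \<open>\<int>\<^sup>n\<close> adapted to \<open>r\<close>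
  (\<open>hyperplane_basis_exists\<close>, the Euclidean algorithm) and an explicit homology.  A linear torus is
  homologous to the average of its translates, and this average evaluates a form at its mean value
  (\<open>torus_current_linear_mean\<close>); a leaf is homologous to the linear torus that it is bent from, because it
  is a graph over it in the direction of \<open>x\<^sub>a\<close> (\<open>torus_current_homotopy\<close>).  Comparison with the coordinate tori is thereby
  reduced to the linear algebra of alternating \<open>(n-1)\<close>-forms, which are fluxes
  \<open>vol(Y, \<cdot>)\<close> of vectors (\<open>alternating_form_eq_flux\<close>).
\<close>

section \<open>Smooth functions\<close>

text \<open>Differentiability of order \<open>k\<close> on the whole line, stated by existence of derivatives so that closure
  properties follow by induction on \<open>k\<close> from the differentiation rules.\<close>

primrec C_k :: "nat \<Rightarrow> (real \<Rightarrow> real) \<Rightarrow> bool" where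
  "C_k 0 f = True"
| "C_k (Suc k) f = (\<exists>f'. (\<forall>x. (f has_real_derivative f' x) (at x)) \<and> C_k k f')"

definition C_inf :: "(real \<Rightarrow> real) \<Rightarrow> bool" where
  "C_inf f \<longleftrightarrow> (\<forall>k. C_k k f)"

lemma C_k_Suc_imp: "C_k (Suc k) f \<Longrightarrow> C_k k f"
proof (induction k arbitrary: f)
  case (Suc k)
  then show ?case by (auto simp only: C_k.simps)
qed simp

lemma C_k_const: "C_k k (\<lambda>x. c)"
proof (induction k arbitrary: c)
  case (Suc k)
  then show ?case by (auto intro!: exI[of _ "\<lambda>x. 0"])
qed simp

lemma C_k_affine: "C_k k (\<lambda>x. c * x + d)"
proof (cases k)
  case (Suc j)
  then show ?thesis
    using C_k_const[of j c] by (auto intro!: exI[of _ "\<lambda>x. c"] derivative_eq_intros)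
qed simp

lemma C_k_add: "C_k k f \<Longrightarrow> C_k k g \<Longrightarrow> C_k k (\<lambda>x. f x + g x)"
proof (induction k arbitrary: f g)
  case (Suc k)
  then obtain f' g' where "\<And>x. (f has_real_derivative f' x) (at x)" "C_k k f'"
    "\<And>x. (g has_real_derivative g' x) (at x)" "C_k k g'"
    by auto
  with Suc.IH show ?case
    by (auto intro!: exI[of _ "\<lambda>x. f' x + g' x"] derivative_intros)
qed simp

lemma C_k_mult: "C_k k f \<Longrightarrow> C_k k g \<Longrightarrow> C_k k (\<lambda>x. f x * g x)"
proof (induction k arbitrary: f g)
  case (Suc k)
  then obtain f' g' where d: "\<And>x. (f has_real_derivative f' x) (at x)" "C_k k f'"
    "\<And>x. (g has_real_derivative g' x) (at x)" "C_k k g'"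
    by auto
  have "C_k k (\<lambda>x. f' x * g x + g' x * f x)"
    using Suc.IH[OF d(2) C_k_Suc_imp[OF Suc.prems(2)]] Suc.IH[OF d(4) C_k_Suc_imp[OF Suc.prems(1)]]
    by (rule C_k_add)
  moreover have "((\<lambda>x. f x * g x) has_real_derivative f' x * g x + g' x * f x) (at x)" for x
    by (rule DERIV_mult[OF d(1) d(3)])
  ultimately show ?case
    unfolding C_k.simps by (intro exI[of _ "\<lambda>x. f' x * g x + g' x * f x"]) blast
qed simp

lemma C_k_compose: "C_k k f \<Longrightarrow> C_k k g \<Longrightarrow> C_k k (\<lambda>x. f (g x))"
proof (induction k arbitrary: f g)
  case (Suc k)
  then obtain f' g' where d: "\<And>x. (f has_real_derivative f' x) (at x)" "C_k k f'"
    "\<And>x. (g has_real_derivative g' x) (at x)" "C_k k g'"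
    by auto
  have "C_k k (\<lambda>x. f' (g x) * g' x)"
    using Suc.IH[OF d(2) C_k_Suc_imp[OF Suc.prems(2)]] d(4) by (rule C_k_mult)
  moreover have "((\<lambda>x. f (g x)) has_real_derivative f' (g x) * g' x) (at x)" for x
    by (rule DERIV_chain2[OF d(1) d(3)])
  ultimately show ?case
    unfolding C_k.simps by (intro exI[of _ "\<lambda>x. f' (g x) * g' x"]) blast
qed simp

lemma C_k_inverse: "C_k k f \<Longrightarrow> (\<And>x. f x > 0) \<Longrightarrow> C_k k (\<lambda>x. inverse (f x))"
proof (induction k arbitrary: f)
  case (Suc k)
  then obtain f' where d: "\<And>x. (f has_real_derivative f' x) (at x)" "C_k k f'"
    by auto
  have "C_k k (\<lambda>x. (- 1) * (inverse (f x) * f' x * inverse (f x)))"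
    using Suc.IH[OF C_k_Suc_imp[OF Suc.prems(1)] Suc.prems(2)] d(2)
    by (intro C_k_mult C_k_const)
  moreover have "((\<lambda>x. inverse (f x)) has_real_derivative
      (- 1) * (inverse (f x) * f' x * inverse (f x))) (at x)" for x
    using DERIV_inverse'[OF d(1)[of x]] Suc.prems(2)[of x] by simp
  ultimately show ?case
    unfolding C_k.simps by (intro exI[of _ "\<lambda>x. (- 1) * (inverse (f x) * f' x * inverse (f x))"]) blast
qed simp

lemma C_k_sqrt: "C_k k f \<Longrightarrow> (\<And>x. f x > 0) \<Longrightarrow> C_k k (\<lambda>x. sqrt (f x))"
proof (induction k arbitrary: f)
  case (Suc k)
  then obtain f' where d: "\<And>x. (f has_real_derivative f' x) (at x)" "C_k k f'"
    by auto
  have "C_k k (\<lambda>x. f' x * (inverse 2 * inverse (sqrt (f x))))"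
    using C_k_inverse[OF Suc.IH[OF C_k_Suc_imp[OF Suc.prems(1)] Suc.prems(2)]] d(2) Suc.prems(2)
    by (intro C_k_mult C_k_const) auto
  moreover have "((\<lambda>x. sqrt (f x)) has_real_derivative
      f' x * (inverse 2 * inverse (sqrt (f x)))) (at x)" for x
    using DERIV_chain2[OF DERIV_real_sqrt[OF Suc.prems(2)[of x]] d(1)[of x]]
    by (simp add: field_simps)
  ultimately show ?case
    unfolding C_k.simps by (intro exI[of _ "\<lambda>x. f' x * (inverse 2 * inverse (sqrt (f x)))"]) blast
qed simp

lemma C_k_sin_cos: "C_k k (\<lambda>x. c * sin x + d * cos x)"
proof (induction k arbitrary: c d)
  case (Suc k)
  have "((\<lambda>x. c * sin x + d * cos x) has_real_derivative (- d) * sin x + c * cos x) (at x)" for x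
    by (auto intro!: derivative_eq_intros)
  with Suc[of "- d" c] show ?case
    unfolding C_k.simps by (intro exI[of _ "\<lambda>x. (- d) * sin x + c * cos x"]) blast
qed simp

lemma C_inf_const: "C_inf (\<lambda>x. c)"
  and C_inf_affine: "C_inf (\<lambda>x. c * x + d)"
  and C_inf_add: "C_inf f \<Longrightarrow> C_inf g \<Longrightarrow> C_inf (\<lambda>x. f x + g x)"
  and C_inf_mult: "C_inf f \<Longrightarrow> C_inf g \<Longrightarrow> C_inf (\<lambda>x. f x * g x)"
  and C_inf_compose: "C_inf f \<Longrightarrow> C_inf g \<Longrightarrow> C_inf (\<lambda>x. f (g x))"
  and C_inf_inverse: "C_inf f \<Longrightarrow> (\<And>x. f x > 0) \<Longrightarrow> C_inf (\<lambda>x. inverse (f x))"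
  and C_inf_sqrt: "C_inf f \<Longrightarrow> (\<And>x. f x > 0) \<Longrightarrow> C_inf (\<lambda>x. sqrt (f x))"
  using C_k_const C_k_affine C_k_add C_k_mult C_k_compose C_k_inverse C_k_sqrt
  by (simp_all add: C_inf_def)

lemma C_inf_id: "C_inf (\<lambda>x. x)"
  using C_inf_affine[of 1 0] by simp

lemma C_inf_sin: "C_inf sin"
  using C_k_sin_cos[of _ 1 0] by (simp add: C_inf_def)

lemma C_inf_sum: "(\<And>i. i \<in> I \<Longrightarrow> C_inf (f i)) \<Longrightarrow> C_inf (\<lambda>x. \<Sum>i\<in>I. f i x)"
  by (induction I rule: infinite_finite_induct) (simp_all add: C_inf_const C_inf_add)

lemma C_inf_antiderivative:
  assumes "\<And>x. (f has_real_derivative f' x) (at x)" "C_inf f'"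
  shows "C_inf f"
  unfolding C_inf_def
proof
  fix k show "C_k k f"
    using assms by (cases k) (auto simp: C_inf_def)
qed

lemma C_inf_derivative:
  assumes "C_inf f" "\<And>x. (f has_real_derivative f' x) (at x)"
  shows "C_inf f'"
  unfolding C_inf_def
proof
  fix k
  obtain f'' where "\<forall>x. (f has_real_derivative f'' x) (at x)" "C_k k f''"
    using assms(1) by (metis C_inf_def C_k.simps(2))
  moreover have "f'' = f'"
    using calculation assms(2) DERIV_unique by blast
  ultimately show "C_k k f'" by simp
qed

lemma C_inf_deriv:
  assumes "C_inf f"
  shows "(f has_real_derivative deriv f x) (at x)" and "C_inf (deriv f)"
proof -
  have "C_k (Suc 0) f" using assms by (simp only: C_inf_def)
  then have *: "(f has_real_derivative deriv f x) (at x)" for x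
    unfolding C_k.simps using DERIV_imp_deriv by metis
  then show "(f has_real_derivative deriv f x) (at x)" .
  show "C_inf (deriv f)" by (rule C_inf_derivative[OF assms *])
qed

lemma C_inf_continuous_on: "C_inf f \<Longrightarrow> continuous_on S f"
  using C_inf_deriv(1) DERIV_isCont by (blast intro: continuous_at_imp_continuous_on)

text \<open>The derivative \<open>1 / (f' \<circ> g)\<close> of the inverse \<open>g\<close> is as often differentiable as \<open>g\<close>.\<close>

lemma C_inf_inverse_function:
  assumes f: "C_inf f" and d: "\<And>x. (f has_real_derivative f' x) (at x)"
    and pos: "\<And>x. f' x > 0"
    and g: "\<And>x. (g has_real_derivative inverse (f' (g x))) (at x)"
  shows "C_inf g"
  unfolding C_inf_def
proof
  fix k show "C_k k g"
  proof (induction k)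
    case (Suc k)
    have "C_k k (\<lambda>x. inverse (f' (g x)))"
      using C_inf_inverse[OF C_inf_derivative[OF f d] pos] Suc C_k_compose
      unfolding C_inf_def by blast
    with g show ?case
      unfolding C_k.simps by (intro exI[of _ "\<lambda>x. inverse (f' (g x))"]) blast
  qed simp
qed

text \<open>All maps in the construction are sums of functions of one linear coordinate each, with
  constant vector coefficients; this form is preserved by directional derivatives.\<close>

lemma ridge_sum_has_derivative:
  fixes u :: "'i \<Rightarrow> 'a::real_inner" and y :: "'i \<Rightarrow> 'b::real_normed_vector"
  assumes "\<And>i. i \<in> I \<Longrightarrow> (\<phi> i has_real_derivative \<phi>' i (u i \<bullet> x)) (at (u i \<bullet> x))"
  shows "((\<lambda>x. \<Sum>i\<in>I. \<phi> i (u i \<bullet> x) *\<^sub>R y i) has_derivative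
          (\<lambda>v. \<Sum>i\<in>I. (\<phi>' i (u i \<bullet> x) * (u i \<bullet> v)) *\<^sub>R y i)) (at x)"
proof (rule has_derivative_sum)
  fix i assume "i \<in> I"
  have "((\<lambda>x. \<phi> i (u i \<bullet> x)) has_derivative (\<lambda>v. \<phi>' i (u i \<bullet> x) * (u i \<bullet> v))) (at x)"
    by (rule has_derivative_compose[of "\<lambda>x. u i \<bullet> x" "\<lambda>v. u i \<bullet> v" x UNIV "\<phi> i"])
      (use assms[OF \<open>i \<in> I\<close>] in \<open>auto simp: has_field_derivative_def intro!: derivative_intros\<close>)
  then show "((\<lambda>x. \<phi> i (u i \<bullet> x) *\<^sub>R y i) has_derivative
      (\<lambda>v. (\<phi>' i (u i \<bullet> x) * (u i \<bullet> v)) *\<^sub>R y i)) (at x)"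
    by (rule has_derivative_scaleR_left)
qed

lemma smooth_ridge_sum:
  fixes u :: "'i \<Rightarrow> 'a::real_inner" and y :: "'i \<Rightarrow> 'b::real_normed_vector"
  assumes "\<And>i. i \<in> I \<Longrightarrow> C_inf (\<phi> i)"
  shows "smooth_on U (\<lambda>x. \<Sum>i\<in>I. \<phi> i (u i \<bullet> x) *\<^sub>R y i)"
proof -
  have "\<exists>\<psi>. (\<forall>i\<in>I. C_inf (\<psi> i)) \<and>
      iter_deriv vs (\<lambda>x. \<Sum>i\<in>I. \<phi> i (u i \<bullet> x) *\<^sub>R y i) = (\<lambda>x. \<Sum>i\<in>I. \<psi> i (u i \<bullet> x) *\<^sub>R y i)" for vs
  proof (induction vs)
    case Nil
    then show ?case using assms by auto
  next
    case (Cons v vs)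
    then obtain \<psi> where \<psi>: "\<And>i. i\<in>I \<Longrightarrow> C_inf (\<psi> i)"
      "iter_deriv vs (\<lambda>x. \<Sum>i\<in>I. \<phi> i (u i \<bullet> x) *\<^sub>R y i) = (\<lambda>x. \<Sum>i\<in>I. \<psi> i (u i \<bullet> x) *\<^sub>R y i)"
      by auto
    have "frechet_derivative (\<lambda>x. \<Sum>i\<in>I. \<psi> i (u i \<bullet> x) *\<^sub>R y i) (at x) =
          (\<lambda>v. \<Sum>i\<in>I. (deriv (\<psi> i) (u i \<bullet> x) * (u i \<bullet> v)) *\<^sub>R y i)" for x
      by (rule frechet_derivative_at[symmetric], rule ridge_sum_has_derivative)
        (rule C_inf_deriv(1)[OF \<psi>(1)])
    then have "iter_deriv (v # vs) (\<lambda>x. \<Sum>i\<in>I. \<phi> i (u i \<bullet> x) *\<^sub>R y i) =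
        (\<lambda>x. \<Sum>i\<in>I. (deriv (\<psi> i) (u i \<bullet> x) * (u i \<bullet> v)) *\<^sub>R y i)"
      by (simp only: iter_deriv.simps \<psi>(2))
    moreover have "C_inf (\<lambda>s. deriv (\<psi> i) s * (u i \<bullet> v))" if "i \<in> I" for i
      by (rule C_inf_mult[OF C_inf_deriv(2)[OF \<psi>(1)[OF that]] C_inf_const])
    ultimately show ?case
      by (intro exI[of _ "\<lambda>i s. deriv (\<psi> i) s * (u i \<bullet> v)"]) blast
  qed
  note form = this
  have diff: "(\<lambda>x. \<Sum>i\<in>I. \<psi> i (u i \<bullet> x) *\<^sub>R y i) differentiable (at x)"
    if "\<forall>i\<in>I. C_inf (\<psi> i)" for \<psi> x
    using ridge_sum_has_derivative[of I \<psi> "\<lambda>i. deriv (\<psi> i)" u x y] that C_inf_deriv(1)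
    unfolding differentiable_def by blast
  show ?thesis
    unfolding smooth_on_def
  proof (intro allI ballI)
    fix vs x
    obtain \<psi> where \<psi>: "\<forall>i\<in>I. C_inf (\<psi> i)"
      "iter_deriv vs (\<lambda>x. \<Sum>i\<in>I. \<phi> i (u i \<bullet> x) *\<^sub>R y i) = (\<lambda>x. \<Sum>i\<in>I. \<psi> i (u i \<bullet> x) *\<^sub>R y i)"
      using form by blast
    show "iter_deriv vs (\<lambda>x. \<Sum>i\<in>I. \<phi> i (u i \<bullet> x) *\<^sub>R y i) differentiable at x"
      unfolding \<psi>(2) by (rule diff[OF \<psi>(1)])
  qed
qed

text \<open>Iterated derivatives on an open set see only the values there; this applies to the inverse of a
  chart, which is a junk value outside the image.\<close>

lemma smooth_on_cong_open:
  assumes "open U" "smooth_on U f" "\<And>x. x \<in> U \<Longrightarrow> g x = f x"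
  shows "smooth_on U g"
proof -
  have tr: "(h has_derivative D) (at x)"
    if "(h' has_derivative D) (at x)" "\<And>y. y \<in> U \<Longrightarrow> h y = h' y" "x \<in> U"
    for h h' :: "'a \<Rightarrow> 'b" and D x
    using has_derivative_transform_within_open[OF that(1) assms(1) that(3)] that(2) by metis
  have eq: "\<forall>x\<in>U. iter_deriv vs g x = iter_deriv vs f x" for vs
  proof (induction vs)
    case (Cons v vs)
    have "frechet_derivative (iter_deriv vs g) (at x) = frechet_derivative (iter_deriv vs f) (at x)"
      if "x \<in> U" for x
    proof -
      have "(iter_deriv vs f has_derivative frechet_derivative (iter_deriv vs f) (at x)) (at x)"
        using assms(2) that unfolding smooth_on_def by (simp flip: frechet_derivative_works)
      from tr[OF this] Cons that show ?thesis
        by (metis frechet_derivative_at)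
    qed
    then show ?case by simp
  qed (use assms(3) in simp)
  show ?thesis
    unfolding smooth_on_def
  proof (intro allI ballI)
    fix vs x assume "x \<in> U"
    then have "(iter_deriv vs f has_derivative frechet_derivative (iter_deriv vs f) (at x)) (at x)"
      using assms(2) unfolding smooth_on_def by (simp flip: frechet_derivative_works)
    from tr[OF this] eq \<open>x \<in> U\<close> show "iter_deriv vs g differentiable at x"
      by (metis differentiable_def)
  qed
qed

lemma smooth_on_UNIV_D:
  assumes "smooth_on UNIV f"
  shows "(f has_derivative frechet_derivative f (at x)) (at x)"
    and "continuous_on S f"
    and "continuous_on S (\<lambda>x. frechet_derivative f (at x) v)"
proof -
  have d: "iter_deriv vs f differentiable (at x)" for vs x
    using assms by (simp add: smooth_on_def)
  show "(f has_derivative frechet_derivative f (at x)) (at x)"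
    using d[of "[]"] by (simp add: frechet_derivative_works)
  show "continuous_on S f"
    using d[of "[]"] by (simp add: continuous_at_imp_continuous_on differentiable_imp_continuous_within)
  show "continuous_on S (\<lambda>x. frechet_derivative f (at x) v)"
    using d[of "[v]"] by (simp add: continuous_at_imp_continuous_on differentiable_imp_continuous_within)
qed

section \<open>Alternating forms\<close>

lemma not_distinctI: "i < length xs \<Longrightarrow> j < length xs \<Longrightarrow> i \<noteq> j \<Longrightarrow> xs ! i = xs ! j \<Longrightarrow> \<not> distinct xs"
  by (auto simp: distinct_conv_nth)

lemma linear_mult_left: "linear f \<Longrightarrow> linear (\<lambda>x. c * f x :: real)"
  using linear_compose_scale_right[of f c] by simp

lemma alternating_formD:
  assumes "alternating_form k \<alpha>"
  shows "length vs \<noteq> k \<Longrightarrow> \<alpha> vs = 0"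
    and "length vs = k \<Longrightarrow> i < k \<Longrightarrow> linear (\<lambda>v. \<alpha> (vs[i := v]))"
    and "length vs = k \<Longrightarrow> \<not> distinct vs \<Longrightarrow> \<alpha> vs = 0"
  using assms unfolding alternating_form_def by blast+

lemma alternating_form_add_scale:
  assumes "alternating_form k \<alpha>" "length vs = k" "i < k"
  shows "\<alpha> (vs[i := u + c *\<^sub>R v]) = \<alpha> (vs[i := u]) + c * \<alpha> (vs[i := v])"
  using linear_add[OF alternating_formD(2)[OF assms], of u "c *\<^sub>R v"]
    linear_scale[OF alternating_formD(2)[OF assms], of c v] by simp

text \<open>Vanishing on repeated arguments, applied to \<open>u + v\<close> in both slots, gives antisymmetry.\<close>

lemma alternating_form_swap:
  assumes "alternating_form k \<alpha>" "length vs = k" "i < k" "j < k" "i \<noteq> j"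
  shows "\<alpha> (vs[i := vs ! j, j := vs ! i]) = - \<alpha> vs"
proof -
  define f where "f u v = \<alpha> (vs[i := u, j := v])" for u v
  have f1: "f (u + u') v = f u v + f u' v" for u u' v
  proof -
    have "vs[i := x, j := v] = (vs[j := v])[i := x]" for x
      using assms(5) by (rule list_update_swap)
    then show ?thesis
      using alternating_form_add_scale[OF assms(1), of "vs[j := v]" i u 1 u'] assms
      by (simp add: f_def)
  qed
  have f2: "f u (v + v') = f u v + f u v'" for u v v'
    using alternating_form_add_scale[OF assms(1), of "vs[i := u]" j v 1 v'] assms
    by (simp add: f_def)
  have f0: "f u u = 0" for u
    unfolding f_def
    by (intro alternating_formD(3)[OF assms(1)] not_distinctI[of i _ j]) (use assms in auto)
  have "f (vs!i + vs!j) (vs!i + vs!j) = f (vs!i) (vs!j) + f (vs!j) (vs!i)"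
    by (simp only: f1 f2) (simp add: f0)
  then have "f (vs!j) (vs!i) = - f (vs!i) (vs!j)"
    by (simp add: f0)
  then show ?thesis by (simp add: f_def)
qed

lemma alternating_form_move:
  assumes "alternating_form k \<alpha>" "Suc (length us) = k" "i \<le> length us"
  shows "\<alpha> (take i us @ v # drop i us) = (- 1) ^ i * \<alpha> (v # us)"
  using assms(3)
proof (induction i)
  case (Suc i)
  let ?l = "take i us @ v # drop i us"
  have i: "i < length us" and d: "drop i us = us ! i # drop (Suc i) us"
    using Suc.prems by (auto simp: Cons_nth_drop_Suc)
  have l: "?l ! i = v" "?l ! Suc i = us ! i" "length ?l = k"
    using i assms(2) by (auto simp: nth_append d)
  have "?l[i := ?l ! Suc i, Suc i := ?l ! i] = take (Suc i) us @ v # drop (Suc i) us"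
    unfolding l using i by (simp add: d take_Suc_conv_app_nth list_update_append)
  with alternating_form_swap[OF assms(1) l(3), of i "Suc i"] i assms(2)
  have "\<alpha> (take (Suc i) us @ v # drop (Suc i) us) = - \<alpha> ?l"
    by simp
  also have "\<dots> = (- 1) ^ Suc i * \<alpha> (v # us)"
    using Suc.IH i by simp
  finally show ?case .
qed simp

text \<open>Translates between the omission of an argument, as in the exterior derivative, and its
  replacement, which is easier to handle because positions do not shift.\<close>

lemma alternating_form_replace:
  assumes "alternating_form k \<alpha>" "length vs = k" "i < k"
  shows "\<alpha> (v # take i vs @ drop (Suc i) vs) = (- 1) ^ i * \<alpha> (vs[i := v])"
proof -
  let ?us = "take i vs @ drop (Suc i) vs"
  have "take i ?us @ v # drop i ?us = vs[i := v]"
    using assms by (simp add: upd_conv_take_nth_drop)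
  with alternating_form_move[OF assms(1), of ?us i v] assms
  have "\<alpha> (vs[i := v]) = (- 1) ^ i * \<alpha> (v # ?us)"
    by simp
  then show ?thesis
    by (simp flip: mult.assoc power_mult_distrib)
qed

lemma alternating_form_interior:
  assumes "alternating_form (Suc k) \<alpha>"
  shows "alternating_form k (\<lambda>vs. \<alpha> (v # vs))"
  unfolding alternating_form_def
proof (intro conjI allI impI)
  show "linear (\<lambda>u. \<alpha> (v # vs[i := u]))" if "length vs = k \<and> i < k" for vs i
    using alternating_formD(2)[OF assms, of "v # vs" "Suc i"] that by simp
qed (use alternating_formD[OF assms] in auto)

lemma permute_list_transpose:
  assumes "a < length xs" "b < length xs"
  shows "permute_list (Transposition.transpose a b) xs = xs[a := xs ! b, b := xs ! a]"
  using assms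
  by (intro nth_equalityI) (auto simp: permute_list_def nth_list_update transpose_def)

text \<open>An alternating form is determined by its values on the increasing lists of basis vectors:
  multilinearity reduces to lists of basis vectors, and such a list is either repetitive
  or sorted by transpositions.\<close>

lemma alternating_form_eq_0:
  fixes \<alpha> :: "(real ^ 'n::{finite,linorder}) list \<Rightarrow> real"
  assumes "alternating_form k \<alpha>"
    and zero: "\<And>J. card J = k \<Longrightarrow> \<alpha> (map (\<lambda>j. axis j 1) (sorted_list_of_set J)) = 0"
  shows "\<alpha> vs = 0"
proof (cases "length vs = k")
  case True
  have basis: "\<alpha> (map (\<lambda>j. axis j 1) js) = 0" if "length js = k" for js :: "'n list"
  proof (cases "distinct js")
    case True
    let ?s = "sorted_list_of_set (set js)"
    let ?e = "map (\<lambda>j::'n. axis j (1::real)) ?s"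
    have len: "length ?s = k" using True that by (simp add: distinct_card)
    have "mset js = mset ?s"
      using True set_eq_iff_mset_eq_distinct[of js ?s] by simp
    then obtain p where p: "p permutes {..<length ?s}" "permute_list p ?s = js"
      by (rule mset_eq_permutation)
    have "\<alpha> (permute_list p ?e) = 0"
      using finite_lessThan p(1)
    proof (induction p rule: permutes_rev_induct)
      case id
      then show ?case using zero[of "set js"] True that by (simp add: distinct_card)
    next
      case (swap a b p)
      let ?l = "permute_list p ?e"
      have ab: "a < length ?l" "b < length ?l" and "length ?l = k"
        using swap len by auto
      have "permute_list (p \<circ> Transposition.transpose a b) ?e
          = permute_list (Transposition.transpose a b) ?l"
        using ab by (intro permute_list_compose) (simp add: permutes_swap_id)
      also have "\<dots> = ?l[a := ?l ! b, b := ?l ! a]"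
        using ab by (rule permute_list_transpose)
      finally have eq: "permute_list (p \<circ> Transposition.transpose a b) ?e = ?l[a := ?l ! b, b := ?l ! a]" .
      have "\<alpha> (?l[a := ?l ! b, b := ?l ! a]) = - \<alpha> ?l"
        using ab swap \<open>length ?l = k\<close> by (intro alternating_form_swap[OF assms(1)]) auto
      then show ?case
        unfolding eq using swap by simp
    qed
    then show ?thesis
      using p by (simp add: permute_list_map)
  next
    case False
    then show ?thesis
      using alternating_formD(3)[OF assms(1)] that by (metis distinct_map length_map)
  qed
  \<comment> \<open>Downward induction on the number of leading arguments known to be basis vectors.\<close>
  have "\<alpha> vs = 0" if "length vs = k" "j \<le> k" "\<And>i. i < j \<Longrightarrow> \<exists>l. vs ! i = axis l 1" for j vs
    using that(2,1,3)
  proof (induction j arbitrary: vs rule: inc_induct)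
    case base
    then obtain l where l: "\<And>i. i < k \<Longrightarrow> vs ! i = axis (l i) 1"
      by metis
    have "vs = map (\<lambda>j. axis j 1) (map l [0..<k])"
      using base l by (intro nth_equalityI) auto
    with basis[of "map l [0..<k]"] show ?case by simp
  next
    case (step j)
    have lin: "linear (\<lambda>v. \<alpha> (vs[j := v]))"
      using alternating_formD(2)[OF assms(1)] step by auto
    have "vs ! j = (\<Sum>l\<in>UNIV. (vs ! j $ l) *\<^sub>R axis l 1)"
      by (simp add: vec_eq_iff axis_def if_distrib cong: if_cong)
    then have "\<alpha> vs = \<alpha> (vs[j := (\<Sum>l\<in>UNIV. (vs ! j $ l) *\<^sub>R axis l 1)])"
      by simp
    also have "\<dots> = (\<Sum>l\<in>UNIV. (vs ! j $ l) * \<alpha> (vs[j := axis l 1]))"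
      using linear_sum[OF lin, of "\<lambda>l. (vs ! j $ l) *\<^sub>R axis l 1" UNIV] linear_scale[OF lin] by simp
    also have "\<dots> = 0"
    proof (intro sum.neutral ballI)
      fix l
      have "\<alpha> (vs[j := axis l 1]) = 0"
        by (rule step.IH) (use step in \<open>auto simp: nth_list_update less_Suc_eq\<close>)
      then show "vs ! j $ l * \<alpha> (vs[j := axis l 1]) = 0" by simp
    qed
    finally show ?case .
  qed
  from this[of vs 0] True show ?thesis by simp
qed (use alternating_formD(1)[OF assms(1)] in simp)

lemma alternating_form_diff:
  "alternating_form k \<alpha> \<Longrightarrow> alternating_form k \<beta> \<Longrightarrow> alternating_form k (\<lambda>vs. \<alpha> vs - \<beta> vs)"
  unfolding alternating_form_def by (simp add: linear_compose_sub)

lemma alternating_form_scale: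
  "alternating_form k \<alpha> \<Longrightarrow> alternating_form k (\<lambda>vs. c * \<alpha> vs)"
  unfolding alternating_form_def by (simp add: linear_mult_left)

text \<open>Adding multiples of one vector \<open>w\<close> to the arguments is a first order perturbation, because
  terms in which \<open>w\<close> occurs twice vanish.\<close>

lemma alternating_form_shear:
  assumes "alternating_form k \<alpha>" "length xs = k"
  shows "\<alpha> (map (\<lambda>i. xs ! i + c i *\<^sub>R w) [0..<k]) = \<alpha> xs + (\<Sum>i<k. c i * \<alpha> (xs[i := w]))"
proof -
  \<comment> \<open>The list in which only the first \<open>j\<close> arguments have been sheared.\<close>
  define ys where "ys j xs = map (\<lambda>i. xs ! i + (if i < j then c i else 0) *\<^sub>R w) [0..<k]" for j xs
  have "\<alpha> (ys j xs) = \<alpha> xs + (\<Sum>i<j. c i * \<alpha> (xs[i := w]))"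
    if "j \<le> k" "length xs = k" for j xs
    using that
  proof (induction j arbitrary: xs)
    case 0
    then have "ys 0 xs = xs" unfolding ys_def by (intro nth_equalityI) auto
    then show ?case by simp
  next
    case (Suc j)
    have len: "length (ys j xs) = k" "j < k" using Suc by (auto simp: ys_def)
    have 1: "ys (Suc j) xs = (ys j xs)[j := xs ! j + c j *\<^sub>R w]"
      and 2: "(ys j xs)[j := xs ! j] = ys j xs"
      and 3: "(ys j xs)[j := w] = ys j (xs[j := w])"
      unfolding ys_def using len Suc.prems
      by (auto intro!: nth_equalityI simp: nth_list_update less_Suc_eq)
    have "\<alpha> (xs[j := w, i := w]) = 0" if "i < j" for i
      by (intro alternating_formD(3)[OF assms(1)] not_distinctI[of i _ j])
        (use Suc.prems that in auto)
    then have "\<alpha> (ys j (xs[j := w])) = \<alpha> (xs[j := w])"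
      using Suc.IH[of "xs[j := w]"] Suc.prems by simp
    then show ?case
      unfolding 1 alternating_form_add_scale[OF assms(1) len] 2 3
      using Suc.IH[of xs] Suc.prems by simp
  qed
  moreover have "ys k xs = map (\<lambda>i. xs ! i + c i *\<^sub>R w) [0..<k]"
    unfolding ys_def by (intro map_cong) auto
  ultimately show ?thesis using assms(2) by (metis order_refl)
qed

section \<open>The volume form\<close>

text \<open>The position of an index in increasing order, which turns families of vectors indexed by \<open>'n\<close>
  into lists; it is also the exponent in the sign of a coordinate torus.\<close>

definition pos :: "'n::{finite,linorder} \<Rightarrow> nat" where
  "pos i = card {l. l < i}"

lemma nth_sorted_pos:
  assumes "i \<in> S"
  shows "sorted_list_of_set S ! card {l \<in> S. l < i} = (i::'n::{finite,linorder})"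
    and "card {l \<in> S. l < i} < card S"
proof -
  show "card {l \<in> S. l < i} < card S"
    using assms by (intro psubset_card_mono) auto
  let ?s = "sorted_list_of_set S"
  obtain p where p: "p < length ?s" "?s ! p = i"
    using assms by (metis finite in_set_conv_nth set_sorted_list_of_set)
  have "{l \<in> S. l < i} = (\<lambda>q. ?s ! q) ` {..<p}"
  proof (intro set_eqI iffI)
    fix l assume "l \<in> {l \<in> S. l < i}"
    then obtain q where q: "q < length ?s" "?s ! q = l" "l < i"
      by (metis (mono_tags, lifting) finite in_set_conv_nth mem_Collect_eq set_sorted_list_of_set)
    have "q < p"
    proof (rule ccontr)
      assume "\<not> q < p"
      then have "?s ! p \<le> ?s ! q" using q by (intro sorted_nth_mono) auto
      then show False using q p by simp
    qed
    then show "l \<in> (\<lambda>q. ?s ! q) ` {..<p}" using q by auto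
  next
    fix l assume "l \<in> (\<lambda>q. ?s ! q) ` {..<p}"
    then obtain q where q: "q < p" "l = ?s ! q" by auto
    then have "?s ! q < ?s ! p"
      using p by (metis finite order.strict_trans sorted_wrt_nth_less strict_sorted_list_of_set)
    moreover have "l \<in> S" using q p by (metis finite nth_mem order.strict_trans set_sorted_list_of_set)
    ultimately show "l \<in> {l \<in> S. l < i}" using q p by simp
  qed
  moreover have "inj_on (\<lambda>q. ?s ! q) {..<p}"
    using p by (auto simp: inj_on_def nth_eq_iff_index_eq)
  ultimately have "card {l \<in> S. l < i} = p"
    by (simp add: card_image)
  then show "?s ! card {l \<in> S. l < i} = i" using p by simp
qed

lemma nth_pos: "sorted_list_of_set UNIV ! pos i = i"
  and pos_less: "pos (i::'n::{finite,linorder}) < CARD('n)"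
  using nth_sorted_pos[of i UNIV] by (simp_all add: pos_def)

lemma pos_inj: "pos i = pos j \<longleftrightarrow> i = j"
  using nth_pos by metis

lemma pos_nth:
  assumes "p < CARD('n)"
  shows "pos (sorted_list_of_set UNIV ! p :: 'n::{finite,linorder}) = p"
  using nth_pos[of "sorted_list_of_set UNIV ! p"] pos_less[of "sorted_list_of_set UNIV ! p :: 'n"] assms
  by (metis distinct_sorted_list_of_set finite length_sorted_list_of_set nth_eq_iff_index_eq)

lemma pos_bij: "bij_betw pos (UNIV :: 'n::{finite,linorder} set) {..<CARD('n)}"
proof (rule bij_betw_byWitness[where f' = "\<lambda>p. sorted_list_of_set UNIV ! p"])
  show "pos ` (UNIV :: 'n set) \<subseteq> {..<CARD('n)}" using pos_less[where 'n='n] by auto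
qed (simp_all add: nth_pos pos_nth)

text \<open>Zero on lists of the wrong length, in keeping with \<^const>\<open>alternating_form\<close>.\<close>

definition vol :: "(real ^ 'n::{finite,linorder}) list \<Rightarrow> real" where
  "vol vs = (if length vs = CARD('n) then det (\<chi> i. vs ! pos i :: real ^ 'n::_ ^ 'n::_) else 0)"

lemma alternating_form_vol: "alternating_form CARD('n) (vol :: (real ^ 'n::{finite,linorder}) list \<Rightarrow> real)"
  unfolding alternating_form_def
proof (intro conjI allI impI)
  fix vs :: "(real ^ 'n::_) list" and p
  assume a: "length vs = CARD('n) \<and> p < CARD('n)"
  let ?i = "sorted_list_of_set UNIV ! p :: 'n"
  have "vol (vs[p := v]) = det (\<chi> i. if i = ?i then v else vs ! pos i)" for v
  proof -
    have "(\<chi> i. vs[p := v] ! pos i :: real ^ 'n::_ ^ 'n::_) = (\<chi> i. if i = ?i then v else vs ! pos i)"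
      using a by (auto simp: vec_eq_iff nth_list_update pos_nth nth_pos pos_less)
    then show ?thesis using a by (simp add: vol_def)
  qed
  note eq = this
  show "linear (\<lambda>v. vol (vs[p := v]))"
  proof (rule linearI)
    show "vol (vs[p := u + v]) = vol (vs[p := u]) + vol (vs[p := v])" for u v
      by (simp add: eq det_row_add)
    have "vol (vs[p := r *s v]) = r * vol (vs[p := v])" for r v
      by (simp add: eq det_row_mul)
    then show "vol (vs[p := r *\<^sub>R v]) = r *\<^sub>R vol (vs[p := v])" for r v
      by (simp add: scalar_mult_eq_scaleR)
  qed
next
  fix vs :: "(real ^ 'n::_) list"
  assume a: "length vs = CARD('n) \<and> \<not> distinct vs"
  then obtain p q where pq: "p < CARD('n)" "q < CARD('n)" "p \<noteq> q" "vs ! p = vs ! q"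
    by (metis distinct_conv_nth)
  let ?A = "\<chi> i. vs ! pos i :: real ^ 'n::_ ^ 'n::_"
  have "det ?A = 0"
    by (rule det_identical_rows[of "sorted_list_of_set UNIV ! p" "sorted_list_of_set UNIV ! q"])
      (use pq in \<open>auto simp: row_def pos_nth vec_eq_iff nth_eq_iff_index_eq\<close>)
  then show "vol vs = 0" by (simp add: vol_def)
qed (simp add: vol_def)

lemma nth_map_pos:
  "map f (sorted_list_of_set UNIV) ! pos i = f (i::'n::{finite,linorder})"
  by (simp add: nth_pos pos_less)

lemma vol_basis: "vol (map (\<lambda>i. axis i 1) (sorted_list_of_set UNIV) :: (real ^ 'n::{finite,linorder}) list) = 1"
proof -
  have "(\<chi> i. axis i 1 :: real ^ 'n::_ ^ 'n::_) = mat 1"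
    by (auto simp: vec_eq_iff mat_def axis_def)
  then show ?thesis by (simp add: vol_def nth_map_pos)
qed

lemma alternating_form_eq_vol:
  fixes \<alpha> :: "(real ^ 'n::{finite,linorder}) list \<Rightarrow> real"
  assumes "alternating_form CARD('n) \<alpha>"
  shows "\<alpha> vs = \<alpha> (map (\<lambda>i. axis i 1) (sorted_list_of_set UNIV)) * vol vs"
proof -
  let ?c = "\<alpha> (map (\<lambda>i. axis i 1) (sorted_list_of_set UNIV))"
  have "(\<lambda>vs. \<alpha> vs - ?c * vol vs) vs = 0"
  proof (rule alternating_form_eq_0[where \<alpha> = "\<lambda>vs. \<alpha> vs - ?c * vol vs" and k = "CARD('n)"])
    show "alternating_form CARD('n) (\<lambda>vs. \<alpha> vs - ?c * vol vs)"
      by (intro alternating_form_diff alternating_form_scale alternating_form_vol assms)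
    fix J :: "'n set" assume "card J = CARD('n)"
    then have "J = UNIV" by (simp add: card_eq_UNIV_imp_eq_UNIV)
    then show "\<alpha> (map (\<lambda>j. axis j 1) (sorted_list_of_set J))
        - ?c * vol (map (\<lambda>j. axis j 1) (sorted_list_of_set J)) = 0"
      by (simp add: vol_basis)
  qed
  then show ?thesis by simp
qed

lemma vol_axis_facet:
  fixes i :: "'n::{finite,linorder}"
  shows "vol (X # map (\<lambda>j. axis j 1) (sorted_list_of_set (UNIV - {i}))) = (- 1) ^ pos i * X $ i"
proof -
  let ?s = "sorted_list_of_set (UNIV - {i})" and ?u = "sorted_list_of_set (UNIV :: 'n set)"
  let ?e = "\<lambda>j::'n. axis j 1 :: real ^ 'n::_"
  have len: "Suc (length ?s) = CARD('n)"
    by (simp add: card_gt_0_iff)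
  have u: "?u = take (pos i) ?u @ i # drop (Suc (pos i)) ?u"
    by (metis id_take_nth_drop length_sorted_list_of_set nth_pos pos_less)
  have "distinct ?u" by simp
  then have "i \<notin> set (take (pos i) ?u @ drop (Suc (pos i)) ?u)"
    by (subst (asm) u) auto
  moreover have "?s = remove1 i ?u"
    by (metis finite sorted_list_of_set_remove)
  ultimately have s: "?s = take (pos i) ?u @ drop (Suc (pos i)) ?u"
    by (subst (asm) (3) u) (auto simp: remove1_append)
  have lin: "linear (\<lambda>v. vol (v # map ?e ?s))"
    using alternating_formD(2)[OF alternating_form_vol, of "X # map ?e ?s" 0] len by simp
  have "X = (\<Sum>j\<in>UNIV. (X $ j) *\<^sub>R ?e j)"
    by (simp add: vec_eq_iff axis_def if_distrib cong: if_cong)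
  then have "vol (X # map ?e ?s) = vol ((\<Sum>j\<in>UNIV. (X $ j) *\<^sub>R ?e j) # map ?e ?s)"
    by simp
  also have "\<dots> = (\<Sum>j\<in>UNIV. X $ j * vol (?e j # map ?e ?s))"
    using linear_sum[OF lin, of "\<lambda>j. (X $ j) *\<^sub>R ?e j" UNIV] linear_scale[OF lin] by simp
  also have "\<dots> = X $ i * vol (?e i # map ?e ?s)"
  proof -
    have "X $ j * vol (?e j # map ?e ?s) = 0" if "j \<in> UNIV - {i}" for j
    proof -
    from that have "\<not> distinct (?e j # map ?e ?s)" by auto
    then have "vol (?e j # map ?e ?s) = 0"
      using alternating_formD(3)[OF alternating_form_vol] len by (metis length_Cons length_map)
    then show ?thesis by simp
    qed
    then have "(\<Sum>j\<in>UNIV. X $ j * vol (?e j # map ?e ?s)) = (\<Sum>j\<in>{i}. X $ j * vol (?e j # map ?e ?s))"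
      by (intro sum.mono_neutral_right) auto
    then show ?thesis by simp
  qed
  also have "vol (?e i # map ?e ?s) = (- 1) ^ pos i"
  proof -
    have "map ?e ?s = take (pos i) (map ?e ?u) @ drop (Suc (pos i)) (map ?e ?u)"
      by (simp add: s take_map drop_map)
    moreover have "(map ?e ?u)[pos i := ?e i] = map ?e ?u"
      by (metis list_update_id nth_map_pos)
    ultimately show ?thesis
      using alternating_form_replace[OF alternating_form_vol, of "map ?e ?u" "pos i" "?e i"]
      by (simp add: pos_less vol_basis)
  qed
  finally show ?thesis by simp
qed

text \<open>Codimension-one forms are fluxes: interior products of the volume form.\<close>

lemma alternating_form_eq_flux:
  fixes \<alpha> :: "(real ^ 'n::{finite,linorder}) list \<Rightarrow> real"
  assumes "alternating_form m \<alpha>" "CARD('n) = Suc m"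
  shows "\<alpha> vs = vol ((\<chi> i. (- 1) ^ pos i
           * \<alpha> (map (\<lambda>j. axis j 1) (sorted_list_of_set (UNIV - {i})))) # vs)"
proof -
  define Y :: "real ^ 'n::_" where
    "Y = (\<chi> i. (- 1) ^ pos i * \<alpha> (map (\<lambda>j. axis j 1) (sorted_list_of_set (UNIV - {i}))))"
  have "(\<lambda>vs. \<alpha> vs - vol (Y # vs)) vs = 0"
  proof (rule alternating_form_eq_0[where \<alpha> = "\<lambda>vs. \<alpha> vs - vol (Y # vs)" and k = m])
    show "alternating_form m (\<lambda>vs. \<alpha> vs - vol (Y # vs))"
      using alternating_form_vol[where 'n='n] assms(2)
      by (intro alternating_form_diff alternating_form_interior assms) simp
    fix J :: "'n set" assume "card J = m"
    then have "card (- J) = 1"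
      by (simp add: Compl_eq_Diff_UNIV card_Diff_subset assms)
    then obtain i where "- J = {i}" by (auto simp: card_1_singleton_iff)
    then have "J = UNIV - {i}" by auto
    then show "\<alpha> (map (\<lambda>j. axis j 1) (sorted_list_of_set J))
        - vol (Y # map (\<lambda>j. axis j 1) (sorted_list_of_set J)) = 0"
      by (simp add: vol_axis_facet Y_def flip: mult.assoc power_mult_distrib)
  qed
  then show ?thesis by (simp add: Y_def)
qed

text \<open>This is \<open>\<theta> \<and> \<iota>\<^sub>X vol = \<theta>(X) vol\<close>.\<close>

lemma sum_wedge_flux:
  fixes vs :: "(real ^ 'n::{finite,linorder}) list"
  assumes "linear \<theta>" "length vs = CARD('n)"
  shows "(\<Sum>i<CARD('n). (- 1) ^ i * \<theta> (vs ! i) * vol (X # take i vs @ drop (Suc i) vs)) = \<theta> X * vol vs"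
proof -
  let ?n = "CARD('n)"
  \<comment> \<open>The left-hand side is itself an alternating \<open>n\<close>-form, so it suffices to evaluate it on the standard basis.\<close>
  define \<beta> where "\<beta> vs = (if length vs = ?n then \<Sum>i<?n. \<theta> (vs ! i) * vol (vs[i := X]) else 0)"
    for vs :: "(real ^ 'n::_) list"
  have 1: "(\<Sum>i<?n. (- 1) ^ i * \<theta> (vs ! i) * vol (X # take i vs @ drop (Suc i) vs)) = \<beta> vs"
    using alternating_form_replace[OF alternating_form_vol assms(2)] assms(2)
    by (auto simp: \<beta>_def intro!: sum.cong simp flip: mult.assoc power_mult_distrib)
  have "alternating_form ?n \<beta>"
    unfolding alternating_form_def
  proof (intro conjI allI impI)
    fix vs :: "(real ^ 'n::_) list" and j assume a: "length vs = ?n \<and> j < ?n"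
    have "linear (\<lambda>v. \<theta> (vs[j := v] ! i) * vol (vs[j := v, i := X]))" if "i < ?n" for i
    proof (cases "i = j")
      case True
      then show ?thesis
        using a linear_compose_scale_right[OF assms(1), of "vol (vs[j := X])"]
        by (simp add: mult.commute)
    next
      case False
      then have "vs[j := v, i := X] = vs[i := X, j := v]" for v
        by (intro list_update_swap) auto
      then show ?thesis
        using False a linear_mult_left[OF alternating_formD(2)[OF alternating_form_vol, of "vs[i := X]" j], of "\<theta> (vs ! i)"]
        by simp
    qed
    then show "linear (\<lambda>v. \<beta> (vs[j := v]))"
      using a by (auto simp: \<beta>_def intro!: linear_compose_sum)
  next
    fix vs :: "(real ^ 'n::_) list" assume a: "length vs = ?n \<and> \<not> distinct vs"
    then obtain p q where pq: "p < ?n" "q < ?n" "p \<noteq> q" "vs ! p = vs ! q"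
      by (metis distinct_conv_nth)
    have "\<theta> (vs ! i) * vol (vs[i := X]) = 0" if "i < ?n" "i \<noteq> p" "i \<noteq> q" for i
    proof -
      have "\<not> distinct (vs[i := X])"
        using a pq that by (intro not_distinctI[of p _ q]) auto
      then show ?thesis using alternating_formD(3)[OF alternating_form_vol, of "vs[i := X]"] a by simp
    qed
    then have "\<beta> vs = (\<Sum>i\<in>{p, q}. \<theta> (vs ! i) * vol (vs[i := X]))"
      unfolding \<beta>_def using a pq by (simp del: sum.insert) (intro sum.mono_neutral_right; auto)
    also have "vs[q := X] = (vs[p := X])[p := vs[p := X] ! q, q := vs[p := X] ! p]"
      using pq a by (auto intro!: nth_equalityI simp: nth_list_update)
    then have "vol (vs[q := X]) = - vol (vs[p := X])"
      using alternating_form_swap[OF alternating_form_vol, of "vs[p := X]" p q] a pq by simp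
    then have "(\<Sum>i\<in>{p, q}. \<theta> (vs ! i) * vol (vs[i := X])) = 0"
      using pq by simp
    finally show "\<beta> vs = 0" .
  qed (simp add: \<beta>_def)
  from alternating_form_eq_vol[OF this]
  have "\<beta> vs = \<beta> (map (\<lambda>i. axis i 1) (sorted_list_of_set UNIV)) * vol vs" .
  also have "\<beta> (map (\<lambda>i. axis i 1) (sorted_list_of_set UNIV)) = \<theta> X"
  proof -
    let ?e = "map (\<lambda>i. axis i 1) (sorted_list_of_set UNIV) :: (real ^ 'n::_) list"
    have v: "vol (?e[pos i := X]) = X $ i" for i
    proof -
      have "(\<chi> j. ?e[pos i := X] ! pos j) = (\<chi> j. if j = i then X else axis j 1 :: real ^ 'n::_ ^ 'n::_)"
        by (auto simp: vec_eq_iff nth_list_update pos_inj nth_map_pos pos_less)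
      moreover have "det (\<chi> j. if j = i then X else axis j 1 :: real ^ 'n::_ ^ 'n::_) = X $ i"
      proof -
        have e: "(\<chi> k. if k = i then X else row k (mat 1)) = (\<chi> j. if j = i then X else axis j 1 :: real ^ 'n::_ ^ 'n::_)"
          by (auto simp: vec_eq_iff row_def mat_def axis_def)
        have s: "(\<Sum>j\<in>UNIV. (X $ j) *s row j (mat 1 :: real ^ 'n::_ ^ 'n::_)) = X"
          by (simp add: vec_eq_iff row_def mat_def if_distrib cong: if_cong)
        show ?thesis
          using cramer_lemma_transpose[of i X "mat 1 :: real ^ 'n::_ ^ 'n::_"] unfolding s e by simp
      qed
      ultimately show ?thesis by (simp add: vol_def)
    qed
    have "\<beta> ?e = (\<Sum>i\<in>UNIV. \<theta> (axis i 1) * X $ i)"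
      unfolding \<beta>_def
      by (simp add: v nth_map_pos nth_pos sum.reindex_bij_betw[OF pos_bij, symmetric])
    also have "\<dots> = \<theta> (\<Sum>i\<in>UNIV. (X $ i) *\<^sub>R axis i 1)"
      using assms(1) by (simp add: linear_sum linear_scale mult.commute)
    also have "(\<Sum>i\<in>UNIV. (X $ i) *\<^sub>R axis i 1) = X"
      by (simp add: vec_eq_iff axis_def if_distrib cong: if_cong)
    finally show ?thesis .
  qed
  finally show ?thesis using 1 by simp
qed

lemma vol_linear_image:
  fixes vs :: "(real ^ 'n::{finite,linorder}) list"
  shows "vol (map ((*v) L) vs) = det L * vol vs"
proof (cases "length vs = CARD('n)")
  case True
  have "(\<chi> i. map ((*v) L) vs ! pos i :: real ^ 'n::_ ^ 'n::_) = (\<chi> i. vs ! pos i) ** transpose L"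
    using True by (simp add: vec_eq_iff matrix_matrix_mult_def matrix_vector_mult_def
        Finite_Cartesian_Product.transpose_def pos_less mult.commute)
  then show ?thesis using True by (simp add: vol_def det_mul)
qed (simp add: vol_def)

lemma vol_squared_Gram:
  fixes vs :: "(real ^ 'n::{finite,linorder}) list"
  assumes "length vs = CARD('n)"
  shows "(vol vs)\<^sup>2 * det G = det (\<chi> i j. vs ! pos i \<bullet> (G *v vs ! pos j) :: real ^ 'n::_ ^ 'n::_)"
proof -
  let ?V = "\<chi> i. vs ! pos i :: real ^ 'n::_ ^ 'n::_"
  have "(\<chi> i j. vs ! pos i \<bullet> (G *v vs ! pos j)) = ?V ** (G ** transpose ?V)"
    by (simp add: vec_eq_iff matrix_matrix_mult_def matrix_vector_mult_def transpose_def inner_vec_def)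
  then show ?thesis
    using assms by (simp add: vol_def det_mul power2_eq_square)
qed

text \<open>The inclusion of \<open>\<real>\<^sup>n\<^sup>-\<^sup>1\<close> as the hyperplane on which the first coordinate vanishes.\<close>

definition pad_vec :: "real ^ 'm::{finite,linorder} \<Rightarrow> real ^ 'n::{finite,linorder}" where
  "pad_vec v = (\<Sum>a\<in>UNIV. v $ a *\<^sub>R axis (sorted_list_of_set UNIV ! Suc (pos a)) 1)"

lemma pad_vec_nth:
  assumes "CARD('n::{finite,linorder}) = Suc CARD('m::{finite,linorder})"
  shows "(pad_vec v :: real ^ 'n::_) $ j = (if pos j = 0 then 0
           else (v :: real ^ 'm::_) $ (sorted_list_of_set UNIV ! (pos j - 1)))"
proof -
  have eq: "j = sorted_list_of_set UNIV ! Suc (pos a) \<longleftrightarrow> Suc (pos a) = pos j" for a :: 'm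
    using pos_less[of a] assms pos_nth nth_pos by (metis Suc_less_eq)
  have "(pad_vec v :: real ^ 'n::_) $ j = (\<Sum>a\<in>UNIV. if Suc (pos a) = pos j then v $ a else 0)"
    by (simp add: pad_vec_def axis_def eq if_distrib cong: if_cong)
  also have "\<dots> = (if pos j = 0 then 0 else v $ (sorted_list_of_set UNIV ! (pos j - 1)))"
  proof (cases "pos j")
    case (Suc p)
    then have "p < CARD('m)" using pos_less[of j] assms by simp
    then have "Suc (pos a) = pos j \<longleftrightarrow> a = sorted_list_of_set UNIV ! p" for a :: 'm
      using Suc pos_nth nth_pos by (metis Suc_inject)
    then show ?thesis using Suc by simp
  qed simp
  finally show ?thesis .
qed

text \<open>Expansion of a determinant along a unit first row.  Both sides are alternating forms on \<open>\<real>\<^sup>n\<^sup>-\<^sup>1\<close>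
  that agree on the standard basis.\<close>

lemma vol_pad:
  fixes vs :: "(real ^ 'm::{finite,linorder}) list"
  assumes "CARD('n::{finite,linorder}) = Suc CARD('m)"
  shows "vol ((axis (sorted_list_of_set UNIV ! 0) 1 :: real ^ 'n::_) # map pad_vec vs) = vol vs"
proof -
  let ?i = "sorted_list_of_set UNIV ! 0 :: 'n" and ?s = "sorted_list_of_set (UNIV :: 'n set)"
  let ?\<alpha> = "\<lambda>vs :: (real ^ 'm::_) list. vol ((axis ?i 1 :: real ^ 'n::_) # map pad_vec vs)"
  have linpad: "linear (pad_vec :: real ^ 'm::_ \<Rightarrow> real ^ 'n::_)"
    unfolding pad_vec_def
    by (intro linearI) (simp_all add: sum.distrib scaleR_add_left scaleR_sum_right)
  have "alternating_form CARD('m) ?\<alpha>"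
    unfolding alternating_form_def
  proof (intro conjI allI impI)
    fix vs :: "(real ^ 'm::_) list" and j assume a: "length vs = CARD('m) \<and> j < CARD('m)"
    have "linear ((\<lambda>v. vol (((axis ?i 1 :: real ^ 'n::_) # map pad_vec vs)[Suc j := v])) \<circ> (pad_vec :: real ^ 'm::_ \<Rightarrow> real ^ 'n::_))"
      by (intro linear_compose linpad alternating_formD(2)[OF alternating_form_vol]) (use a assms in auto)
    then show "linear (\<lambda>v. ?\<alpha> (vs[j := v]))"
      by (simp add: o_def map_update)
  next
    fix vs :: "(real ^ 'm::_) list" assume a: "length vs = CARD('m) \<and> \<not> distinct vs"
    then show "?\<alpha> vs = 0"
      by (intro alternating_formD(3)[OF alternating_form_vol]) (auto simp: assms distinct_map)
  qed (simp add: vol_def assms)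
  from alternating_form_eq_vol[OF this, of vs]
  have "?\<alpha> vs = ?\<alpha> (map (\<lambda>i. axis i 1) (sorted_list_of_set UNIV)) * vol vs" .
  also have "(axis ?i 1 :: real ^ 'n::_) # map pad_vec (map (\<lambda>i. axis i 1 :: real ^ 'm::_) (sorted_list_of_set UNIV))
      = map (\<lambda>i. axis i 1) ?s"
  proof (rule nth_equalityI)
    fix p assume "p < length ((axis ?i 1 :: real ^ 'n::_) # map pad_vec (map (\<lambda>i. axis i 1 :: real ^ 'm::_) (sorted_list_of_set UNIV)))"
    then have p: "p < Suc CARD('m)" by simp
    show "((axis ?i 1 :: real ^ 'n::_) # map pad_vec (map (\<lambda>i. axis i 1 :: real ^ 'm::_) (sorted_list_of_set UNIV))) ! p
        = map (\<lambda>i. axis i 1) ?s ! p"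
    proof (cases p)
      case (Suc q)
      have "(pad_vec (axis (sorted_list_of_set UNIV ! q) 1 :: real ^ 'm::_) :: real ^ 'n::_) = axis (?s ! Suc q) 1"
        using p Suc by (simp add: pad_vec_def axis_def if_distrib pos_nth cong: if_cong)
          (simp add: if_distribR if_distrib pos_nth cong: if_cong)
      then show ?thesis using p Suc assms by simp
    qed (use assms in simp)
  qed (simp add: assms)
  finally show ?thesis by (simp add: vol_basis)
qed

text \<open>The volume spanned with a unit normal vector is the area of the tangent vectors.\<close>

lemma vol_unit_normal_squared:
  fixes V :: "'m::{finite,linorder} \<Rightarrow> real ^ 'n::{finite,linorder}"
  assumes "CARD('n) = Suc CARD('m)" "transpose G = G"
    and "X \<bullet> (G *v X) = 1" "\<And>a. X \<bullet> (G *v V a) = 0"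
  shows "(vol (X # map V (sorted_list_of_set UNIV)))\<^sup>2 * det G = det (\<chi> a b. V a \<bullet> (G *v V b))"
proof -
  let ?vs = "X # map V (sorted_list_of_set UNIV)"
  let ?M = "\<chi> a b. V a \<bullet> (G *v V b)"
  have sym: "u \<bullet> (G *v v) = v \<bullet> (G *v u)" for u v
    by (metis assms(2) dot_lmul_matrix inner_commute transpose_matrix_vector)
  have nth: "?vs ! pos j = (if pos j = 0 then X else V (sorted_list_of_set UNIV ! (pos j - 1)))" for j :: 'n
    using pos_less[of j] assms(1) by (auto simp: nth_Cons')
  \<comment> \<open>The Gram matrix is block diagonal, with a block 1 for the normal vector.\<close>
  have rows: "(\<chi> i j. ?vs ! pos i \<bullet> (G *v ?vs ! pos j) :: real ^ 'n::_ ^ 'n::_) =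
     (\<chi> i. ((axis (sorted_list_of_set UNIV ! 0) 1 :: real ^ 'n::_) #
         map pad_vec (map (\<lambda>a. \<chi> b. V a \<bullet> (G *v V b)) (sorted_list_of_set UNIV))) ! pos i)"
  proof -
    have "?vs ! pos i \<bullet> (G *v ?vs ! pos j) = (((axis (sorted_list_of_set UNIV ! 0) 1 :: real ^ 'n::_) #
         map pad_vec (map (\<lambda>a. \<chi> b. V a \<bullet> (G *v V b)) (sorted_list_of_set UNIV))) ! pos i) $ j" for i j :: 'n
    proof (cases "pos i = 0")
      case True
      have "i = sorted_list_of_set UNIV ! 0" using True nth_pos by metis
      moreover have "pos j = 0 \<longleftrightarrow> j = i" using True pos_inj by metis
      ultimately show ?thesis using True assms(3,4) by (auto simp: nth axis_def)
    next
      case False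
      then show ?thesis
        using pos_less[of i] pos_less[of j] assms(1,4) sym
        by (auto simp: nth_Cons' nth pad_vec_nth[OF assms(1)])
    qed
    then show ?thesis by (simp add: vec_eq_iff del: map_map)
  qed
  have "(vol ?vs)\<^sup>2 * det G = vol ((axis (sorted_list_of_set UNIV ! 0) 1 :: real ^ 'n::_) #
         map pad_vec (map (\<lambda>a. \<chi> b. V a \<bullet> (G *v V b)) (sorted_list_of_set UNIV)))"
    by (subst vol_squared_Gram) (simp_all add: assms(1) rows vol_def)
  also have "\<dots> = det ?M"
    by (subst vol_pad[OF assms(1)]) (simp add: vol_def nth_map_pos vec_lambda_eta)
  finally show ?thesis .
qed

text \<open>Hadamard's inequality for a vector and an orthonormal frame of the remaining dimension:
  the components along the frame do not contribute to the volume.\<close>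

lemma vol_orthonormal_frame_le:
  fixes vs :: "(real ^ 'n::{finite,linorder}) list"
  assumes "CARD('n) = Suc (length vs)" "transpose G = G" "det G = 1"
    and nonneg: "\<And>v. v \<bullet> (G *v v) \<ge> 0"
    and "orthonormal_frame G vs"
  shows "(vol (X # vs))\<^sup>2 \<le> X \<bullet> (G *v X)"
proof -
  let ?k = "length vs"
  have sym: "u \<bullet> (G *v v) = v \<bullet> (G *v u)" for u v
    by (metis assms(2) dot_lmul_matrix inner_commute transpose_matrix_vector)
  \<comment> \<open>The component of \<open>X\<close> orthogonal to the frame; the Gram matrix with \<open>W\<close> in place of \<open>X\<close> is diagonal.\<close>
  define W where "W = X - (\<Sum>i<?k. (X \<bullet> (G *v vs ! i)) *\<^sub>R vs ! i)"
  have Wv: "W \<bullet> (G *v vs ! j) = 0" if "j < ?k" for j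
  proof -
    have "(\<Sum>i<?k. (X \<bullet> (G *v vs ! i)) * (vs ! i \<bullet> (G *v vs ! j)))
        = (\<Sum>i<?k. if i = j then X \<bullet> (G *v vs ! i) else 0)"
      using assms(5) that by (intro sum.cong) (auto simp: orthonormal_frame_def)
    also have "\<dots> = X \<bullet> (G *v vs ! j)" using that by simp
    finally show ?thesis by (simp add: W_def inner_diff_left inner_sum_left)
  qed
  have "vol (X # vs) = vol (W # vs)"
  proof -
    have lin: "linear (\<lambda>v. vol (v # vs))"
      using alternating_formD(2)[OF alternating_form_vol, of "X # vs" 0] assms(1) by simp
    have "vol (vs ! i # vs) = 0" if "i < ?k" for i
      by (rule alternating_formD(3)[OF alternating_form_vol]) (use assms(1) that in auto)
    then show ?thesis
      unfolding W_def
      by (simp add: linear_diff[OF lin] linear_sum[OF lin] linear_scale[OF lin])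
  qed
  also have "(vol (W # vs))\<^sup>2 = det (\<chi> i j. (W # vs) ! pos i \<bullet> (G *v (W # vs) ! pos j) :: real ^ 'n::_ ^ 'n::_)"
    using vol_squared_Gram[of "W # vs" G] assms(1,3) by simp
  also have "\<dots> = (\<Prod>i\<in>UNIV. (W # vs) ! pos i \<bullet> (G *v (W # vs) ! pos (i::'n)))"
  proof (subst det_diagonal)
    fix i j :: 'n assume "i \<noteq> j"
    then have ne: "pos i \<noteq> pos j" by (simp add: pos_inj)
    show "(\<chi> i j. (W # vs) ! pos i \<bullet> (G *v (W # vs) ! pos j)) $ i $ j = 0"
      using ne Wv pos_less[of i] pos_less[of j] assms(1,5) sym
      by (auto simp: nth_Cons' orthonormal_frame_def)
  qed simp
  also have "\<dots> = (\<Prod>p<CARD('n). (W # vs) ! p \<bullet> (G *v (W # vs) ! p))"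
    by (rule prod.reindex_bij_betw[OF pos_bij])
  also have "\<dots> = W \<bullet> (G *v W)"
    unfolding assms(1) prod.lessThan_Suc_shift
    using assms(5) by (simp add: orthonormal_frame_def)
  also have "\<dots> = X \<bullet> (G *v X) - (\<Sum>i<?k. (X \<bullet> (G *v vs ! i))\<^sup>2)"
  proof -
    have "W \<bullet> (G *v W) = W \<bullet> (G *v X)"
      using Wv by (subst (2) W_def) (simp add: matrix_vector_mult_diff_distrib inner_diff_right
          matrix_vector_mult_scaleR inner_sum_right
          linear_sum[OF matrix_vector_mul_linear, of G "\<lambda>i. (X \<bullet> (G *v vs ! i)) *\<^sub>R vs ! i"])
    also have "\<dots> = X \<bullet> (G *v X) - (\<Sum>i<?k. (X \<bullet> (G *v vs ! i)) * (vs ! i \<bullet> (G *v X)))"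
      by (simp add: W_def inner_diff_left inner_sum_left)
    also have "(\<Sum>i<?k. (X \<bullet> (G *v vs ! i)) * (vs ! i \<bullet> (G *v X))) = (\<Sum>i<?k. (X \<bullet> (G *v vs ! i))\<^sup>2)"
      by (intro sum.cong refl) (metis sym power2_eq_square)
    finally show ?thesis .
  qed
  also have "\<dots> \<le> X \<bullet> (G *v X)" by (simp add: sum_nonneg)
  finally show ?thesis .
qed

section \<open>Integrals of periodic functions\<close>

lemma sum_Basis_nth: "(\<Sum>x\<in>Basis. (x :: real ^ 'k) $ i) = 1"
proof -
  have "(\<Sum>x\<in>Basis. (x :: real ^ 'k) $ i) = (One :: real ^ 'k) \<bullet> axis i 1"
    by (simp add: cart_eq_inner_axis inner_sum_left)
  also have "\<dots> = 1" by (simp add: inner_sum_left inner_Basis)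
  finally show ?thesis .
qed

definition periodic :: "(real ^ 'k \<Rightarrow> 'b) \<Rightarrow> bool" where
  "periodic f \<longleftrightarrow> (\<forall>x. \<forall>z\<in>int_lattice. f (x + z) = f x)"

lemma axis_int_lattice: "k \<in> \<int> \<Longrightarrow> axis i k \<in> int_lattice"
  by (simp add: int_lattice_def axis_def)

text \<open>The translated cube is cut at the face where the coordinate is 1; the part beyond it, moved back by
  a period, completes the other part to the unit cube.\<close>

lemma integral_periodic_axis:
  fixes P :: "real ^ 'k \<Rightarrow> real"
  assumes "continuous_on UNIV P" "periodic P" "0 \<le> s" "s \<le> 1"
  shows "integral (cbox 0 One) (\<lambda>x. P (x + s *\<^sub>R axis a 1)) = integral (cbox 0 One) P"
proof -
  let ?e = "axis a 1 :: real ^ 'k"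
  have int: "P integrable_on cbox u v" for u v
    using assms(1) continuous_on_subset by (blast intro: integrable_continuous)
  have e: "?e \<in> Basis" by (simp add: axis_in_Basis_iff)
  have b1: "cbox (s *\<^sub>R ?e) (One + s *\<^sub>R ?e) \<inter> {x. x \<bullet> ?e \<le> 1} = cbox (s *\<^sub>R ?e) One"
    unfolding inner_axis inner_real_def mult_1_right interval_split_cart[unfolded interval_cbox_cart]
    by (rule arg_cong[where f = "cbox _"]) (use assms(3) in \<open>auto simp: vec_eq_iff axis_def sum_Basis_nth\<close>)
  have b2: "cbox (s *\<^sub>R ?e) (One + s *\<^sub>R ?e) \<inter> {x. x \<bullet> ?e \<ge> 1} = cbox ?e (One + s *\<^sub>R ?e)"
    unfolding inner_axis inner_real_def mult_1_right interval_split_cart[unfolded interval_cbox_cart]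
    by (rule arg_cong[where f = "\<lambda>u. cbox u _"]) (use assms(4) in \<open>auto simp: vec_eq_iff axis_def sum_Basis_nth\<close>)
  have b3: "cbox 0 One \<inter> {x. x \<bullet> ?e \<le> s} = cbox 0 (One + s *\<^sub>R ?e - ?e)"
    unfolding inner_axis inner_real_def mult_1_right interval_split_cart[unfolded interval_cbox_cart]
    by (rule arg_cong[where f = "cbox _"]) (use assms(4) in \<open>auto simp: vec_eq_iff axis_def sum_Basis_nth\<close>)
  have b4: "cbox 0 One \<inter> {x. x \<bullet> ?e \<ge> s} = cbox (s *\<^sub>R ?e) One"
    unfolding inner_axis inner_real_def mult_1_right interval_split_cart[unfolded interval_cbox_cart]
    by (rule arg_cong[where f = "\<lambda>u. cbox u _"]) (use assms(3) in \<open>auto simp: vec_eq_iff axis_def sum_Basis_nth\<close>)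
  have shift: "integral (cbox ?e (One + s *\<^sub>R ?e)) P = integral (cbox 0 (One + s *\<^sub>R ?e - ?e)) P"
  proof -
    have "P (x + ?e) = P x" for x
      using assms(2) axis_int_lattice[of 1 a] by (simp add: periodic_def)
    then show ?thesis
      using integral_shift_cbox[of ?e ?e "One + s *\<^sub>R ?e" P] by simp
  qed
  have "integral (cbox 0 One) (\<lambda>x. P (x + s *\<^sub>R ?e)) = integral (cbox (s *\<^sub>R ?e) (One + s *\<^sub>R ?e)) P"
    using integral_shift_cbox[of "s *\<^sub>R ?e" "s *\<^sub>R ?e" "One + s *\<^sub>R ?e" P] by simp
  also have "\<dots> = integral (cbox (s *\<^sub>R ?e) One) P + integral (cbox ?e (One + s *\<^sub>R ?e)) P"
    using integral_split[OF int e, of "s *\<^sub>R ?e" "One + s *\<^sub>R ?e" 1] by (simp only: b1 b2)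
  also have "\<dots> = integral (cbox 0 One) P"
    using integral_split[OF int e, of 0 One s] by (simp only: b3 b4 shift add.commute)
  finally show ?thesis .
qed

text \<open>One axis after the other, the integer part of the shift being absorbed by periodicity.\<close>

lemma integral_periodic_translation:
  fixes P :: "real ^ 'k \<Rightarrow> real"
  assumes "continuous_on UNIV P" "periodic P"
  shows "integral (cbox 0 One) (\<lambda>x. P (x + v)) = integral (cbox 0 One) P"
proof -
  have sum_axis: "(\<Sum>i\<in>UNIV. v $ i *\<^sub>R axis i 1) = v"
    by (simp add: vec_eq_iff axis_def if_distrib cong: if_cong)
  have cont: "continuous_on UNIV (\<lambda>x. P (x + u))" for u
    by (intro continuous_on_compose2[OF assms(1)] continuous_intros) auto
  have per: "periodic (\<lambda>x. P (x + u))" for u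
    using assms(2) unfolding periodic_def by (metis add.assoc add.commute)
  have axis: "integral (cbox 0 One) (\<lambda>x. Q (x + s *\<^sub>R axis a 1)) = integral (cbox 0 One) Q"
    if "continuous_on UNIV Q" "periodic Q" for Q :: "real ^ 'k \<Rightarrow> real" and s a
  proof -
    have "Q (x + s *\<^sub>R axis a 1) = Q (x + frac s *\<^sub>R axis a 1)" for x
    proof -
      have "x + s *\<^sub>R axis a 1 = (x + frac s *\<^sub>R axis a 1) + axis a (of_int \<lfloor>s\<rfloor>)"
        by (simp add: vec_eq_iff axis_def frac_def)
      then show ?thesis
        using that(2) axis_int_lattice[of "of_int \<lfloor>s\<rfloor>" a] unfolding periodic_def by (metis Ints_of_int)
    qed
    then show ?thesis
      using integral_periodic_axis[OF that, of "frac s" a] frac_lt_1[of s] by simp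
  qed
  have "integral (cbox 0 One) (\<lambda>x. P (x + (\<Sum>i\<in>I. v $ i *\<^sub>R axis i 1))) = integral (cbox 0 One) P"
    if "finite I" for I
    using that
  proof (induction I)
    case (insert i I)
    show ?case
      using axis[OF cont[of "\<Sum>i\<in>I. v $ i *\<^sub>R axis i 1"] per[of "\<Sum>i\<in>I. v $ i *\<^sub>R axis i 1"], of "v $ i" i] insert
      by (simp add: add.assoc)
  qed simp
  from this[of UNIV] show ?thesis
    unfolding sum_axis by simp
qed

lemma periodic_derivative:
  fixes P :: "real ^ 'k \<Rightarrow> real"
  assumes "\<And>x. (P has_derivative P' x) (at x)" "periodic P"
  shows "periodic P'"
  unfolding periodic_def
proof (intro allI ballI)
  fix x z :: "real ^ 'k" assume z: "z \<in> int_lattice"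
  have "((\<lambda>y. P (y + z)) has_derivative P' (x + z)) (at x)"
    by (rule has_derivative_compose[of "\<lambda>y. y + z" "\<lambda>v. v" x UNIV P "P' (x + z)"])
      (auto intro!: derivative_eq_intros assms(1))
  moreover have "(\<lambda>y. P (y + z)) = P"
    using assms(2) z by (auto simp: periodic_def)
  ultimately show "P' (x + z) = P' x"
    using assms(1)[of x] has_derivative_unique by metis
qed

text \<open>Averaging over translates along the axis turns the integral of a partial derivative into
  that of a difference over a period.\<close>

lemma integral_partial_periodic:
  fixes P :: "real ^ 'k \<Rightarrow> real"
  assumes d: "\<And>x. (P has_derivative P' x) (at x)" and "periodic P"
    and cont: "continuous_on UNIV (\<lambda>x. P' x (axis a 1))"
  shows "integral (cbox 0 One) (\<lambda>x. P' x (axis a 1)) = 0"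
proof -
  let ?e = "axis a 1 :: real ^ 'k"
  have per: "periodic (\<lambda>x. P' x ?e)"
    using periodic_derivative[OF assms(1,2)] by (simp add: periodic_def)
  have "integral (cbox 0 One) (\<lambda>x. P' x ?e)
      = integral (cbox 0 (1::real)) (\<lambda>s. integral (cbox 0 One) (\<lambda>x. P' (x + s *\<^sub>R ?e) ?e))"
    by (simp add: integral_periodic_translation[OF cont per])
  also have "\<dots> = integral (cbox 0 One) (\<lambda>x. integral (cbox 0 (1::real)) (\<lambda>s. P' (x + s *\<^sub>R ?e) ?e))"
    by (rule integral_swap_continuous)
      (auto simp: case_prod_unfold intro!: continuous_on_compose2[OF cont] continuous_intros)
  also have "\<dots> = integral (cbox 0 One) (\<lambda>x::real ^ 'k. 0)"
  proof (rule arg_cong[where f = "integral (cbox 0 One)"], rule ext)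
    fix x
    have "((\<lambda>s. P' (x + s *\<^sub>R ?e) ?e) has_integral P (x + 1 *\<^sub>R ?e) - P (x + 0 *\<^sub>R ?e)) {0..1::real}"
    proof (rule fundamental_theorem_of_calculus)
      fix s :: real
      have "((\<lambda>s. P (x + s *\<^sub>R ?e)) has_derivative (\<lambda>h. P' (x + s *\<^sub>R ?e) (h *\<^sub>R ?e))) (at s)"
        by (rule has_derivative_compose[OF _ d]) (auto intro!: derivative_eq_intros)
      moreover have "P' (x + s *\<^sub>R ?e) (h *\<^sub>R ?e) = h *\<^sub>R P' (x + s *\<^sub>R ?e) ?e" for h
        by (rule linear_scale[OF has_derivative_linear[OF d]])
      ultimately have "((\<lambda>s. P (x + s *\<^sub>R ?e)) has_vector_derivative P' (x + s *\<^sub>R ?e) ?e) (at s)"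
        by (simp add: has_vector_derivative_def)
      then show "((\<lambda>s. P (x + s *\<^sub>R ?e)) has_vector_derivative P' (x + s *\<^sub>R ?e) ?e) (at s within {0..1})"
        by (rule has_vector_derivative_at_within)
    qed simp
    moreover have "P (x + ?e) = P x"
      using assms(2) axis_int_lattice[of 1 a] by (simp add: periodic_def)
    ultimately show "integral (cbox 0 (1::real)) (\<lambda>s. P' (x + s *\<^sub>R ?e) ?e) = 0"
      by (simp add: integral_unique)
  qed
  finally show ?thesis by simp
qed

section \<open>Homology of torus maps\<close>

lemma smooth_formD:
  assumes "smooth_form k \<omega>"
  shows "alternating_form k (\<omega> x)"
    and "((\<lambda>x. \<omega> x vs) has_derivative frechet_derivative (\<lambda>x. \<omega> x vs) (at x)) (at x)"
    and "continuous_on S h \<Longrightarrow> continuous_on S (\<lambda>p. \<omega> (h p) vs)"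
    and "continuous_on S h \<Longrightarrow> continuous_on S (\<lambda>p. frechet_derivative (\<lambda>x. \<omega> x vs) (at (h p)) v)"
    and "linear (frechet_derivative (\<lambda>x. \<omega> x vs) (at x))"
    and "periodic \<omega>"
proof -
  have s: "smooth_on UNIV (\<lambda>x. \<omega> x vs)" and "periodic \<omega>" "alternating_form k (\<omega> x)"
    using assms by (auto simp: smooth_form_def periodic_def)
  then show "alternating_form k (\<omega> x)" "periodic \<omega>" by simp_all
  show d: "((\<lambda>x. \<omega> x vs) has_derivative frechet_derivative (\<lambda>x. \<omega> x vs) (at x)) (at x)"
    by (rule smooth_on_UNIV_D(1)[OF s])
  show "continuous_on S h \<Longrightarrow> continuous_on S (\<lambda>p. \<omega> (h p) vs)"
    by (rule continuous_on_compose2[OF smooth_on_UNIV_D(2)[OF s, of UNIV]]) auto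
  show "continuous_on S h \<Longrightarrow> continuous_on S (\<lambda>p. frechet_derivative (\<lambda>x. \<omega> x vs) (at (h p)) v)"
    by (rule continuous_on_compose2[OF smooth_on_UNIV_D(3)[OF s, of UNIV v]]) auto
  show "linear (frechet_derivative (\<lambda>x. \<omega> x vs) (at x))"
    by (rule has_derivative_linear[OF d])
qed

lemma ext_deriv_Cons:
  assumes "smooth_form k \<omega>" "length vs = k"
  shows "ext_deriv \<omega> x (w # vs) = frechet_derivative (\<lambda>y. \<omega> y vs) (at x) w
    - (\<Sum>j<k. frechet_derivative (\<lambda>y. \<omega> y (vs[j := w])) (at x) (vs ! j))"
proof -
  have "frechet_derivative (\<lambda>y. \<omega> y (w # take j vs @ drop (Suc j) vs)) (at x) v
      = (- 1) ^ j * frechet_derivative (\<lambda>y. \<omega> y (vs[j := w])) (at x) v" if "j < k" for j v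
  proof -
    have eq: "(\<lambda>y. \<omega> y (w # take j vs @ drop (Suc j) vs)) = (\<lambda>y. (- 1) ^ j * \<omega> y (vs[j := w]))"
      using alternating_form_replace[OF smooth_formD(1)[OF assms(1)] assms(2) that] by blast
    have "((\<lambda>y. (- 1) ^ j * \<omega> y (vs[j := w])) has_derivative
        (\<lambda>v. (- 1) ^ j * frechet_derivative (\<lambda>y. \<omega> y (vs[j := w])) (at x) v)) (at x)"
      by (intro has_derivative_mult_right smooth_formD(2)[OF assms(1)])
    from frechet_derivative_at[OF this] show ?thesis
      unfolding eq by metis
  qed
  then have "(\<Sum>j<k. (- 1) ^ Suc j * frechet_derivative (\<lambda>y. \<omega> y (w # take j vs @ drop (Suc j) vs)) (at x) (vs ! j))
      = (\<Sum>j<k. - frechet_derivative (\<lambda>y. \<omega> y (vs[j := w])) (at x) (vs ! j))"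
    by (intro sum.cong refl) (simp flip: mult.assoc power_mult_distrib)
  then show ?thesis
    by (simp add: ext_deriv_def assms(2) sum.lessThan_Suc_shift sum_negf del: sum.lessThan_Suc)
qed

text \<open>The currents that are boundaries; unlike \<^const>\<open>homologous\<close> the notion is visibly linear.\<close>

definition null_homologous :: "nat \<Rightarrow> ('n::finite form \<Rightarrow> real) \<Rightarrow> bool" where
  "null_homologous k S \<longleftrightarrow>
     (\<exists>U. current (Suc k) U \<and> (\<forall>\<omega>. smooth_form k \<omega> \<longrightarrow> S \<omega> = U (ext_deriv \<omega>)))"

lemma homologous_iff: "homologous k S T \<longleftrightarrow> null_homologous k (\<lambda>\<omega>. S \<omega> - T \<omega>)"
  by (simp add: homologous_def null_homologous_def)

lemma current_add:
  fixes S T :: "'n::finite form \<Rightarrow> real"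
  assumes "current k S" "current k T"
  shows "current k (\<lambda>\<omega>. S \<omega> + T \<omega>)"
  unfolding current_def
proof (intro conjI allI impI)
  fix W :: "nat \<Rightarrow> 'n form" assume "(\<forall>m. smooth_form k (W m)) \<and>
      (\<forall>ds vs. uniform_limit UNIV (\<lambda>m. iter_deriv ds (\<lambda>y. W m y vs)) (\<lambda>_. 0) sequentially)"
  then have "(\<lambda>m. S (W m)) \<longlonglongrightarrow> 0" "(\<lambda>m. T (W m)) \<longlonglongrightarrow> 0"
    using assms unfolding current_def by blast+
  from tendsto_add[OF this] show "(\<lambda>m. S (W m) + T (W m)) \<longlonglongrightarrow> 0"
    by simp
qed (use assms in \<open>simp_all add: current_def distrib_left\<close>)

lemma current_scale:
  fixes S :: "'n::finite form \<Rightarrow> real"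
  assumes "current k S"
  shows "current k (\<lambda>\<omega>. c * S \<omega>)"
  unfolding current_def
proof (intro conjI allI impI)
  fix W :: "nat \<Rightarrow> 'n form" assume "(\<forall>m. smooth_form k (W m)) \<and>
      (\<forall>ds vs. uniform_limit UNIV (\<lambda>m. iter_deriv ds (\<lambda>y. W m y vs)) (\<lambda>_. 0) sequentially)"
  then have "(\<lambda>m. S (W m)) \<longlonglongrightarrow> 0"
    using assms unfolding current_def by blast
  from tendsto_mult_left[OF this, of c] show "(\<lambda>m. c * S (W m)) \<longlonglongrightarrow> 0"
    by simp
qed (use assms in \<open>simp_all add: current_def distrib_left\<close>)

lemma null_homologous_add:
  assumes "null_homologous k S" "null_homologous k T"
  shows "null_homologous k (\<lambda>\<omega>. S \<omega> + T \<omega>)"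
proof -
  obtain U V where "current (Suc k) U" "\<And>\<omega>. smooth_form k \<omega> \<Longrightarrow> S \<omega> = U (ext_deriv \<omega>)"
    "current (Suc k) V" "\<And>\<omega>. smooth_form k \<omega> \<Longrightarrow> T \<omega> = V (ext_deriv \<omega>)"
    using assms by (auto simp: null_homologous_def)
  then show ?thesis
    unfolding null_homologous_def
    by (intro exI[of _ "\<lambda>\<omega>. U \<omega> + V \<omega>"]) (simp add: current_add)
qed

lemma null_homologous_scale:
  assumes "null_homologous k S"
  shows "null_homologous k (\<lambda>\<omega>. c * S \<omega>)"
proof -
  obtain U where "current (Suc k) U" "\<And>\<omega>. smooth_form k \<omega> \<Longrightarrow> S \<omega> = U (ext_deriv \<omega>)"
    using assms by (auto simp: null_homologous_def)
  then show ?thesis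
    unfolding null_homologous_def
    by (intro exI[of _ "\<lambda>\<omega>. c * U \<omega>"]) (simp add: current_scale)
qed

lemma null_homologous_cong:
  assumes "null_homologous k S" "\<And>\<omega>. smooth_form k \<omega> \<Longrightarrow> T \<omega> = S \<omega>"
  shows "null_homologous k T"
  using assms(1) unfolding null_homologous_def by (simp add: assms(2))

lemma current_zero: "current k (\<lambda>\<omega>. 0)"
  by (simp add: current_def)

lemma null_homologous_sum:
  "(\<And>i. i \<in> I \<Longrightarrow> null_homologous k (S i)) \<Longrightarrow> null_homologous k (\<lambda>\<omega>. \<Sum>i\<in>I. S i \<omega>)"
proof (induction I rule: infinite_finite_induct)
  case (insert i I)
  then show ?case using null_homologous_add[of k "S i"] by simp
qed (auto simp: null_homologous_def intro!: exI[of _ "\<lambda>\<omega>. 0"] current_zero)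

lemma current_sum:
  "(\<And>i. i \<in> I \<Longrightarrow> current k (S i)) \<Longrightarrow> current k (\<lambda>\<omega>. \<Sum>i\<in>I. S i \<omega>)"
proof (induction I rule: infinite_finite_induct)
  case (insert i I)
  then show ?case using current_add[of k "S i"] by simp
qed (simp_all add: current_zero)

text \<open>Weighted integrals of a form along a continuous family of points, with constant arguments: the
  currents that the homotopies sweep out are finite sums of these.\<close>

lemma current_integral:
  fixes \<kappa> :: "'p::euclidean_space \<Rightarrow> real" and \<gamma> :: "'p \<Rightarrow> real ^ 'n"
  assumes "continuous_on (cbox a b) \<kappa>" "continuous_on (cbox a b) \<gamma>"
  shows "current k (\<lambda>\<omega>. integral (cbox a b) (\<lambda>p. \<kappa> p * \<omega> (\<gamma> p) vs))"
proof -
  have cont: "continuous_on (cbox a b) (\<lambda>p. \<kappa> p * \<omega> (\<gamma> p) vs)" if "smooth_form k \<omega>" for \<omega>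
    by (intro continuous_intros assms smooth_formD(3)[OF that])
  have int: "(\<lambda>p. \<kappa> p * \<omega> (\<gamma> p) vs) integrable_on cbox a b" if "smooth_form k \<omega>" for \<omega>
    by (rule integrable_continuous[OF cont[OF that]])
  show ?thesis
    unfolding current_def
  proof (intro conjI allI impI)
    fix \<omega> \<eta> :: "'n form" assume "smooth_form k \<omega> \<and> smooth_form k \<eta>"
    then show "integral (cbox a b) (\<lambda>p. \<kappa> p * (\<omega> (\<gamma> p) vs + \<eta> (\<gamma> p) vs))
      = integral (cbox a b) (\<lambda>p. \<kappa> p * \<omega> (\<gamma> p) vs) + integral (cbox a b) (\<lambda>p. \<kappa> p * \<eta> (\<gamma> p) vs)"
      by (simp add: distrib_left integral_add int)
  next
    fix c and \<omega> :: "'n form"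
    have "(\<lambda>p. \<kappa> p * (c * \<omega> (\<gamma> p) vs)) = (\<lambda>p. c * (\<kappa> p * \<omega> (\<gamma> p) vs))"
      by (simp add: mult.left_commute)
    then show "integral (cbox a b) (\<lambda>p. \<kappa> p * (c * \<omega> (\<gamma> p) vs))
      = c * integral (cbox a b) (\<lambda>p. \<kappa> p * \<omega> (\<gamma> p) vs)"
      by (simp only: integral_mult_right)
  next
    fix W :: "nat \<Rightarrow> 'n form"
    assume W: "(\<forall>m. smooth_form k (W m)) \<and>
      (\<forall>ds vs. uniform_limit UNIV (\<lambda>m. iter_deriv ds (\<lambda>y. W m y vs)) (\<lambda>_. 0) sequentially)"
    have "uniform_limit UNIV (\<lambda>m. iter_deriv [] (\<lambda>y. W m y vs)) (\<lambda>_. 0) sequentially"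
      using W by blast
    then have "uniform_limit (cbox a b) (\<lambda>m p. W m (\<gamma> p) vs) (\<lambda>p. 0) sequentially"
      by (auto simp: uniform_limit_iff elim!: eventually_mono)
    moreover have "bounded (\<kappa> ` cbox a b)"
      using assms(1) compact_cbox compact_continuous_image compact_imp_bounded by blast
    ultimately have "uniform_limit (cbox a b) (\<lambda>m p. \<kappa> p * W m (\<gamma> p) vs) (\<lambda>p. \<kappa> p * 0) sequentially"
      by (intro uniform_lim_mult uniform_limit_const) (auto simp: image_constant_conv)
    then obtain I J where "\<And>m. ((\<lambda>p. \<kappa> p * W m (\<gamma> p) vs) has_integral I m) (cbox a b)"
      "((\<lambda>p. \<kappa> p * 0) has_integral J) (cbox a b)" "I \<longlonglongrightarrow> J"
      by (rule uniform_limit_integral_cbox) (use W cont in auto)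
    moreover have "J = 0"
      using calculation(2) by (simp add: has_integral_0_eq)
    moreover have "(\<lambda>m. integral (cbox a b) (\<lambda>p. \<kappa> p * W m (\<gamma> p) vs)) = I"
      using calculation(1) by (intro ext integral_unique)
    ultimately show "(\<lambda>m. integral (cbox a b) (\<lambda>p. \<kappa> p * W m (\<gamma> p) vs)) \<longlonglongrightarrow> 0"
      by simp
  qed
qed

definition affine_param :: "real ^ 'n \<Rightarrow> ('m \<Rightarrow> real ^ 'n) \<Rightarrow> real ^ 'm \<Rightarrow> real ^ 'n" where
  "affine_param c A t = c + (\<Sum>a\<in>UNIV. t $ a *\<^sub>R A a)"

lemma affine_param_has_derivative:
  "(affine_param c A has_derivative (\<lambda>v. \<Sum>a\<in>UNIV. v $ a *\<^sub>R A a)) (at t)"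
  unfolding affine_param_def
  by (auto intro!: derivative_eq_intros bounded_linear_imp_has_derivative bounded_linear_vec_nth)

lemma sum_axis_scale:
  fixes A :: "'m::finite \<Rightarrow> 'b::real_vector"
  shows "(\<Sum>a\<in>UNIV. (axis b (1::real)) $ a *\<^sub>R A a) = A b"
proof -
  have "(\<Sum>a\<in>UNIV. (axis b (1::real)) $ a *\<^sub>R A a) = (\<Sum>a\<in>UNIV. if a = b then A a else 0)"
    by (intro sum.cong) (auto simp: axis_def)
  then show ?thesis by simp
qed

lemma continuous_on_affine_param:
  "continuous_on S f \<Longrightarrow> continuous_on S (\<lambda>p. affine_param c A (f p))"
  unfolding affine_param_def by (intro continuous_intros)

lemma affine_param_lattice:
  assumes "\<And>a. A a \<in> int_lattice" "z \<in> int_lattice"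
  shows "affine_param c A (t + z) - affine_param c A t \<in> int_lattice"
proof -
  have "affine_param c A (t + z) - affine_param c A t = (\<Sum>a\<in>UNIV. z $ a *\<^sub>R A a)"
    by (simp add: affine_param_def scaleR_add_left sum.distrib)
  then show ?thesis using assms by (auto simp: int_lattice_def intro!: Ints_sum Ints_mult)
qed

text \<open>Stokes' theorem for the cylinder swept out when a linear torus is pushed in the fixed direction
  \<open>w\<close> to a graph over it.  Only first derivatives of \<open>\<phi>\<close> occur, because \<open>w\<close> annihilates the terms in
  which it is inserted twice.\<close>

lemma torus_current_homotopy:
  fixes A :: "'m::{finite,linorder} \<Rightarrow> real ^ 'n" and \<phi> :: "real ^ 'm::_ \<Rightarrow> real"
  assumes \<omega>: "smooth_form CARD('m) \<omega>" and A: "\<And>a. A a \<in> int_lattice"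
    and \<phi>: "\<And>t. (\<phi> has_derivative \<phi>' t) (at t)" "\<And>v. continuous_on UNIV (\<lambda>t. \<phi>' t v)" "periodic \<phi>"
  shows "torus_current (\<lambda>t. affine_param c A t + \<phi> t *\<^sub>R w) \<omega> - torus_current (affine_param c A) \<omega>
    = integral (cbox (0, 0) (1, One)) (\<lambda>(\<tau>, t). \<phi> t *
        ext_deriv \<omega> (affine_param c A t + (\<tau> * \<phi> t) *\<^sub>R w) (w # map A (sorted_list_of_set UNIV)))"
proof -
  let ?ms = "sorted_list_of_set UNIV :: 'm list"
  let ?m = "CARD('m)"
  define As where "As = map A ?ms"
  define D where "D vs x = frechet_derivative (\<lambda>x. \<omega> x vs) (at x)" for vs x
  define H where "H \<tau> t = affine_param c A t + (\<tau> * \<phi> t) *\<^sub>R w" for \<tau> t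
  define k where "k i t = \<phi>' t (axis (?ms ! i) 1)" for i t
  \<comment> \<open>The integrand of the torus at time \<open>\<tau>\<close> of the homotopy, expanded by shearing.\<close>
  define G where "G \<tau> t = \<omega> (H \<tau> t) As + \<tau> * (\<Sum>i<?m. k i t * \<omega> (H \<tau> t) (As[i := w]))" for \<tau> t
  define G' where "G' \<tau> t = \<phi> t * D As (H \<tau> t) w + (\<Sum>i<?m. k i t * \<omega> (H \<tau> t) (As[i := w]))
      + \<tau> * (\<Sum>i<?m. k i t * (\<phi> t * D (As[i := w]) (H \<tau> t) w))" for \<tau> t
  \<comment> \<open>The partial derivative of \<open>\<phi> * \<omega>(H \<tau>)(As[i := w])\<close> in the direction of the \<open>i\<close>-th parameter.\<close>
  define Q where "Q i \<tau> t = k i t * \<omega> (H \<tau> t) (As[i := w])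
      + \<phi> t * (D (As[i := w]) (H \<tau> t) (As ! i) + \<tau> * k i t * D (As[i := w]) (H \<tau> t) w)" for i \<tau> t
  have len: "length As = ?m" by (simp add: As_def)
  have linD: "linear (D vs x)" for vs x
    unfolding D_def by (rule smooth_formD(5)[OF \<omega>])
  have contD: "continuous_on S h \<Longrightarrow> continuous_on S (\<lambda>p. D vs (h p) v)" for S vs v and h :: "'x::topological_space \<Rightarrow> _"
    unfolding D_def by (rule smooth_formD(4)[OF \<omega>])
  have cont\<omega>: "continuous_on S h \<Longrightarrow> continuous_on S (\<lambda>p. \<omega> (h p) vs)" for S vs and h :: "'x::topological_space \<Rightarrow> _"
    by (rule smooth_formD(3)[OF \<omega>])
  have cont\<phi>: "continuous_on UNIV \<phi>"
    by (auto intro!: continuous_at_imp_continuous_on has_derivative_continuous[OF \<phi>(1)])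
  have cont\<phi>1: "continuous_on S h \<Longrightarrow> continuous_on S (\<lambda>p. \<phi> (h p))" for S and h :: "'x::topological_space \<Rightarrow> _"
    by (rule continuous_on_compose2[OF cont\<phi>]) auto
  have contk: "continuous_on S h \<Longrightarrow> continuous_on S (\<lambda>p. k i (h p))" for S i and h :: "'x::topological_space \<Rightarrow> _"
    unfolding k_def by (rule continuous_on_compose2[OF \<phi>(2)]) auto
  have contH: "continuous_on S f \<Longrightarrow> continuous_on S h \<Longrightarrow> continuous_on S (\<lambda>p. H (f p) (h p))"
    for S f and h :: "'x::topological_space \<Rightarrow> _"
    unfolding H_def by (intro continuous_intros continuous_on_affine_param cont\<phi>1)
  note ci = continuous_intros contD cont\<omega> contH cont\<phi>1 contk

  have F: "torus_current (\<lambda>t. affine_param c A t + (s * \<phi> t) *\<^sub>R w) \<omega>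
    = integral (cbox 0 One) (\<lambda>t. G s t)" for s
  proof -
    have "partial a (\<lambda>t. affine_param c A t + (s * \<phi> t) *\<^sub>R w) t = A a + (s * \<phi>' t (axis a 1)) *\<^sub>R w" for a t
    proof -
      have "((\<lambda>t. affine_param c A t + (s * \<phi> t) *\<^sub>R w) has_derivative
          (\<lambda>v. (\<Sum>a\<in>UNIV. v $ a *\<^sub>R A a) + (s * \<phi>' t v) *\<^sub>R w)) (at t)"
        by (intro has_derivative_add affine_param_has_derivative has_derivative_scaleR_left
            has_derivative_mult_right \<phi>(1))
      from frechet_derivative_at[OF this, symmetric] show ?thesis
        by (simp add: partial_def sum_axis_scale)
    qed
    then have "map (\<lambda>a. partial a (\<lambda>t. affine_param c A t + (s * \<phi> t) *\<^sub>R w) t) ?ms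
        = map (\<lambda>i. As ! i + (s * k i t) *\<^sub>R w) [0..<?m]" for t
      by (intro nth_equalityI) (auto simp: As_def k_def)
    then have "\<omega> (H s t) (map (\<lambda>a. partial a (\<lambda>t. affine_param c A t + (s * \<phi> t) *\<^sub>R w) t) ?ms) = G s t" for t
      using alternating_form_shear[OF smooth_formD(1)[OF \<omega>] len, of "H s t" "\<lambda>i. s * k i t" w]
      by (simp add: G_def sum_distrib_left mult.assoc)
    then show ?thesis by (simp add: torus_current_def H_def)
  qed
  have dG: "((\<lambda>\<tau>. G \<tau> t) has_vector_derivative G' \<tau> t) (at \<tau>)" for \<tau> t
  proof -
    have "((\<lambda>\<tau>. \<omega> (H \<tau> t) vs) has_derivative (\<lambda>h. D vs (H \<tau> t) ((h * \<phi> t) *\<^sub>R w))) (at \<tau>)" for vs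
      unfolding D_def
      by (rule has_derivative_compose[OF _ smooth_formD(2)[OF \<omega>]])
        (auto simp: H_def intro!: derivative_eq_intros)
    moreover have "(\<lambda>h. D vs (H \<tau> t) ((h * \<phi> t) *\<^sub>R w)) = (*) (\<phi> t * D vs (H \<tau> t) w)" for vs
      by (simp add: fun_eq_iff linear_scale[OF linD])
    ultimately have d: "((\<lambda>\<tau>. \<omega> (H \<tau> t) vs) has_real_derivative \<phi> t * D vs (H \<tau> t) w) (at \<tau>)" for vs
      by (simp add: has_field_derivative_def)
    show ?thesis
      unfolding G_def G'_def has_real_derivative_iff_has_vector_derivative[symmetric]
      by (auto intro!: derivative_eq_intros d simp: sum_distrib_left sum.distrib algebra_simps)
  qed
  have dQ: "integral (cbox 0 One) (Q i \<tau>) = 0" if "i < ?m" for i \<tau>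
  proof -
    let ?P = "\<lambda>t. \<phi> t * \<omega> (H \<tau> t) (As[i := w])"
    let ?P' = "\<lambda>t v. \<phi> t * D (As[i := w]) (H \<tau> t) ((\<Sum>a\<in>UNIV. v $ a *\<^sub>R A a) + (\<tau> * \<phi>' t v) *\<^sub>R w)
        + \<phi>' t v * \<omega> (H \<tau> t) (As[i := w])"
    have dP: "(?P has_derivative ?P' t) (at t)" for t
    proof (rule has_derivative_mult[OF \<phi>(1)])
      show "((\<lambda>t. \<omega> (H \<tau> t) (As[i := w])) has_derivative
        (\<lambda>v. D (As[i := w]) (H \<tau> t) ((\<Sum>a\<in>UNIV. v $ a *\<^sub>R A a) + (\<tau> * \<phi>' t v) *\<^sub>R w))) (at t)"
        unfolding D_def
        by (rule has_derivative_compose[OF _ smooth_formD(2)[OF \<omega>]])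
          (unfold H_def, intro has_derivative_add affine_param_has_derivative has_derivative_scaleR_left
            has_derivative_mult_right \<phi>(1))
    qed
    have eq: "?P' t (axis (?ms ! i) 1) = Q i \<tau> t" for t
      using that by (simp add: Q_def k_def sum_axis_scale As_def linear_add[OF linD] linear_scale[OF linD] algebra_simps)
    have "periodic ?P"
      unfolding periodic_def
    proof (intro allI ballI)
      fix t z :: "real ^ 'm::_" assume z: "z \<in> int_lattice"
      have "H \<tau> (t + z) = H \<tau> t + (affine_param c A (t + z) - affine_param c A t)" "\<phi> (t + z) = \<phi> t"
        using \<phi>(3) z by (simp_all add: H_def periodic_def)
      moreover have "\<omega> (H \<tau> t + (affine_param c A (t + z) - affine_param c A t)) = \<omega> (H \<tau> t)"
        using smooth_formD(6)[OF \<omega>] affine_param_lattice[OF A z] by (simp add: periodic_def)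
      ultimately show "\<phi> (t + z) * \<omega> (H \<tau> (t + z)) (As[i := w]) = \<phi> t * \<omega> (H \<tau> t) (As[i := w])"
        by simp
    qed
    moreover have "continuous_on UNIV (\<lambda>t. ?P' t (axis (?ms ! i) 1))"
      unfolding eq Q_def by (intro ci)
    ultimately have "integral (cbox 0 One) (\<lambda>t. ?P' t (axis (?ms ! i) 1)) = 0"
      by (rule integral_partial_periodic[OF dP])
    then show ?thesis by (simp only: eq)
  qed
  \<comment> \<open>The divergence terms collected in \<open>Q\<close> integrate to zero over the period.\<close>
  have G': "G' \<tau> t = \<phi> t * ext_deriv \<omega> (H \<tau> t) (w # As) + (\<Sum>i<?m. Q i \<tau> t)" for \<tau> t
    unfolding ext_deriv_Cons[OF \<omega> len] D_def[symmetric] G'_def Q_def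
    by (simp add: sum.distrib sum_distrib_left algebra_simps)
  have contG': "continuous_on S f \<Longrightarrow> continuous_on S h \<Longrightarrow> continuous_on S (\<lambda>p. G' (f p) (h p))"
    for S f and h :: "'x::topological_space \<Rightarrow> _"
    unfolding G'_def by (intro ci)
  have contQ: "continuous_on S f \<Longrightarrow> continuous_on S h \<Longrightarrow> continuous_on S (\<lambda>p. Q i (f p) (h p))"
    for S f i and h :: "'x::topological_space \<Rightarrow> _"
    unfolding Q_def by (intro ci)
  have contE: "continuous_on S f \<Longrightarrow> continuous_on S h \<Longrightarrow>
      continuous_on S (\<lambda>p. \<phi> (h p) * ext_deriv \<omega> (H (f p) (h p)) (w # As))"
    for S f and h :: "'x::topological_space \<Rightarrow> _"
    unfolding ext_deriv_Cons[OF \<omega> len] D_def[symmetric] by (intro ci)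
  have contG: "continuous_on S (G s)" for S s
    unfolding G_def by (intro ci)
  have "torus_current (\<lambda>t. affine_param c A t + \<phi> t *\<^sub>R w) \<omega> - torus_current (affine_param c A) \<omega>
      = integral (cbox 0 One) (\<lambda>t. G 1 t) - integral (cbox 0 One) (\<lambda>t. G 0 t)"
    using F[of 1] F[of 0] by simp
  also have "\<dots> = integral (cbox 0 One) (\<lambda>t. G 1 t - G 0 t)"
    by (intro integral_diff[symmetric] integrable_continuous contG)
  also have "\<dots> = integral (cbox 0 One) (\<lambda>t. integral (cbox 0 1) (\<lambda>\<tau>. G' \<tau> t))"
  proof (rule arg_cong[where f = "integral (cbox 0 One)"], rule ext)
    fix t
    have "((\<lambda>\<tau>. G' \<tau> t) has_integral G 1 t - G 0 t) {0..1}"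
      by (rule fundamental_theorem_of_calculus[where f = "\<lambda>\<tau>. G \<tau> t"])
        (simp, rule has_vector_derivative_at_within[OF dG])
    then show "G 1 t - G 0 t = integral (cbox 0 1) (\<lambda>\<tau>. G' \<tau> t)"
      by (simp add: integral_unique)
  qed
  also have "\<dots> = integral (cbox 0 1) (\<lambda>\<tau>. integral (cbox 0 One) (\<lambda>t. G' \<tau> t))"
    by (rule integral_swap_continuous, unfold case_prod_unfold)
      (intro contG' continuous_on_fst continuous_on_snd continuous_on_id)
  also have "\<dots> = integral (cbox 0 1) (\<lambda>\<tau>. integral (cbox 0 One) (\<lambda>t. \<phi> t * ext_deriv \<omega> (H \<tau> t) (w # As)))"
  proof (rule arg_cong[where f = "integral (cbox 0 1)"], rule ext)
    fix \<tau>
    have "integral (cbox 0 One) (\<lambda>t. G' \<tau> t)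
      = integral (cbox 0 One) (\<lambda>t. \<phi> t * ext_deriv \<omega> (H \<tau> t) (w # As)) + (\<Sum>i<?m. integral (cbox 0 One) (Q i \<tau>))"
    proof -
      have "(\<lambda>t. \<phi> t * ext_deriv \<omega> (H \<tau> t) (w # As)) integrable_on cbox 0 One"
        by (intro integrable_continuous contE continuous_on_const continuous_on_id)
      moreover have Qi: "Q i \<tau> integrable_on cbox 0 One" for i
        using contQ[OF continuous_on_const continuous_on_id, of "cbox 0 One" i \<tau>]
        by (intro integrable_continuous) simp
      moreover have "(\<lambda>t. \<Sum>i<?m. Q i \<tau> t) integrable_on cbox 0 One"
        by (intro integrable_sum Qi) simp
      ultimately show ?thesis
        unfolding G' by (simp add: integral_add integral_sum)
    qed
    then show "integral (cbox 0 One) (\<lambda>t. G' \<tau> t)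
      = integral (cbox 0 One) (\<lambda>t. \<phi> t * ext_deriv \<omega> (H \<tau> t) (w # As))"
      using dQ by simp
  qed
  also have "\<dots> = integral (cbox (0, 0) (1, One)) (\<lambda>(\<tau>, t). \<phi> t * ext_deriv \<omega> (H \<tau> t) (w # As))"
  proof (subst integral_prod_continuous)
    show "continuous_on (cbox (0, 0) (1, One)) (\<lambda>(\<tau>, t). \<phi> t * ext_deriv \<omega> (H \<tau> t) (w # As))"
      unfolding case_prod_unfold
      by (intro contE continuous_on_fst continuous_on_snd continuous_on_id)
  qed simp
  finally show ?thesis by (simp add: H_def As_def)
qed

definition mean_form :: "'n::finite form \<Rightarrow> (real ^ 'n) list \<Rightarrow> real" where
  "mean_form \<omega> vs = integral (cbox 0 One) (\<lambda>z. \<omega> z vs)"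

lemma alternating_form_mean:
  assumes "smooth_form k \<omega>"
  shows "alternating_form k (mean_form \<omega>)"
proof -
  note alt = alternating_formD[OF smooth_formD(1)[OF assms]]
  have int: "(\<lambda>z. \<omega> z vs) integrable_on cbox 0 One" for vs
    by (intro integrable_continuous smooth_formD(3)[OF assms] continuous_intros)
  show ?thesis
    unfolding alternating_form_def mean_form_def
  proof (intro conjI allI impI)
    fix vs :: "(real ^ 'a) list" and i assume a: "length vs = k \<and> i < k"
    show "linear (\<lambda>v. integral (cbox 0 One) (\<lambda>z. \<omega> z (vs[i := v])))"
      using a by (intro linearI) (simp_all add: linear_add[OF alt(2)] linear_scale[OF alt(2)] integral_add int)
  qed (use alt in auto)
qed

text \<open>Averaging the translates of a linear torus replaces a form by its mean, so its class pairs with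
  forms through their means.\<close>

lemma torus_current_linear_mean:
  fixes A :: "'m::{finite,linorder} \<Rightarrow> real ^ 'n"
  assumes A: "\<And>a. A a \<in> int_lattice"
  shows "null_homologous CARD('m) (\<lambda>\<omega>. torus_current (affine_param c A) \<omega>
           - mean_form \<omega> (map A (sorted_list_of_set UNIV)))"
proof -
  let ?m = "CARD('m)"
  define As where "As = map A (sorted_list_of_set UNIV)"
  have len: "length As = ?m" by (simp add: As_def)
  \<comment> \<open>The homotopy to the translate by \<open>z\<close>, averaged over \<open>z\<close>, with \<open>z\<close> expanded in the basis because a current of integral type has constant arguments.\<close>
  define U where "U \<eta> = (\<Sum>i\<in>UNIV. integral (cbox (0, 0, 0) (One, 1, One))
      (\<lambda>p. (- fst p $ i) * \<eta> (affine_param c A (snd (snd p)) + fst (snd p) *\<^sub>R fst p) (axis i 1 # As)))"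
    for \<eta> :: "'n form"
  have U: "current (Suc ?m) U"
    unfolding U_def
    by (intro current_sum current_integral continuous_intros continuous_on_affine_param)
  have "torus_current (affine_param c A) \<omega> - mean_form \<omega> As = U (ext_deriv \<omega>)"
    if \<omega>: "smooth_form ?m \<omega>" for \<omega>
  proof -
    let ?E = "\<lambda>z \<tau> t. ext_deriv \<omega> (affine_param c A t + \<tau> *\<^sub>R z)"
    have contE: "continuous_on S f \<Longrightarrow> continuous_on S g \<Longrightarrow> continuous_on S h \<Longrightarrow>
        continuous_on S (\<lambda>p. ?E (h p) (f p) (g p) (w # As))"
      for S f g w and h :: "'x::topological_space \<Rightarrow> _"
      unfolding ext_deriv_Cons[OF \<omega> len]
      by (intro continuous_intros smooth_formD(4)[OF \<omega>] continuous_on_affine_param)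
    have linE: "?E z \<tau> t (z # As) = (\<Sum>i\<in>UNIV. z $ i * ?E z \<tau> t (axis i 1 # As))" for z \<tau> t
    proof -
      have "linear (\<lambda>w. ext_deriv \<omega> x (w # As))" for x
      proof -
        have "linear (\<lambda>w. frechet_derivative (\<lambda>y. \<omega> y (As[j := w])) (at x) v)" if "j < ?m" for j v
        proof (rule linearI)
          note alt = alternating_formD(2)[OF smooth_formD(1)[OF \<omega>] len that]
          note d = smooth_formD(2)[OF \<omega>]
          show "frechet_derivative (\<lambda>y. \<omega> y (As[j := w + w'])) (at x) v
            = frechet_derivative (\<lambda>y. \<omega> y (As[j := w])) (at x) v
              + frechet_derivative (\<lambda>y. \<omega> y (As[j := w'])) (at x) v" for w w'
            using frechet_derivative_at[OF has_derivative_add[OF d[of "As[j := w]" x] d[of "As[j := w']" x]]]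
            by (simp add: linear_add[OF alt] fun_eq_iff)
          show "frechet_derivative (\<lambda>y. \<omega> y (As[j := r *\<^sub>R w])) (at x) v
            = r *\<^sub>R frechet_derivative (\<lambda>y. \<omega> y (As[j := w])) (at x) v" for r w
            using frechet_derivative_at[OF has_derivative_scaleR_right[OF d[of "As[j := w]" x], of r]]
            by (simp add: linear_scale[OF alt] fun_eq_iff)
        qed
        then show ?thesis
          unfolding ext_deriv_Cons[OF \<omega> len]
          by (intro linear_compose_sub linear_compose_sum smooth_formD(5)[OF \<omega>]) auto
      qed
      note lin = this
      have "z = (\<Sum>i\<in>UNIV. z $ i *\<^sub>R axis i 1)"
        by (simp add: vec_eq_iff axis_def if_distrib cong: if_cong)
      then have "?E z \<tau> t (z # As) = ?E z \<tau> t ((\<Sum>i\<in>UNIV. z $ i *\<^sub>R axis i 1) # As)"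
        by simp
      also have "\<dots> = (\<Sum>i\<in>UNIV. z $ i * ?E z \<tau> t (axis i 1 # As))"
        by (simp add: linear_sum[OF lin] linear_scale[OF lin])
      finally show ?thesis .
    qed
    have contF: "continuous_on S f \<Longrightarrow> continuous_on S h \<Longrightarrow> continuous_on S (\<lambda>p. \<omega> (affine_param c A (f p) + h p) As)"
      for S f and h :: "'x::topological_space \<Rightarrow> _"
      by (intro smooth_formD(3)[OF \<omega>] continuous_intros continuous_on_affine_param)
    have T: "torus_current (\<lambda>t. affine_param c A t + z) \<omega> = integral (cbox 0 One) (\<lambda>t. \<omega> (affine_param c A t + z) As)" for z
    proof -
      have "partial a (\<lambda>t. affine_param c A t + z) t = A a" for a t
      proof -
        have "((\<lambda>t. affine_param c A t + z) has_derivative (\<lambda>v. (\<Sum>a\<in>UNIV. v $ a *\<^sub>R A a) + 0)) (at t)"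
          by (intro has_derivative_add affine_param_has_derivative has_derivative_const)
        from frechet_derivative_at[OF this, symmetric] show ?thesis
          by (simp add: partial_def sum_axis_scale)
      qed
      then show ?thesis by (simp add: torus_current_def As_def)
    qed
    have hom: "torus_current (\<lambda>t. affine_param c A t + z) \<omega> - torus_current (affine_param c A) \<omega>
        = integral (cbox (0, 0) (1, One)) (\<lambda>p. ?E z (fst p) (snd p) (z # As))" for z
      using torus_current_homotopy[OF \<omega>, where A = A and \<phi> = "\<lambda>t. 1" and \<phi>' = "\<lambda>t v. 0" and c = c and w = z] A
      by (simp add: As_def case_prod_unfold periodic_def)
    have "mean_form \<omega> As - torus_current (affine_param c A) \<omega>
        = integral (cbox 0 One) (\<lambda>z. torus_current (\<lambda>t. affine_param c A t + z) \<omega>)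
          - integral (cbox 0 One) (\<lambda>z::real ^ 'n. torus_current (affine_param c A) \<omega>)"
    proof -
      have "integral (cbox 0 One) (\<lambda>z. torus_current (\<lambda>t. affine_param c A t + z) \<omega>)
          = integral (cbox 0 One) (\<lambda>t. integral (cbox 0 One) (\<lambda>z. \<omega> (affine_param c A t + z) As))"
        unfolding T
        by (rule integral_swap_continuous, unfold case_prod_unfold)
          (intro contF continuous_on_fst continuous_on_snd continuous_on_id)
      also have "(\<lambda>t. integral (cbox 0 One) (\<lambda>z. \<omega> (affine_param c A t + z) As)) = (\<lambda>t. mean_form \<omega> As)"
      proof
        fix t show "integral (cbox 0 One) (\<lambda>z. \<omega> (affine_param c A t + z) As) = mean_form \<omega> As"
        using integral_periodic_translation[of "\<lambda>z. \<omega> z As" "affine_param c A t"] smooth_formD(6)[OF \<omega>]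
          smooth_formD(3)[OF \<omega> continuous_on_id, of UNIV As]
        by (simp add: mean_form_def periodic_def add.commute[of "affine_param c A t"])
      qed
      finally show ?thesis by simp
    qed
    also have "\<dots> = integral (cbox 0 One) (\<lambda>z. torus_current (\<lambda>t. affine_param c A t + z) \<omega>
          - torus_current (affine_param c A) \<omega>)"
      unfolding T
      by (intro integral_diff[symmetric] integrable_continuous integral_continuous_on_param continuous_on_const,
          unfold case_prod_unfold)
        (intro contF continuous_on_fst continuous_on_snd continuous_on_id)
    also have "\<dots> = integral (cbox 0 One) (\<lambda>z. integral (cbox (0, 0) (1, One)) (\<lambda>p. ?E z (fst p) (snd p) (z # As)))"
      by (simp only: hom)
    also have "\<dots> = integral (cbox (0, 0, 0) (One, 1, One)) (\<lambda>p. ?E (fst p) (fst (snd p)) (snd (snd p)) (fst p # As))"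
      unfolding linE
      by (subst integral_prod_continuous)
        (intro continuous_on_sum continuous_on_mult continuous_on_component contE
          continuous_on_fst continuous_on_snd continuous_on_id, simp)
    also have "\<dots> = - U (ext_deriv \<omega>)"
    proof -
      have "(\<lambda>p. fst p $ i * ?E (fst p) (fst (snd p)) (snd (snd p)) (axis i 1 # As))
          integrable_on cbox (0, 0, 0) (One, 1, One)" for i
        by (intro integrable_continuous continuous_on_mult continuous_on_component contE
          continuous_on_fst continuous_on_snd continuous_on_id)
      then show ?thesis
        unfolding linE U_def by (simp add: integral_sum sum_negf)
    qed
    finally show ?thesis by simp
  qed
  with U show ?thesis
    unfolding null_homologous_def As_def by blast
qed

text \<open>A graph over a linear torus has the homology class of the linear torus, so it pairs with forms
  through their means, too.\<close>

theorem torus_current_graph_mean: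
  fixes A :: "'m::{finite,linorder} \<Rightarrow> real ^ 'n" and \<phi> :: "real ^ 'm::_ \<Rightarrow> real"
  assumes A: "\<And>a. A a \<in> int_lattice"
    and \<phi>: "\<And>t. (\<phi> has_derivative \<phi>' t) (at t)" "\<And>v. continuous_on UNIV (\<lambda>t. \<phi>' t v)" "periodic \<phi>"
  shows "null_homologous CARD('m) (\<lambda>\<omega>. torus_current (\<lambda>t. affine_param c A t + \<phi> t *\<^sub>R w) \<omega>
           - mean_form \<omega> (map A (sorted_list_of_set UNIV)))"
proof -
  have "continuous_on UNIV \<phi>"
    by (auto intro!: continuous_at_imp_continuous_on has_derivative_continuous[OF \<phi>(1)])
  note c\<phi> = this
  have cont\<phi>: "continuous_on S (\<lambda>p. \<phi> (h p))" if "continuous_on S h" for S and h :: "'x::topological_space \<Rightarrow> _"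
    by (rule continuous_on_compose2[OF c\<phi> that]) auto
  have "current (Suc CARD('m)) (\<lambda>\<eta>. integral (cbox (0, 0) (1, One)) (\<lambda>p. \<phi> (snd p) *
        \<eta> (affine_param c A (snd p) + (fst p * \<phi> (snd p)) *\<^sub>R w) (w # map A (sorted_list_of_set UNIV))))"
    by (intro current_integral continuous_intros continuous_on_affine_param cont\<phi>)
  then have "null_homologous CARD('m) (\<lambda>\<omega>. torus_current (\<lambda>t. affine_param c A t + \<phi> t *\<^sub>R w) \<omega>
      - torus_current (affine_param c A) \<omega>)"
    unfolding null_homologous_def
    using torus_current_homotopy[OF _ A \<phi>, where c = c and w = w] by (fastforce simp: case_prod_unfold)
  from null_homologous_add[OF this torus_current_linear_mean[where A = A and c = c, OF A]]
  show ?thesis by simp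
qed

section \<open>Lattice bases adapted to a primitive covector\<close>

text \<open>The row \<open>i0\<close> of an integral matrix with integral inverse.  The determinant is fixed because it
  determines the orientation of the tori.\<close>

definition unimodular_row :: "'n \<Rightarrow> int ^ 'n \<Rightarrow> bool" where
  "unimodular_row i0 r \<longleftrightarrow> (\<exists>M N :: real ^ 'n ^ 'n. M ** N = mat 1 \<and> N ** M = mat 1 \<and> det M = 1 \<and>
     (\<forall>i j. M $ i $ j \<in> \<int> \<and> N $ i $ j \<in> \<int>) \<and> (\<forall>j. N $ i0 $ j = of_int (r $ j)))"

definition add_entry :: "'n \<Rightarrow> int \<Rightarrow> 'n \<Rightarrow> int ^ 'n \<Rightarrow> int ^ 'n" where
  "add_entry i c j r = (\<chi> k. if k = i then r $ i + c * r $ j else r $ k)"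

text \<open>A transvection of the row is multiplication of the matrix by an elementary matrix, and of the
  inverse by the inverse elementary matrix.\<close>

lemma unimodular_row_add_entry:
  assumes "unimodular_row i0 r" "i \<noteq> j"
  shows "unimodular_row i0 (add_entry i c j r)"
proof -
  obtain M N :: "real ^ 'a ^ 'a" where MN: "M ** N = mat 1" "N ** M = mat 1" "det M = 1"
    and int: "\<And>i j. M $ i $ j \<in> \<int>" "\<And>i j. N $ i $ j \<in> \<int>" and r: "\<And>j. N $ i0 $ j = of_int (r $ j)"
    using assms(1) unfolding unimodular_row_def by blast
  define E :: "int \<Rightarrow> real ^ 'a ^ 'a" where
    "E c = (\<chi> k l. (if k = l then 1 else 0) + (if k = j \<and> l = i then of_int c else 0))" for c
  have NE: "(X ** E c) $ k $ l = X $ k $ l + (if l = i then X $ k $ j * of_int c else 0)" for X k l c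
  proof -
    have "(X ** E c) $ k $ l = (\<Sum>p\<in>UNIV. (if p = l then X $ k $ p else 0)
        + (if p = j then (if l = i then X $ k $ p * of_int c else 0) else 0))"
      unfolding matrix_matrix_mult_def E_def by (auto intro!: sum.cong simp: distrib_left)
    then show ?thesis by (simp add: sum.distrib)
  qed
  have EM: "(E c ** X) $ k $ l = X $ k $ l + (if k = j then of_int c * X $ i $ l else 0)" for X k l c
  proof -
    have "(E c ** X) $ k $ l = (\<Sum>p\<in>UNIV. (if p = k then X $ p $ l else 0)
        + (if p = i then (if k = j then of_int c * X $ p $ l else 0) else 0))"
      unfolding matrix_matrix_mult_def E_def by (auto intro!: sum.cong simp: distrib_right)
    then show ?thesis by (simp add: sum.distrib)
  qed
  have EE: "E c ** E (- c) = mat 1" for c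
    using assms(2) by (simp add: vec_eq_iff NE) (simp add: E_def mat_def)
  have detE: "det (E c) = 1" for c
  proof -
    have "E c = (\<chi> k. if k = j then row j (mat 1) + of_int c *s row i (mat 1) else row k (mat 1))"
      using assms(2) by (auto simp: E_def vec_eq_iff row_def mat_def)
    then show ?thesis
      using det_row_operation[of j i "mat 1 :: real ^ 'a ^ 'a" "of_int c"] assms(2) by simp
  qed
  show ?thesis
    unfolding unimodular_row_def
  proof (rule exI[of _ "E (- c) ** M"], rule exI[of _ "N ** E c"], intro conjI allI)
    show "E (- c) ** M ** (N ** E c) = mat 1"
      using EE[of "- c"] MN(1) by (metis matrix_mul_assoc matrix_mul_rid minus_minus)
    show "N ** E c ** (E (- c) ** M) = mat 1"
      using EE[of c] MN(2) by (metis matrix_mul_assoc matrix_mul_rid)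
    show "det (E (- c) ** M) = 1" by (simp add: det_mul detE MN(3))
    show "(E (- c) ** M) $ i' $ j' \<in> \<int>" "(N ** E c) $ i' $ j' \<in> \<int>" for i' j'
      using int by (auto simp: NE EM intro!: Ints_add Ints_mult Ints_minus)
    show "(N ** E c) $ i0 $ l = of_int (add_entry i c j r $ l)" for l
      by (simp add: NE r add_entry_def)
  qed
qed

text \<open>Signed unit vectors arise from each other by transvections, so no determinant has to be corrected.
  A sign change needs a second coordinate.\<close>

lemma unimodular_row_unit:
  fixes i0 :: "'n::finite"
  assumes "CARD('n) \<ge> 2" "c \<in> {1, -1}"
  shows "unimodular_row i0 (axis i c)"
proof -
  have base: "unimodular_row i0 (axis i0 1)"
    unfolding unimodular_row_def
  proof (intro exI[of _ "mat 1"] conjI allI)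
    show "(mat 1 :: real ^ 'n ^ 'n) $ i $ j \<in> \<int>" "(mat 1 :: real ^ 'n ^ 'n) $ i $ j \<in> \<int>" for i j
      by (simp_all add: mat_def)
    show "(mat 1 :: real ^ 'n ^ 'n) $ i0 $ j = of_int (axis i0 1 $ j)" for j
      by (simp add: mat_def axis_def)
  qed simp_all
  have step: "unimodular_row i0 (axis j c)" if "unimodular_row i0 (axis i 1)" "i \<noteq> j" "c \<in> {1, -1}" for i j c
  proof -
    have "axis j c = add_entry i (- c) j (add_entry j c i (axis i 1))"
      using that(2,3) by (auto simp: vec_eq_iff add_entry_def axis_def)
    then show ?thesis
      using that by (metis unimodular_row_add_entry)
  qed
  obtain j where "j \<noteq> i0"
    using assms(1) by (metis (full_types) UNIV_I card_1_singleton_iff card_le_Suc0_iff_eq finite not_less_eq_eq numeral_2_eq_2)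
  then show ?thesis
    using step base assms(2) by (metis insertI1)
qed

text \<open>The Euclidean algorithm on the entries, by transvections.\<close>

lemma primitive_imp_unimodular_row:
  fixes r :: "int ^ 'n"
  assumes "CARD('n) \<ge> 2" "primitive_class r"
  shows "unimodular_row i0 r"
  using assms(2)
proof (induction "\<Sum>i\<in>UNIV. nat \<bar>r $ i\<bar>" arbitrary: r rule: less_induct)
  case less
  have scaled: "False" if "r = k *s s" "k \<notin> {1, -1}" for k s
    using less.prems that unfolding primitive_class_def by blast
  show ?case
  proof (cases "\<exists>i j. i \<noteq> j \<and> r $ i \<noteq> 0 \<and> r $ j \<noteq> 0")
    case True
    then obtain i j where ij: "i \<noteq> j" "r $ i \<noteq> 0" "r $ j \<noteq> 0" "\<bar>r $ j\<bar> \<le> \<bar>r $ i\<bar>"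
      by (metis linear)
    define c where "c = - sgn (r $ i) * sgn (r $ j)"
    let ?r = "add_entry i c j r"
    have r_eq: "r = add_entry i (- c) j ?r"
      using ij(1) by (auto simp: vec_eq_iff add_entry_def)
    have "\<bar>r $ i + c * r $ j\<bar> < \<bar>r $ i\<bar>"
      using ij unfolding c_def by (auto simp: sgn_if abs_if split: if_splits)
    then have "(\<Sum>k\<in>UNIV. nat \<bar>?r $ k\<bar>) < (\<Sum>k\<in>UNIV. nat \<bar>r $ k\<bar>)"
      by (intro sum_strict_mono_ex1) (auto simp: add_entry_def intro!: bexI[of _ i])
    moreover have "primitive_class ?r"
      unfolding primitive_class_def
    proof (rule notI, elim exE conjE)
      fix k s assume k: "k \<notin> {1, -1}" and s: "?r = k *s s"
      have "r = k *s add_entry i (- c) j s"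
        by (subst r_eq, subst s) (simp add: vec_eq_iff add_entry_def algebra_simps)
      then show False using scaled k by blast
    qed
    ultimately have "unimodular_row i0 ?r"
      by (rule less.hyps)
    then show ?thesis
      by (subst r_eq) (rule unimodular_row_add_entry[OF _ ij(1)])
  next
    case False
    have "r \<noteq> 0" using scaled[of 0 0] by (auto simp: vec_eq_iff)
    then obtain i where i: "r $ i \<noteq> 0" by (auto simp: vec_eq_iff)
    then have r: "r = axis i (r $ i)"
      using False by (auto simp: vec_eq_iff axis_def)
    moreover have "axis i (r $ i) = (r $ i) *s axis i 1"
      by (auto simp: vec_eq_iff axis_def)
    ultimately have "r $ i \<in> {1, -1}" using scaled by metis
    then show ?thesis using unimodular_row_unit[OF assms(1), of "r $ i" i0 i] r by metis
  qed
qed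

text \<open>A positively oriented lattice basis consisting of \<open>M0\<close>, on which \<open>r\<close> is 1, and a basis \<open>A\<close> of the
  kernel of \<open>r\<close>; the covectors \<open>r\<close>, \<open>B\<close> form the dual basis.\<close>

locale hyperplane_basis =
  fixes r M0 :: "real ^ 'n::{finite,linorder}" and A B :: "'m::{finite,linorder} \<Rightarrow> real ^ 'n::_"
  assumes card_n: "CARD('n) = Suc CARD('m)"
    and int_r: "r \<in> int_lattice" and int_M0: "M0 \<in> int_lattice"
    and int_A: "A a \<in> int_lattice" and int_B: "B a \<in> int_lattice"
    and r_M0: "r \<bullet> M0 = 1" and r_A: "r \<bullet> A a = 0"
    and B_A: "B a \<bullet> A b = (if a = b then 1 else 0)"
    and expand: "v = (r \<bullet> v) *\<^sub>R M0 + (\<Sum>a\<in>UNIV. (B a \<bullet> v) *\<^sub>R A a)"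
    and vol_1: "vol (M0 # map A (sorted_list_of_set UNIV)) = 1"

text \<open>The columns of an integral matrix of determinant one whose inverse has \<open>r\<close> as its first row.\<close>

lemma hyperplane_basis_exists:
  fixes r :: "int ^ 'n::{finite,linorder}"
  assumes card: "CARD('n) = Suc CARD('m::{finite,linorder})" "CARD('n) \<ge> 2" and "primitive_class r"
  shows "\<exists>M0 (A :: 'm \<Rightarrow> _) B. hyperplane_basis (\<chi> i. of_int (r $ i)) M0 A B"
proof -
  define S :: "'m \<Rightarrow> 'n" where "S a = sorted_list_of_set UNIV ! Suc (pos a)" for a
  let ?i0 = "sorted_list_of_set UNIV ! 0 :: 'n"
  obtain M N :: "real ^ 'n::_ ^ 'n::_" where MN: "M ** N = mat 1" "N ** M = mat 1" "det M = 1"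
    and int: "\<And>i j. M $ i $ j \<in> \<int>" "\<And>i j. N $ i $ j \<in> \<int>" and r: "\<And>j. N $ ?i0 $ j = of_int (r $ j)"
    using primitive_imp_unimodular_row[OF card(2) assms(3), of ?i0] unfolding unimodular_row_def by blast
  have posS: "pos (S a) = Suc (pos a)" for a
    unfolding S_def by (rule pos_nth) (use pos_less[of a] card in simp)
  have pos0: "pos ?i0 = 0" by (rule pos_nth) (use card in simp)
  have injS: "S a = S b \<longleftrightarrow> a = b" for a b using posS pos_inj by (metis Suc_inject)
  have S0: "S a \<noteq> ?i0" for a using posS[of a] pos0 by auto
  have rangeS: "UNIV = insert ?i0 (range S)"
  proof -
    have "i \<in> insert ?i0 (range S)" for i :: 'n
    proof (cases "pos i")
      case 0
      then show ?thesis using pos0 pos_inj by (metis insertI1)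
    next
      case (Suc p)
      then have "p < CARD('m)" using pos_less[of i] card by simp
      then have "pos (S (sorted_list_of_set UNIV ! p)) = pos i" using posS pos_nth Suc by metis
      then show ?thesis using pos_inj by (metis insertI2 rangeI)
    qed
    then show ?thesis by blast
  qed
  have NM: "N $ i \<bullet> column j M = (if i = j then 1 else 0)" for i j
  proof -
    have "N $ i \<bullet> column j M = (N ** M) $ i $ j"
      by (simp add: matrix_matrix_mult_def inner_vec_def column_def)
    then show ?thesis using MN(2) by (simp add: mat_def)
  qed
  have int_col: "column j M \<in> int_lattice" and int_row: "N $ j \<in> int_lattice" for j
    using int by (auto simp: int_lattice_def column_def)
  have r_eq: "(\<chi> i. of_int (r $ i)) = N $ ?i0" by (simp add: vec_eq_iff r)
  have expand: "v = (N $ ?i0 \<bullet> v) *\<^sub>R column ?i0 M + (\<Sum>a\<in>UNIV. (N $ S a \<bullet> v) *\<^sub>R column (S a) M)" for v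
  proof -
    have "v = M *v (N *v v)" using MN(1) by (simp add: matrix_vector_mul_assoc)
    also have "\<dots> = (\<Sum>i\<in>UNIV. (N *v v) $ i *s column i M)" by (rule matrix_mult_sum)
    also have "\<dots> = (\<Sum>i\<in>insert ?i0 (range S). (N $ i \<bullet> v) *\<^sub>R column i M)"
      using rangeS by (simp add: matrix_vector_mul_component scalar_mult_eq_scaleR)
    also have "\<dots> = (N $ ?i0 \<bullet> v) *\<^sub>R column ?i0 M + (\<Sum>i\<in>range S. (N $ i \<bullet> v) *\<^sub>R column i M)"
    proof -
      have "?i0 \<notin> range S" using S0 by (metis imageE)
      then show ?thesis by simp
    qed
    also have "(\<Sum>i\<in>range S. (N $ i \<bullet> v) *\<^sub>R column i M) = (\<Sum>a\<in>UNIV. (N $ S a \<bullet> v) *\<^sub>R column (S a) M)"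
      by (subst sum.reindex) (auto simp: inj_on_def injS)
    finally show ?thesis .
  qed
  have "vol (column ?i0 M # map (\<lambda>a. column (S a) M) (sorted_list_of_set UNIV)) = 1"
  proof -
    have "(column ?i0 M # map (\<lambda>a. column (S a) M) (sorted_list_of_set UNIV)) ! pos i = column i M" for i
    proof (cases "i = ?i0")
      case False
      then obtain a where "i = S a" using rangeS by auto
      then show ?thesis by (simp add: posS nth_map_pos)
    qed (simp add: pos0)
    then have "(\<chi> i. (column ?i0 M # map (\<lambda>a. column (S a) M) (sorted_list_of_set UNIV)) ! pos i) = transpose M"
      by (simp add: vec_eq_iff transpose_def column_def)
    then show ?thesis using MN(3) card by (simp add: vol_def)
  qed
  then have "hyperplane_basis (\<chi> i. of_int (r $ i)) (column ?i0 M) (\<lambda>a. column (S a) M) (\<lambda>a. N $ S a)"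
    unfolding r_eq
    using card S0 injS expand
    by unfold_locales (simp_all add: NM int_col int_row S0[THEN not_sym])
  then show ?thesis by blast
qed

context hyperplane_basis
begin

text \<open>The minors of the kernel basis are the entries of \<open>r\<close>.\<close>

lemma vol_Cons_hyperplane_basis: "vol (Y # map A (sorted_list_of_set UNIV)) = r \<bullet> Y"
proof -
  let ?As = "map A (sorted_list_of_set UNIV)"
  have lin: "linear (\<lambda>v. vol (v # ?As))"
    using alternating_formD(2)[OF alternating_form_vol, of "Y # ?As" 0] card_n by simp
  have "vol (A a # ?As) = 0" for a
    by (rule alternating_formD(3)[OF alternating_form_vol]) (auto simp: card_n)
  then have "vol (((r \<bullet> Y) *\<^sub>R M0 + (\<Sum>a\<in>UNIV. (B a \<bullet> Y) *\<^sub>R A a)) # ?As) = r \<bullet> Y"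
    by (simp add: linear_add[OF lin] linear_sum[OF lin] linear_scale[OF lin] vol_1)
  then show ?thesis using expand by metis
qed

lemma alternating_form_hyperplane_basis:
  assumes "alternating_form CARD('m) \<alpha>"
  shows "\<alpha> (map A (sorted_list_of_set UNIV)) = (\<Sum>i\<in>UNIV. r $ i * (- 1) ^ pos i *
     \<alpha> (map (\<lambda>j. axis j 1) (sorted_list_of_set (UNIV - {i}))))"
  by (subst alternating_form_eq_flux[OF assms card_n]) (simp add: vol_Cons_hyperplane_basis inner_vec_def mult.assoc)

end

text \<open>The position of the parameter belonging to the coordinate \<open>j \<noteq> i\<close> is inverse to the increasing
  enumeration of the coordinates other than \<open>i\<close>.\<close>

lemma coordinate_torus_affine:
  assumes "CARD('n::{finite,linorder}) = Suc CARD('m::{finite,linorder})"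
  shows "(coordinate_torus i :: real ^ 'm::_ \<Rightarrow> real ^ 'n::_)
    = affine_param 0 (\<lambda>a. axis (sorted_list_of_set (UNIV - {i}) ! pos a) 1)"
proof (intro ext, subst vec_eq_iff, intro allI)
  fix t :: "real ^ 'm::_" and j
  let ?s = "sorted_list_of_set (UNIV - {i})"
  have card: "card (UNIV - {i}) = CARD('m)" using assms by (simp add: card_Diff_singleton)
  have nth: "affine_param 0 (\<lambda>a. axis (?s ! pos a) 1) t $ j = (\<Sum>a\<in>UNIV. if ?s ! pos a = j then t $ a else 0)"
    by (auto simp: affine_param_def axis_def intro!: sum.cong)
  show "coordinate_torus i t $ j = affine_param 0 (\<lambda>a. axis (?s ! pos a) 1) t $ j"
  proof (cases "j = i")
    case True
    have "?s ! pos a \<noteq> i" for a :: 'm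
      using nth_mem[of "pos a" ?s] pos_less[of a] card by auto
    then show ?thesis unfolding nth using True by (simp add: coordinate_torus_def)
  next
    case False
    define p where "p = card {l. l < j \<and> l \<noteq> i}"
    have p: "?s ! p = j" "p < CARD('m)"
    proof -
      have "p = card {l \<in> UNIV - {i}. l < j}" unfolding p_def by (intro arg_cong[where f = card]) auto
      then show "?s ! p = j" "p < CARD('m)"
        using nth_sorted_pos[of j "UNIV - {i}"] False card by auto
    qed
    have "?s ! pos a = j \<longleftrightarrow> a = sorted_list_of_set UNIV ! p" for a :: 'm
    proof -
      have "?s ! pos a = j \<longleftrightarrow> pos a = p"
        using p pos_less[of a] card
        by (metis distinct_sorted_list_of_set length_sorted_list_of_set nth_eq_iff_index_eq)
      then show ?thesis using p(2) pos_nth nth_pos by metis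
    qed
    then show ?thesis using False by (simp add: nth coordinate_torus_def p_def)
  qed
qed

text \<open>Both sides evaluate a form through its mean, and for the mean the identity is the expansion of an
  alternating form on the kernel basis.\<close>

lemma (in hyperplane_basis) represents_class_graph:
  fixes k :: "int ^ 'n::_"
  assumes "r = (\<chi> i. of_int (k $ i))"
    and \<phi>: "\<And>t. (\<phi> has_derivative \<phi>' t) (at t)" "\<And>v. continuous_on UNIV (\<lambda>t. \<phi>' t v)" "periodic \<phi>"
  shows "represents_class (\<lambda>t. affine_param c A t + \<phi> t *\<^sub>R w) k"
proof -
  let ?C = "\<lambda>i. coordinate_torus i :: real ^ 'm::_ \<Rightarrow> real ^ 'n::_"
  let ?e = "\<lambda>i. map (\<lambda>j. axis j 1 :: real ^ 'n::_) (sorted_list_of_set (UNIV - {i}))"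
  have C: "null_homologous CARD('m) (\<lambda>\<omega>. torus_current (?C i) \<omega> - mean_form \<omega> (?e i))" for i
  proof -
    have "map (\<lambda>a::'m. axis (sorted_list_of_set (UNIV - {i}) ! pos a) 1) (sorted_list_of_set UNIV) = ?e i"
      by (intro nth_equalityI) (auto simp: card_n pos_nth)
    then show ?thesis
      using torus_current_linear_mean[of "\<lambda>a::'m. axis (sorted_list_of_set (UNIV - {i}) ! pos a) 1" 0]
      by (simp add: coordinate_torus_affine[OF card_n] axis_int_lattice)
  qed
  have F: "null_homologous CARD('m) (\<lambda>\<omega>. torus_current (\<lambda>t. affine_param c A t + \<phi> t *\<^sub>R w) \<omega>
           - mean_form \<omega> (map A (sorted_list_of_set UNIV)))"
    by (rule torus_current_graph_mean[OF int_A \<phi>])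
  have "null_homologous CARD('m) (\<lambda>\<omega>. \<Sum>i\<in>UNIV. (- (r $ i * (- 1) ^ pos i)) *
      (torus_current (?C i) \<omega> - mean_form \<omega> (?e i)))"
    by (intro null_homologous_sum null_homologous_scale C)
  from null_homologous_add[OF F this] show ?thesis
    unfolding represents_class_def homologous_iff
  proof (rule null_homologous_cong)
    fix \<omega> :: "'n form" assume \<omega>: "smooth_form CARD('m) \<omega>"
    show "torus_current (\<lambda>t. affine_param c A t + \<phi> t *\<^sub>R w) \<omega>
      - (\<Sum>i\<in>UNIV. of_int (k $ i) * (- 1) ^ card {l. l < i} * torus_current (?C i) \<omega>)
      = torus_current (\<lambda>t. affine_param c A t + \<phi> t *\<^sub>R w) \<omega>
        - mean_form \<omega> (map A (sorted_list_of_set UNIV))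
        + (\<Sum>i\<in>UNIV. (- (r $ i * (- 1) ^ pos i)) * (torus_current (?C i) \<omega> - mean_form \<omega> (?e i)))"
      unfolding alternating_form_hyperplane_basis[OF alternating_form_mean[OF \<omega>]]
      by (simp add: assms(1) pos_def right_diff_distrib sum_subtractf sum_negf)
  qed
qed

section \<open>Diagonal metrics depending on one coordinate\<close>

lemma periodic_1_of_int:
  fixes f :: "real \<Rightarrow> 'b"
  assumes "\<And>s. f (s + 1) = f s"
  shows "f (s + of_int k) = f s"
proof (induction k rule: int_induct[where k = 0])
  case (step1 i)
  then show ?case using assms[of "s + of_int i"] by (simp add: add.assoc)
next
  case (step2 i)
  then show ?case using assms[of "s + of_int i - 1"] by (simp add: algebra_simps)
qed simp

lemma inner_axis_left: "axis i 1 \<bullet> x = (x :: real ^ 'n) $ i"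
  by (simp add: inner_axis')

lemma matrix_inv_eqI:
  fixes P Q :: "real ^ 'k ^ 'k"
  assumes "P ** Q = mat 1" "Q ** P = mat 1"
  shows "matrix_inv P = Q"
proof -
  have inv: "P ** matrix_inv P = mat 1 \<and> matrix_inv P ** P = mat 1"
    unfolding matrix_inv_def by (rule someI[of _ Q]) (simp add: assms)
  have "matrix_inv P = matrix_inv P ** (P ** Q)" by (simp add: assms)
  also have "\<dots> = Q" using inv by (simp add: matrix_mul_assoc)
  finally show ?thesis .
qed

text \<open>The product condition makes the coordinate volume form Riemannian, so that the divergence of a vector
  field is its coordinate divergence.\<close>

locale torus_metric =
  fixes a :: "'n::{finite,linorder}" and \<gamma> :: "'n \<Rightarrow> real \<Rightarrow> real"
  assumes \<gamma>_smooth: "C_inf (\<gamma> i)" and \<gamma>_pos: "\<gamma> i s > 0" and \<gamma>_periodic: "\<gamma> i (s + 1) = \<gamma> i s"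
    and \<gamma>_a: "\<gamma> a s = 1" and \<gamma>_prod: "(\<Prod>i\<in>UNIV. \<gamma> i s) = 1"
begin

definition g :: "real ^ 'n::_ \<Rightarrow> real ^ 'n::_ ^ 'n::_" where
  "g x = (\<chi> i j. if i = j then \<gamma> i (x $ a) else 0)"

lemma \<gamma>_nz [simp]: "\<gamma> i s \<noteq> 0"
  using \<gamma>_pos[of i s] by simp

lemma \<gamma>_int: "k \<in> \<int> \<Longrightarrow> \<gamma> i (s + k) = \<gamma> i s"
  using periodic_1_of_int[of "\<gamma> i"] \<gamma>_periodic by (auto elim!: Ints_cases)

lemma g_mult: "(g x *v v) $ i = \<gamma> i (x $ a) * v $ i"
proof -
  have "(g x *v v) $ i = (\<Sum>j\<in>UNIV. if j = i then \<gamma> i (x $ a) * v $ i else 0)"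
    unfolding matrix_vector_mult_def g_def vec_lambda_beta by (intro sum.cong) auto
  then show ?thesis by simp
qed

lemma g_inner: "u \<bullet> (g x *v v) = (\<Sum>i\<in>UNIV. \<gamma> i (x $ a) * u $ i * v $ i)"
  by (simp add: inner_vec_def g_mult mult_ac)

lemma g_symmetric: "u \<bullet> (g x *v v) = v \<bullet> (g x *v u)"
  by (simp add: g_inner mult_ac)

lemma transpose_g: "transpose (g x) = g x"
  by (auto simp: g_def transpose_def vec_eq_iff)

lemma det_g: "det (g x) = 1"
  by (subst det_diagonal) (simp_all add: g_def \<gamma>_prod)

lemma g_nonneg: "v \<bullet> (g x *v v) \<ge> 0"
proof -
  have "\<gamma> i (x $ a) * v $ i * v $ i \<ge> 0" for i
    using mult_nonneg_nonneg[OF less_imp_le[OF \<gamma>_pos[of i "x $ a"]] zero_le_square[of "v $ i"]]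
    by (simp add: mult.assoc)
  then show ?thesis by (simp add: g_inner sum_nonneg)
qed

lemma Riemannian_metric_g: "Riemannian_metric g"
  unfolding Riemannian_metric_def
proof (intro conjI allI ballI impI)
  have "g = (\<lambda>x. \<Sum>i\<in>UNIV. \<gamma> i (axis a 1 \<bullet> x) *\<^sub>R (\<chi> k l. if k = i \<and> l = i then 1 else 0))"
  proof (rule ext, unfold vec_eq_iff, intro allI)
    fix x :: "real ^ 'n::_" and k l
    have "(\<Sum>i\<in>UNIV. \<gamma> i (x $ a) * (if k = i \<and> l = i then 1 else 0))
      = (\<Sum>i\<in>UNIV. if i = k then (if k = l then \<gamma> i (x $ a) else 0) else 0)"
      by (intro sum.cong) auto
    then show "g x $ k $ l = (\<Sum>i\<in>UNIV. \<gamma> i (axis a 1 \<bullet> x) *\<^sub>R (\<chi> k l. if k = i \<and> l = i then 1 else 0)) $ k $ l"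
      by (simp add: g_def inner_axis_left)
  qed
  then show "smooth_on UNIV g"
    using smooth_ridge_sum[of UNIV \<gamma> UNIV "\<lambda>i. axis a 1"] \<gamma>_smooth by simp
  show "g (x + z) = g x" if "z \<in> int_lattice" for x z
  proof -
    have "\<gamma> i ((x + z) $ a) = \<gamma> i (x $ a)" for i
      using that by (simp add: int_lattice_def \<gamma>_int)
    then show ?thesis by (simp only: g_def)
  qed
  show "transpose (g x) = g x" for x by (rule transpose_g)
  show "v \<bullet> (g x *v v) > 0" if v: "v \<noteq> 0" for x v
  proof -
    obtain i where i: "v $ i \<noteq> 0" using v by (metis vec_eq_iff zero_index)
    have "0 < \<gamma> i (x $ a) * v $ i * v $ i"
      using i mult_pos_pos[OF \<gamma>_pos[of i "x $ a"], of "v $ i * v $ i"]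
      by (simp add: mult.assoc zero_less_mult_iff linorder_neq_iff disj_commute)
    moreover have "\<gamma> j (x $ a) * v $ j * v $ j \<ge> 0" for j
      using mult_nonneg_nonneg[OF less_imp_le[OF \<gamma>_pos[of j "x $ a"]] zero_le_square[of "v $ j"]]
      by (simp add: mult.assoc)
    ultimately show ?thesis
      unfolding g_inner by (intro sum_pos2[where i = i]) auto
  qed
qed

lemma matrix_inv_g: "matrix_inv (g x) = (\<chi> i j. if i = j then 1 / \<gamma> i (x $ a) else 0)"
proof (rule matrix_inv_eqI)
  let ?Q = "(\<chi> i j. if i = j then 1 / \<gamma> i (x $ a) else 0) :: real ^ 'n::_ ^ 'n::_"
  have "(g x ** ?Q) $ i $ j = (\<Sum>k\<in>UNIV. if k = i then (if i = j then 1 else 0) else 0)" for i j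
    unfolding matrix_matrix_mult_def g_def vec_lambda_beta by (intro sum.cong) auto
  then show "g x ** ?Q = mat 1" by (simp add: vec_eq_iff mat_def)
  have "(?Q ** g x) $ i $ j = (\<Sum>k\<in>UNIV. if k = i then (if i = j then 1 else 0) else 0)" for i j
    unfolding matrix_matrix_mult_def g_def vec_lambda_beta by (intro sum.cong) auto
  then show "?Q ** g x = mat 1" by (simp add: vec_eq_iff mat_def)
qed

definition \<gamma>' :: "'n \<Rightarrow> real \<Rightarrow> real" where "\<gamma>' i = deriv (\<gamma> i)"

lemma \<gamma>_deriv: "(\<gamma> i has_real_derivative \<gamma>' i s) (at s)"
  unfolding \<gamma>'_def by (rule C_inf_deriv(1)[OF \<gamma>_smooth])

lemma \<gamma>'_a: "\<gamma>' a s = 0"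
proof -
  have "\<gamma> a = (\<lambda>s. 1)" using \<gamma>_a by auto
  then show ?thesis using \<gamma>_deriv[of a s] DERIV_const DERIV_unique by metis
qed

text \<open>The logarithmic derivative of the constant determinant vanishes.\<close>

lemma sum_log_deriv: "(\<Sum>i\<in>UNIV. \<gamma>' i s / \<gamma> i s) = 0"
proof -
  have "(\<Sum>i\<in>UNIV. ln (\<gamma> i s)) = 0" for s
    using ln_prod[of UNIV "\<lambda>i. \<gamma> i s"] \<gamma>_pos \<gamma>_prod by simp
  moreover have "((\<lambda>s. \<Sum>i\<in>UNIV. ln (\<gamma> i s)) has_real_derivative (\<Sum>i\<in>UNIV. \<gamma>' i s / \<gamma> i s)) (at s)"
  proof (rule DERIV_sum)
    fix i
    show "((\<lambda>s. ln (\<gamma> i s)) has_real_derivative \<gamma>' i s / \<gamma> i s) (at s)"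
      using DERIV_chain2[OF DERIV_ln_divide[OF \<gamma>_pos] \<gamma>_deriv, of i s] by simp
  qed
  ultimately have "((\<lambda>s. 0) has_real_derivative (\<Sum>i\<in>UNIV. \<gamma>' i s / \<gamma> i s)) (at s)"
    by simp
  then show ?thesis using DERIV_const DERIV_unique by metis
qed

lemma function_of_coordinate_has_derivative:
  assumes "(f has_real_derivative f') (at ((x :: real ^ 'n::_) $ a))"
  shows "((\<lambda>y. f (y $ a)) has_derivative (\<lambda>v. f' * v $ a)) (at x)"
  by (rule has_derivative_compose[of "\<lambda>y. y $ a" "\<lambda>v. v $ a" x UNIV f])
    (use assms in \<open>auto simp: has_field_derivative_def intro!: bounded_linear_imp_has_derivative bounded_linear_vec_nth\<close>)

lemma partial_function_of_coordinate:
  assumes "(f has_real_derivative f') (at ((x :: real ^ 'n::_) $ a))"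
  shows "partial i (\<lambda>y. f (y $ a)) x = (if i = a then f' else 0)"
  unfolding partial_def frechet_derivative_at[OF function_of_coordinate_has_derivative[OF assms], symmetric]
  by (simp add: axis_def)

lemma partial_g: "partial k (\<lambda>y. g y $ i $ j) x = (if k = a \<and> i = j then \<gamma>' i (x $ a) else 0)"
proof (cases "i = j")
  case True
  then show ?thesis
    using partial_function_of_coordinate[OF \<gamma>_deriv, of k i x] by (simp add: g_def)
next
  case False
  then show ?thesis
    using partial_function_of_coordinate[OF DERIV_const, of k 0 x] by (simp add: g_def)
qed

lemma christoffel_g:
  "christoffel g k i j x = ((if i = a \<and> j = k then \<gamma>' k (x $ a) else 0)
     + (if j = a \<and> i = k then \<gamma>' k (x $ a) else 0) - (if k = a \<and> i = j then \<gamma>' i (x $ a) else 0))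
     / (2 * \<gamma> k (x $ a))"
proof -
  have "christoffel g k i j x = 1 / 2 * (\<Sum>l\<in>UNIV. if l = k then 1 / \<gamma> k (x $ a) *
     (partial i (\<lambda>y. g y $ j $ l) x + partial j (\<lambda>y. g y $ i $ l) x - partial l (\<lambda>y. g y $ i $ j) x) else 0)"
    unfolding christoffel_def by (intro arg_cong2[where f = "(*)"] sum.cong) (auto simp: matrix_inv_g)
  also have "\<dots> = (partial i (\<lambda>y. g y $ j $ k) x + partial j (\<lambda>y. g y $ i $ k) x
     - partial k (\<lambda>y. g y $ i $ j) x) / (2 * \<gamma> k (x $ a))"
    by simp
  also have "partial i (\<lambda>y. g y $ j $ k) x = (if i = a \<and> j = k then \<gamma>' k (x $ a) else 0)"
    by (auto simp: partial_g)
  also have "partial j (\<lambda>y. g y $ i $ k) x = (if j = a \<and> i = k then \<gamma>' k (x $ a) else 0)"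
    by (auto simp: partial_g)
  finally show ?thesis by (simp only: partial_g)
qed

text \<open>The only nonzero Christoffel symbols in the formula are \<open>\<Gamma>\<^sup>a\<^sub>b\<^sub>b = -\<gamma>\<^sub>b' / 2\<close> and
  \<open>\<Gamma>\<^sup>b\<^sub>a\<^sub>b = \<gamma>\<^sub>b' / (2 \<gamma>\<^sub>b)\<close>.\<close>

lemma curvature_g:
  assumes "b \<noteq> a" "(\<gamma>' b has_real_derivative \<gamma>'' ) (at (x $ a))"
  shows "riemann_curvature g a b a b x = (\<gamma>' b (x $ a))\<^sup>2 / (4 * \<gamma> b (x $ a)) - \<gamma>'' / 2"
proof -
  have "christoffel g a b b = (\<lambda>y. - \<gamma>' b (y $ a) / 2)"
    using assms(1) by (auto simp: christoffel_g \<gamma>_a)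
  moreover have "partial a (\<lambda>y. - \<gamma>' b (y $ a) / 2) x = - \<gamma>'' / 2"
    by (subst partial_function_of_coordinate[where f = "\<lambda>s. - \<gamma>' b s / 2"])
      (auto intro!: derivative_eq_intros assms(2))
  moreover have "christoffel g a a b = (\<lambda>y. 0)"
    using assms(1) by (auto simp: christoffel_g)
  moreover have "partial b (\<lambda>y. 0 :: real) x = 0"
    by (simp add: partial_def)
  moreover have "(\<Sum>p\<in>UNIV. christoffel g a a p x * christoffel g p b b x
        - christoffel g a b p x * christoffel g p a b x)
      = (\<Sum>p\<in>UNIV. if p = b then (\<gamma>' b (x $ a))\<^sup>2 / (4 * \<gamma> b (x $ a)) else 0)"
    using assms(1) by (intro sum.cong) (auto simp: christoffel_g \<gamma>_a \<gamma>'_a power2_eq_square)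
  ultimately show ?thesis
    by (simp add: riemann_curvature_def)
qed

end

definition wave :: "real \<Rightarrow> real" where "wave s = 2 + sin (2 * pi * s)"

lemma wave_pos: "wave s > 0"
  using sin_ge_minus_one[of "2 * pi * s"] unfolding wave_def by linarith

lemma C_inf_wave: "C_inf wave"
proof -
  have "C_inf (\<lambda>s. sin (2 * pi * s + 0))"
    by (rule C_inf_compose[where f = sin, OF C_inf_sin C_inf_affine])
  from C_inf_add[OF C_inf_const[of 2] this] show ?thesis
    by (simp add: wave_def[abs_def])
qed

definition wave_weight :: "'n \<Rightarrow> 'n \<Rightarrow> 'n \<Rightarrow> real \<Rightarrow> real" where
  "wave_weight b c i s = (if i = b then wave s else if i = c then inverse (wave s) else 1)"

lemma wave_torus_metric:
  fixes a b c :: "'n::{finite,linorder}"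
  assumes "a \<noteq> b" "a \<noteq> c" "b \<noteq> c"
  shows "torus_metric a (wave_weight b c)"
proof
  fix i s
  have "wave_weight b c i = (if i = b then wave else if i = c then (\<lambda>s. inverse (wave s)) else (\<lambda>s. 1))"
    by (auto simp: wave_weight_def)
  then show "C_inf (wave_weight b c i)"
    using C_inf_wave C_inf_inverse[OF C_inf_wave wave_pos] C_inf_const by simp
  show "wave_weight b c i s > 0" by (simp add: wave_weight_def wave_pos)
  have "sin (2 * pi * (s + 1)) = sin (2 * pi * s)"
    using sin_periodic[of "2 * pi * s"] by (simp add: algebra_simps)
  then show "wave_weight b c i (s + 1) = wave_weight b c i s"
    by (simp add: wave_weight_def wave_def)
  show "wave_weight b c a s = 1" using assms by (simp add: wave_weight_def)
  have "(\<Prod>i\<in>UNIV. wave_weight b c i s) = (\<Prod>i\<in>{b, c}. wave_weight b c i s)"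
    by (intro prod.mono_neutral_right) (auto simp: wave_weight_def)
  also have "\<dots> = 1" using assms wave_pos[of s] by (simp add: wave_weight_def)
  finally show "(\<Prod>i\<in>UNIV. wave_weight b c i s) = 1" .
qed

text \<open>At the origin \<open>w' \<noteq> 0\<close> and \<open>w'' = 0\<close>, which leaves the term \<open>w'\<^sup>2 / (4 w)\<close> of the curvature.\<close>

lemma wave_metric_not_flat:
  fixes a b c :: "'n::{finite,linorder}"
  assumes "a \<noteq> b" "a \<noteq> c" "b \<noteq> c"
  shows "\<not> flat_metric (torus_metric.g a (wave_weight b c))"
proof -
  interpret torus_metric a "wave_weight b c" by (rule wave_torus_metric[OF assms])
  have w: "wave_weight b c b = wave" by (auto simp: wave_weight_def)
  have d: "(wave has_real_derivative 2 * pi * cos (2 * pi * s)) (at s)" for s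
    unfolding wave_def[abs_def] by (auto intro!: derivative_eq_intros)
  have w': "\<gamma>' b = (\<lambda>s. 2 * pi * cos (2 * pi * s))"
    by (rule ext) (rule DERIV_unique[OF \<gamma>_deriv[of b, unfolded w] d])
  have "(\<gamma>' b has_real_derivative 0) (at ((0 :: real ^ 'n::_) $ a))"
    unfolding w' by (auto intro!: derivative_eq_intros)
  from curvature_g[OF assms(1)[symmetric] this]
  have "riemann_curvature g a b a b 0 = (2 * pi)\<^sup>2 / 8"
    by (simp add: w' w wave_def)
  moreover have "(2 * pi)\<^sup>2 / 8 \<noteq> (0 :: real)" by simp
  ultimately have "riemann_curvature g a b a b 0 \<noteq> 0" by metis
  then show ?thesis unfolding flat_metric_def by blast
qed

section \<open>Straightening the leaves\<close>

lemma increasing_circle_map_inverse: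
  assumes d: "\<And>s. (h has_real_derivative h' s) (at s)" and pos: "\<And>s. h' s > 0"
    and per: "\<And>s. h (s + 1) = h s + (1 :: real)"
  shows "\<exists>k. (\<forall>y. h (k y) = y) \<and> (\<forall>s. k (h s) = s) \<and> (\<forall>y. (k has_real_derivative inverse (h' (k y))) (at y))"
proof -
  have mono: "s < t \<Longrightarrow> h s < h t" for s t
    by (rule DERIV_pos_imp_increasing) (use d pos in blast)+
  have cont: "isCont h s" for s
    using d by (rule DERIV_isCont)
  have shift: "h (s + of_int n) = h s + of_int n" for s n
  proof -
    have "(\<lambda>s. h s - s) (s + of_int n) = (\<lambda>s. h s - s) s"
      by (rule periodic_1_of_int) (simp add: per)
    then show ?thesis by simp
  qed
  have "\<exists>s. h s = y" for y
  proof -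
    define n where "n = \<lfloor>y - h 0\<rfloor>"
    have "h (of_int n) \<le> y" "y \<le> h (of_int n + 1)"
      using shift[of 0 n] shift[of 0 "n + 1"] unfolding n_def by (simp_all, linarith+)
    then show ?thesis
      using IVT[of h "of_int n" y "of_int n + 1"] cont by auto
  qed
  then obtain k where hk: "\<And>y. h (k y) = y" by metis
  have inj: "h s = h t \<Longrightarrow> s = t" for s t
    using mono by (metis less_irrefl linorder_neqE)
  then have kh: "k (h s) = s" for s using hk by blast
  have contk: "isCont k y" for y
    using isCont_inverse_function[of 1 "k y" k h] kh cont hk by simp
  have "(k has_real_derivative inverse (h' (k y))) (at y)" for y
    by (rule DERIV_inverse_function[of h _ k y "y - 1" "y + 1"])
      (use d hk contk pos[of "k y"] in auto)
  with hk kh show ?thesis by blast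
qed

context torus_metric
begin

text \<open>The length of the part of a covector \<open>r\<close> transverse to \<open>dx\<^sub>a\<close> is a function of \<open>x\<^sub>a\<close> alone.  Its
  primitive, rescaled to a map of the circle of degree one, is the new coordinate.  If \<open>r\<close> is a multiple of
  \<open>dx\<^sub>a\<close>, the length is zero and the coordinate is kept.\<close>

lemma straightening_exists:
  fixes r :: "real ^ 'n::_"
  assumes "r \<noteq> 0"
  shows "\<exists>h h' \<kappa>. C_inf h \<and> (\<forall>s. (h has_real_derivative h' s) (at s)) \<and> (\<forall>s. h' s > 0) \<and>
     (\<forall>s. h (s + 1) = h s + 1) \<and> (r $ a)\<^sup>2 + \<kappa> > 0 \<and>
     (\<forall>s. (\<Sum>i\<in>UNIV - {a}. (r $ i)\<^sup>2 / \<gamma> i s) = \<kappa> * (h' s)\<^sup>2)"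
proof (cases "\<forall>i\<in>UNIV - {a}. r $ i = 0")
  case True
  then have "r $ a \<noteq> 0" using assms by (auto simp: vec_eq_iff)
  then show ?thesis
    using True C_inf_id
    by (intro exI[of _ "\<lambda>s. s"] exI[of _ "\<lambda>s. 1"] exI[of _ 0]) auto
next
  case False
  then obtain i0 where i0: "i0 \<noteq> a" "r $ i0 \<noteq> 0" by auto
  define q where "q s = (\<Sum>i\<in>UNIV - {a}. (r $ i)\<^sup>2 / \<gamma> i s)" for s
  define f where "f s = sqrt (q s)" for s
  have qpos: "q s > 0" for s
    unfolding q_def by (rule sum_pos2[where i = i0]) (use i0 \<gamma>_pos less_imp_le in \<open>auto intro!: divide_nonneg_pos divide_pos_pos\<close>)
  have "C_inf (\<lambda>s. \<Sum>i\<in>UNIV - {a}. (r $ i)\<^sup>2 * inverse (\<gamma> i s))"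
    by (intro C_inf_sum C_inf_mult[OF C_inf_const] C_inf_inverse \<gamma>_smooth \<gamma>_pos)
  then have "C_inf q" by (simp add: q_def[abs_def] divide_inverse)
  then have smf: "C_inf f" unfolding f_def[abs_def] by (rule C_inf_sqrt) (rule qpos)
  have fpos: "f s > 0" for s using qpos by (simp add: f_def)
  have fper: "f (s + 1) = f s" for s by (simp add: f_def q_def \<gamma>_periodic)
  have "isCont f s" for s using C_inf_deriv(1)[OF smf] by (rule DERIV_isCont)
  then obtain H where H: "\<And>s. (H has_real_derivative f s) (at s)"
    using einterval_antiderivative[of "-\<infinity>" "\<infinity>" f]
    by (auto simp: has_real_derivative_iff_has_vector_derivative)
  have Hper: "H (s + 1) - H s = H 1 - H 0" for s
  proof -
    have "((\<lambda>s. H (s + 1) - H s) has_real_derivative 0) (at s)" for s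
      using DERIV_diff[OF DERIV_shift[THEN iffD1, OF H[of "s + 1"]] H[of s]] by (simp add: fper)
    from DERIV_isconst_all[OF allI, OF this, of s 0] show ?thesis by simp
  qed
  define P where "P = H 1 - H 0"
  have "P > 0"
    unfolding P_def using DERIV_pos_imp_increasing[of 0 1 H] H fpos by force
  have dh: "((\<lambda>s. H s / P) has_real_derivative f s / P) (at s)" for s
    by (rule DERIV_cdivide[OF H])
  show ?thesis
  proof (rule exI[of _ "\<lambda>s. H s / P"], rule exI[of _ "\<lambda>s. f s / P"], rule exI[of _ "P\<^sup>2"],
      intro conjI allI)
    show "C_inf (\<lambda>s. H s / P)"
      using C_inf_antiderivative[OF dh] C_inf_mult[OF smf C_inf_const, of "inverse P"]
      by (simp add: divide_inverse)
    show "H (s + 1) / P = H s / P + 1" for s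
      using Hper[of s] \<open>P > 0\<close> by (simp add: P_def field_simps)
    show "(r $ a)\<^sup>2 + P\<^sup>2 > 0" using \<open>P > 0\<close> by (intro add_nonneg_pos) auto
    show "(\<Sum>i\<in>UNIV - {a}. (r $ i)\<^sup>2 / \<gamma> i s) = P\<^sup>2 * (f s / P)\<^sup>2" for s
      using \<open>P > 0\<close> qpos[of s] by (simp add: f_def power_divide flip: q_def)
  qed (use dh fpos \<open>P > 0\<close> in auto)
qed

end

section \<open>The foliation in a primitive class\<close>

text \<open>The data for one primitive covector: a lattice basis adapted to it, and a reparametrisation \<open>h\<close> of the
  coordinate \<open>x\<^sub>a\<close>, with inverse \<open>k\<close>, relative to which the part of \<open>r\<close> transverse to \<open>dx\<^sub>a\<close> has the
  constant squared length \<open>\<kappa>\<close>.\<close>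

locale leaf_family = torus_metric a \<gamma> + hyperplane_basis r M0 A B
  for a :: "'n::{finite,linorder}" and \<gamma> and r M0 :: "real ^ 'n::_"
    and A B :: "'m::{finite,linorder} \<Rightarrow> real ^ 'n::_" +
  fixes h h' k :: "real \<Rightarrow> real" and \<kappa> :: real
  assumes h_smooth: "C_inf h" and h_deriv: "(h has_real_derivative h' s) (at s)"
    and h'_pos: "h' s > 0" and h_period: "h (s + 1) = h s + 1"
    and h_k: "h (k y) = y" and k_h: "k (h s) = s"
    and k_deriv: "(k has_real_derivative inverse (h' (k y))) (at y)"
    and norm_pos: "(r $ a)\<^sup>2 + \<kappa> > 0"
    and conormal_length: "(\<Sum>i\<in>UNIV - {a}. (r $ i)\<^sup>2 / \<gamma> i s) = \<kappa> * (h' s)\<^sup>2"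
begin

lemma h'_nz [simp]: "h' s \<noteq> 0"
  using h'_pos[of s] by simp

lemma k_smooth: "C_inf k"
  by (rule C_inf_inverse_function[OF h_smooth h_deriv h'_pos k_deriv])

lemma h_int:
  assumes "z \<in> \<int>"
  shows "h (s + z) = h s + z"
proof -
  obtain n where z: "z = of_int n" using assms by (auto elim!: Ints_cases)
  have "(\<lambda>s. h s - s) (s + of_int n) = (\<lambda>s. h s - s) s"
    by (rule periodic_1_of_int) (simp add: h_period)
  then show ?thesis by (simp add: z)
qed

lemma k_int: "z \<in> \<int> \<Longrightarrow> k (y + z) = k y + z"
  by (metis h_int h_k k_h)

lemma h'_periodic: "h' (s + 1) = h' s"
proof -
  have "((\<lambda>s. h (s + 1)) has_real_derivative h' (s + 1)) (at s)"
    by (rule DERIV_shift[THEN iffD1, OF h_deriv])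
  moreover have "((\<lambda>s. h s + 1) has_real_derivative h' s) (at s)"
    using DERIV_add[OF h_deriv DERIV_const] by simp
  ultimately show ?thesis
    unfolding h_period by (rule DERIV_unique)
qed

lemma h'_int: "z \<in> \<int> \<Longrightarrow> h' (s + z) = h' s"
  using periodic_1_of_int[of h'] h'_periodic by (auto elim!: Ints_cases)

definition straight :: "real ^ 'n::_ \<Rightarrow> real ^ 'n::_" where
  "straight x = (\<chi> i. if i = a then h (x $ a) else x $ i)"

definition unstraight :: "real ^ 'n::_ \<Rightarrow> real ^ 'n::_" where
  "unstraight y = (\<chi> i. if i = a then k (y $ a) else y $ i)"

lemma straight_unstraight [simp]: "straight (unstraight y) = y"
  and unstraight_straight [simp]: "unstraight (straight x) = x"
  by (simp_all add: straight_def unstraight_def vec_eq_iff h_k k_h)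

lemma straight_add: "z \<in> int_lattice \<Longrightarrow> straight (x + z) = straight x + z"
  and unstraight_add: "z \<in> int_lattice \<Longrightarrow> unstraight (y + z) = unstraight y + z"
  by (simp_all add: straight_def unstraight_def vec_eq_iff int_lattice_def h_int k_int)

lemma straight_diff_lattice: "straight x - straight y \<in> int_lattice \<longleftrightarrow> x - y \<in> int_lattice"
proof
  assume "straight x - straight y \<in> int_lattice"
  then have "x = y + (straight x - straight y)"
    using unstraight_add[of "straight x - straight y" "straight y"] by simp
  then have "x - y = straight x - straight y" by (metis add_diff_cancel_left')
  with \<open>straight x - straight y \<in> int_lattice\<close> show "x - y \<in> int_lattice" by simp
next
  assume "x - y \<in> int_lattice"
  then show "straight x - straight y \<in> int_lattice"
    using straight_add[of "x - y" y] by simp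
qed

definition leaf :: "real \<Rightarrow> real ^ 'm::_ \<Rightarrow> real ^ 'n::_" where
  "leaf c t = unstraight (affine_param (c *\<^sub>R M0) A t)"

text \<open>The preimage of a leaf in the universal cover; \<open>r \<bullet> straight x\<close> is well defined modulo 1 on the
  torus.\<close>

definition leaf_set :: "real \<Rightarrow> (real ^ 'n::_) set" where
  "leaf_set c = {x. r \<bullet> straight x - c \<in> \<int>}"

lemma inner_int_lattice: "u \<in> int_lattice \<Longrightarrow> v \<in> int_lattice \<Longrightarrow> u \<bullet> v \<in> \<int>"
  by (auto simp: inner_vec_def int_lattice_def intro!: Ints_sum Ints_mult)

lemma r_affine: "r \<bullet> affine_param (c *\<^sub>R M0) A t = c"
  by (simp add: affine_param_def inner_add_right inner_sum_right r_M0 r_A)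

text \<open>Expansion of \<open>straight x\<close> in the adapted basis separates the parameter of the leaf from an integral
  multiple of \<open>M0\<close>.\<close>

lemma leaf_set_eq: "leaf_set c = saturation (range (leaf c))"
proof (intro set_eqI iffI)
  fix x assume "x \<in> leaf_set c"
  then have int: "r \<bullet> straight x - c \<in> \<int>" by (simp add: leaf_set_def)
  define n where "n = r \<bullet> straight x - c"
  define t where "t = (\<chi> b. B b \<bullet> straight x)"
  have "straight x = affine_param (c *\<^sub>R M0) A t + n *\<^sub>R M0"
    by (subst expand) (simp add: affine_param_def t_def n_def algebra_simps)
  moreover have nM: "n *\<^sub>R M0 \<in> int_lattice"
    using int int_M0 by (auto simp: n_def int_lattice_def intro!: Ints_mult)
  ultimately have "x = leaf c t + n *\<^sub>R M0"
    unfolding leaf_def by (metis unstraight_add unstraight_straight)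
  then show "x \<in> saturation (range (leaf c))"
    using nM by (auto simp: saturation_def)
next
  fix x assume "x \<in> saturation (range (leaf c))"
  then obtain t z where x: "x = leaf c t + z" "z \<in> int_lattice"
    by (auto simp: saturation_def)
  have "r \<bullet> straight x = c + r \<bullet> z"
    unfolding x(1) straight_add[OF x(2)] leaf_def by (simp add: inner_add_right r_affine)
  then show "x \<in> leaf_set c"
    using inner_int_lattice[OF int_r x(2)] by (simp add: leaf_set_def)
qed

text \<open>The coordinates of a leaf as functions of one linear form each.\<close>

definition \<psi> :: "real \<Rightarrow> 'n \<Rightarrow> real \<Rightarrow> real" where
  "\<psi> c i s = (if i = a then k (c * M0 $ a + s) else c * M0 $ i + s)"

lemma \<psi>_smooth: "C_inf (\<psi> c i)"
proof -
  have "C_inf (\<lambda>s. c * M0 $ i + s)" for i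
    using C_inf_affine[of 1 "c * M0 $ i"] by (simp add: add.commute)
  moreover from C_inf_compose[OF k_smooth this[of a]] have "C_inf (\<lambda>s. k (c * M0 $ a + s))" .
  ultimately show ?thesis by (cases "i = a") (simp_all add: \<psi>_def[abs_def])
qed

lemma affine_param_nth: "affine_param c0 A t $ i = c0 $ i + (\<chi> b. A b $ i) \<bullet> t"
  by (simp add: affine_param_def inner_vec_def mult.commute)

lemma sum_axis_nth: "(\<Sum>i\<in>UNIV. f i *\<^sub>R axis i (1::real)) $ j = f (j :: 'n)"
  by (simp add: axis_def if_distrib cong: if_cong)

lemma leaf_ridge: "leaf c t = (\<Sum>i\<in>UNIV. \<psi> c i ((\<chi> b. A b $ i) \<bullet> t) *\<^sub>R axis i 1)"
  by (simp only: vec_eq_iff sum_axis_nth) (simp add: leaf_def unstraight_def \<psi>_def affine_param_nth)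

lemma leaf_smooth: "smooth_on U (leaf c)"
  unfolding leaf_ridge[abs_def] by (rule smooth_ridge_sum) (rule \<psi>_smooth)

text \<open>The differential of \<open>unstraight\<close> in terms of the point in the range.\<close>

definition push :: "real ^ 'n::_ \<Rightarrow> real ^ 'n::_ \<Rightarrow> real ^ 'n::_" where
  "push x v = (\<chi> i. if i = a then v $ a / h' (x $ a) else v $ i)"

lemma leaf_a: "leaf c t $ a = k (affine_param (c *\<^sub>R M0) A t $ a)"
  by (simp add: leaf_def unstraight_def)

lemma leaf_has_derivative:
  "(leaf c has_derivative (\<lambda>v. push (leaf c t) (\<Sum>b\<in>UNIV. v $ b *\<^sub>R A b))) (at t)"
proof -
  let ?u = "\<lambda>i. \<chi> b. A b $ i"
  let ?\<psi>' = "\<lambda>i s. if i = a then inverse (h' (k (c * M0 $ a + s))) else 1"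
  have "(\<psi> c i has_real_derivative ?\<psi>' i s) (at s)" for i s
  proof -
    have lin: "((\<lambda>s. c * M0 $ i + s) has_real_derivative 1) (at s)" for i
      by (auto intro!: derivative_eq_intros)
    have "((\<lambda>s. k (c * M0 $ a + s)) has_real_derivative inverse (h' (k (c * M0 $ a + s)))) (at s)"
      using DERIV_chain2[OF k_deriv lin[of a]] by simp
    with lin[of i] show ?thesis by (cases "i = a") (simp_all add: \<psi>_def[abs_def])
  qed
  then have D1: "((\<lambda>t. \<Sum>i\<in>UNIV. \<psi> c i (?u i \<bullet> t) *\<^sub>R axis i (1::real)) has_derivative
    (\<lambda>v. \<Sum>i\<in>UNIV. (?\<psi>' i (?u i \<bullet> t) * (?u i \<bullet> v)) *\<^sub>R axis i (1::real))) (at t)"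
    by (intro ridge_sum_has_derivative)
  have D2: "(\<Sum>i\<in>UNIV. (?\<psi>' i (?u i \<bullet> t) * (?u i \<bullet> v)) *\<^sub>R axis i 1)
      = push (leaf c t) (\<Sum>b\<in>UNIV. v $ b *\<^sub>R A b)" for v
  proof -
    have uv: "?u i \<bullet> v = (\<Sum>b\<in>UNIV. v $ b *\<^sub>R A b) $ i" for i
      by (simp add: inner_vec_def mult.commute)
    show ?thesis
      by (simp only: vec_eq_iff sum_axis_nth uv)
        (simp add: push_def leaf_a affine_param_nth divide_inverse mult.commute)
  qed
  show ?thesis
    using D1 unfolding D2 leaf_ridge[symmetric] .
qed

lemma leaf_partial: "partial b (leaf c) t = push (leaf c t) (A b)"
  using frechet_derivative_at[OF leaf_has_derivative, of c t, symmetric]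
  by (simp add: partial_def sum_axis_scale)

lemma B_sum: "B b \<bullet> (\<Sum>b\<in>UNIV. v $ b *\<^sub>R A b) = v $ b"
proof -
  have "B b \<bullet> (\<Sum>b\<in>UNIV. v $ b *\<^sub>R A b) = (\<Sum>b'\<in>UNIV. if b' = b then v $ b' else 0)"
    unfolding inner_sum_right inner_scaleR_right B_A by (intro sum.cong) auto
  then show ?thesis by simp
qed

lemma push_inj:
  assumes "push x u = push x v"
  shows "u = v"
proof -
  have "u $ i = v $ i" for i
  proof -
    have "push x u $ i = push x v $ i" by (simp only: assms)
    then show ?thesis by (cases "i = a") (simp_all add: push_def)
  qed
  then show ?thesis by (simp add: vec_eq_iff)
qed

lemma leaf_embedding: "torus_embedding (leaf c)"
  unfolding torus_embedding_def
proof (intro conjI allI ballI impI)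
  show "smooth_on UNIV (leaf c)" by (rule leaf_smooth)
  show "leaf c (t + z) - leaf c t \<in> int_lattice" if "z \<in> int_lattice" for t z
    using affine_param_lattice[where A = A and z = z and c = "c *\<^sub>R M0" and t = t, OF int_A] that
      straight_diff_lattice[of "leaf c (t + z)" "leaf c t"]
    by (simp add: leaf_def)
  show "s - t \<in> int_lattice" if "leaf c s - leaf c t \<in> int_lattice" for s t
  proof -
    let ?v = "affine_param (c *\<^sub>R M0) A s - affine_param (c *\<^sub>R M0) A t"
    have v: "?v \<in> int_lattice"
      using that straight_diff_lattice[of "leaf c s" "leaf c t"] by (simp add: leaf_def)
    have "?v = (\<Sum>b\<in>UNIV. (s - t) $ b *\<^sub>R A b)"
      by (simp add: affine_param_def scaleR_diff_left sum_subtractf)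
    then have "(s - t) $ b = B b \<bullet> ?v" for b
      using B_sum[of b "s - t"] by simp
    then show ?thesis
      using inner_int_lattice[OF int_B v] by (simp add: int_lattice_def)
  qed
  show "inj (frechet_derivative (leaf c) (at t))" for t
  proof (rule injI)
    fix u v assume "frechet_derivative (leaf c) (at t) u = frechet_derivative (leaf c) (at t) v"
    then have "push (leaf c t) (\<Sum>b\<in>UNIV. u $ b *\<^sub>R A b) = push (leaf c t) (\<Sum>b\<in>UNIV. v $ b *\<^sub>R A b)"
      by (simp only: frechet_derivative_at[OF leaf_has_derivative, symmetric])
    then have "(\<Sum>b\<in>UNIV. u $ b *\<^sub>R A b) = (\<Sum>b\<in>UNIV. v $ b *\<^sub>R A b)"
      by (rule push_inj)
    then have "u $ b = v $ b" for b
      using B_sum[of b u] B_sum[of b v] by simp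
    then show "u = v" by (simp add: vec_eq_iff)
  qed
qed

text \<open>A leaf is the graph over a linear torus, in the direction of the coordinate \<open>a\<close>, of the periodic
  function \<open>k - id\<close> of that coordinate.\<close>

lemma leaf_represents:
  assumes "r = (\<chi> i. of_int (\<rho> $ i))"
  shows "represents_class (leaf c) \<rho>"
proof -
  define l where "l t = affine_param (c *\<^sub>R M0) A t $ a" for t
  define \<phi> where "\<phi> t = k (l t) - l t" for t
  define \<phi>' where "\<phi>' t v = inverse (h' (k (l t))) * (\<Sum>b\<in>UNIV. v $ b *\<^sub>R A b) $ a
      - (\<Sum>b\<in>UNIV. v $ b *\<^sub>R A b) $ a" for t v
  have dl: "(l has_derivative (\<lambda>v. (\<Sum>b\<in>UNIV. v $ b *\<^sub>R A b) $ a)) (at t)" for t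
    unfolding l_def
    by (rule bounded_linear.has_derivative[OF bounded_linear_vec_nth affine_param_has_derivative])
  have "leaf c = (\<lambda>t. affine_param (c *\<^sub>R M0) A t + \<phi> t *\<^sub>R axis a 1)"
    by (auto simp: leaf_def unstraight_def \<phi>_def l_def vec_eq_iff axis_def)
  moreover have "(\<phi> has_derivative \<phi>' t) (at t)" for t
    unfolding \<phi>_def \<phi>'_def
    by (rule has_derivative_diff[OF has_derivative_compose[OF dl k_deriv[unfolded has_field_derivative_def]] dl])
  moreover have "continuous_on UNIV (\<lambda>t. \<phi>' t v)" for v
  proof -
    have "continuous_on UNIV (\<lambda>s. inverse (h' s))"
      using C_inf_continuous_on[OF C_inf_derivative[OF h_smooth h_deriv]]
      by (intro continuous_on_inverse) auto
    moreover have "continuous_on UNIV (\<lambda>t. k (l t))"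
      unfolding l_def
      by (intro continuous_on_compose2[OF C_inf_continuous_on[OF k_smooth, of UNIV]]
          continuous_on_component continuous_on_affine_param continuous_on_id) auto
    ultimately have "continuous_on UNIV (\<lambda>t. inverse (h' (k (l t))))"
      by (rule continuous_on_compose2) auto
    then show ?thesis
      unfolding \<phi>'_def by (intro continuous_on_diff continuous_on_mult continuous_on_const)
  qed
  moreover have "periodic \<phi>"
    unfolding periodic_def
  proof (intro allI ballI)
    fix t z :: "real ^ 'm::_" assume "z \<in> int_lattice"
    then have "l (t + z) - l t \<in> \<int>"
      using affine_param_lattice[where A = A and z = z and c = "c *\<^sub>R M0" and t = t, OF int_A] by (simp add: l_def int_lattice_def)
    from k_int[OF this, of "l t"] show "\<phi> (t + z) = \<phi> t"
      by (simp add: \<phi>_def)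
  qed
  ultimately show ?thesis
    using represents_class_graph[OF assms, of \<phi> \<phi>' "c *\<^sub>R M0" "axis a 1"] by simp
qed

lemma leaf_set_partition: "partition_on UNIV (range leaf_set)"
proof (rule partition_onI)
  show "\<Union> (range leaf_set) = UNIV"
  proof -
    have "x \<in> leaf_set (r \<bullet> straight x)" for x by (simp add: leaf_set_def)
    then show ?thesis by blast
  qed
  show "disjnt P Q" if PQ: "P \<in> range leaf_set" "Q \<in> range leaf_set" "P \<noteq> Q" for P Q
  proof (rule ccontr)
    assume "\<not> disjnt P Q"
    then obtain x c d where x: "P = leaf_set c" "Q = leaf_set d" "r \<bullet> straight x - c \<in> \<int>" "r \<bullet> straight x - d \<in> \<int>"
      using PQ unfolding disjnt_def leaf_set_def by blast
    then have cd: "c - d \<in> \<int>" using Ints_diff[OF x(4) x(3)] by simp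
    have "r \<bullet> straight y - c \<in> \<int> \<longleftrightarrow> r \<bullet> straight y - d \<in> \<int>" for y
      using Ints_add[OF _ cd, of "r \<bullet> straight y - c"] Ints_diff[OF _ cd, of "r \<bullet> straight y - d"]
      by auto
    then show False using PQ(3) x(1,2) by (auto simp: leaf_set_def)
  qed
  have "leaf c 0 \<in> leaf_set c" for c
    by (simp add: leaf_set_def leaf_def r_affine)
  then show "{} \<notin> range leaf_set" by blast
qed

text \<open>Near \<open>p\<close>, a chart whose \<open>i\<close>-th coordinate is a multiple of \<open>r \<bullet> straight\<close>, for some \<open>i\<close> with
  \<open>r\<^sub>i \<noteq> 0\<close>.  The factor 4 keeps the variation of \<open>r \<bullet> straight\<close> in the chart below 1, so a leaf meets
  the domain in at most one plaque.\<close>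

lemma leaf_chart:
  "\<exists>U \<phi> i. p \<in> U \<and> cubic_chart U \<phi> \<and>
     (\<forall>L\<in>range leaf_set. components (U \<inter> L) \<subseteq> {{q\<in>U. \<phi> q $ i = c} | c. True})"
proof -
  have "r \<noteq> 0" using r_M0 by auto
  then obtain i where i: "r $ i \<noteq> 0" by (auto simp: vec_eq_iff)
  \<comment> \<open>\<open>T\<close> replaces the \<open>i\<close>-th coordinate by \<open>r \<bullet> v\<close>; \<open>T'\<close> is its inverse, with rows \<open>u\<close>.\<close>
  define T where "T v = v + (r \<bullet> v - v $ i) *\<^sub>R axis i 1" for v
  define u where "u j = (if j = i then (1 / r $ i) *\<^sub>R (axis i 1 - r + r $ i *\<^sub>R axis i 1) else axis j (1::real))" for j
  define T' where "T' v = (\<chi> j. u j \<bullet> v)" for v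
  have T'_nth: "T' v $ j = (if j = i then (v $ i - r \<bullet> v + r $ i * v $ i) / r $ i else v $ j)" for v j
    by (simp add: T'_def u_def inner_diff_left inner_add_left inner_axis_left)
  have T_nth: "T v $ j = (if j = i then r \<bullet> v else v $ j)" for v j
    by (simp add: T_def axis_def)
  have r_split: "r \<bullet> v = r $ i * v $ i + (\<Sum>j\<in>UNIV - {i}. r $ j * v $ j)" for v
    unfolding inner_vec_def by (subst sum.remove[of _ i]) auto
  have TT': "T (T' v) = v" for v
  proof -
    have "r \<bullet> T' v = r $ i * T' v $ i + (\<Sum>j\<in>UNIV - {i}. r $ j * v $ j)"
      unfolding r_split[of "T' v"] by (intro arg_cong2[where f = "(+)"] sum.cong) (auto simp: T'_nth)
    also have "\<dots> = v $ i"
      using i r_split[of v] by (simp add: T'_nth)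
    finally show ?thesis by (simp add: vec_eq_iff T_nth) (simp add: T'_nth)
  qed
  have T'T: "T' (T v) = v" for v
  proof -
    have "r \<bullet> T v = r $ i * (r \<bullet> v) + (\<Sum>j\<in>UNIV - {i}. r $ j * v $ j)"
      unfolding r_split[of "T v"] by (intro arg_cong2[where f = "(+)"] sum.cong) (auto simp: T_nth)
    then show ?thesis
      using i r_split[of v] by (simp add: vec_eq_iff T'_nth) (simp add: T_nth)
  qed
  have linT: "linear T" unfolding T_def
    by (rule linearI) (simp_all add: inner_add_right algebra_simps)
  define \<phi> where "\<phi> x = 4 *\<^sub>R T (straight x - straight p)" for x
  define \<xi> where "\<xi> y = unstraight (straight p + T' ((1/4) *\<^sub>R y))" for y
  have \<phi>\<xi>: "\<phi> (\<xi> y) = y" for y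
    by (simp add: \<phi>_def \<xi>_def TT')
  have \<xi>\<phi>: "\<xi> (\<phi> x) = x" for x
    by (simp add: \<phi>_def \<xi>_def T'T)
  have smooth\<phi>: "smooth_on U \<phi>" for U
  proof -
    let ?f = "\<lambda>j s. (if j = a then h s else s) - straight p $ j"
    have sm: "C_inf (?f j)" for j
      using C_inf_add[OF h_smooth C_inf_const[of "- straight p $ j"]] C_inf_affine[of 1 "- straight p $ j"]
      by (cases "j = a") simp_all
    have eq': "\<phi> x = (\<Sum>j\<in>UNIV. ?f j (x $ j) *\<^sub>R (4 *\<^sub>R T (axis j 1)))" for x
    proof -
      have "straight x - straight p = (\<Sum>j\<in>UNIV. ?f j (x $ j) *\<^sub>R axis j 1)"
        by (subst vec_eq_iff) (simp only: sum_axis_nth, simp add: straight_def)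
      then show ?thesis
        by (simp add: \<phi>_def linear_sum[OF linT] linear_scale[OF linT] scaleR_sum_right mult.commute)
    qed
    have eq: "\<phi> x = (\<Sum>j\<in>UNIV. ?f j (axis j 1 \<bullet> x) *\<^sub>R (4 *\<^sub>R T (axis j 1)))" for x
      unfolding inner_axis_left by (rule eq')
    have "\<phi> = (\<lambda>x. \<Sum>j\<in>UNIV. ?f j (axis j 1 \<bullet> x) *\<^sub>R (4 *\<^sub>R T (axis j 1)))"
      by (rule ext) (rule eq)
    then show ?thesis
      using smooth_ridge_sum[OF sm] by (simp only:)
  qed
  have smooth\<xi>: "smooth_on U \<xi>" for U
  proof -
    let ?f = "\<lambda>j s. if j = a then k (1 * s + straight p $ j) else 1 * s + straight p $ j"
    have sm: "C_inf (?f j)" for j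
      using C_inf_affine[of 1 "straight p $ j"] C_inf_compose[OF k_smooth C_inf_affine[of 1 "straight p $ j"]]
      by (cases "j = a") simp_all
    have eq: "\<xi> y = (\<Sum>j\<in>UNIV. ?f j (((1/4) *\<^sub>R u j) \<bullet> y) *\<^sub>R axis j 1)" for y
      by (subst vec_eq_iff) (simp only: sum_axis_nth, simp add: \<xi>_def unstraight_def T'_def add.commute)
    have "\<xi> = (\<lambda>y. \<Sum>j\<in>UNIV. ?f j (((1/4) *\<^sub>R u j) \<bullet> y) *\<^sub>R axis j 1)"
      by (rule ext) (rule eq)
    then show ?thesis
      using smooth_ridge_sum[OF sm] by (simp only:)
  qed
  define U where "U = \<phi> -` box (- One) One"
  have U_eq: "U = \<xi> ` box (- One) One"
    unfolding U_def using \<phi>\<xi> \<xi>\<phi> by (auto simp: image_iff) metis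
  have "open U"
    unfolding U_def
    by (rule open_vimage[OF open_box smooth_on_UNIV_D(2)[OF smooth\<phi>]])
  moreover have "inj_on \<phi> U" using \<xi>\<phi> by (metis inj_onI)
  moreover have img: "\<phi> ` U = box (- One) One"
    unfolding U_eq image_image \<phi>\<xi> by simp
  moreover have "smooth_on (box (- One) One) (inv_into U \<phi>)"
  proof (rule smooth_on_cong_open[OF open_box smooth\<xi>])
    fix y :: "real ^ 'n::_" assume "y \<in> box (- One) One"
    then show "inv_into U \<phi> y = \<xi> y"
      using \<open>inj_on \<phi> U\<close> \<phi>\<xi> U_eq by (metis image_eqI inv_into_f_f)
  qed
  ultimately have chart: "cubic_chart U \<phi>"
    using smooth\<phi> by (simp add: cubic_chart_def)
  have "p \<in> U"
  proof -
    have "\<phi> p = 0" using linear_0[OF linT] by (simp add: \<phi>_def)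
    then show ?thesis by (simp add: U_def mem_box_cart sum_Basis_nth)
  qed
  have \<phi>i: "\<phi> q $ i = 4 * (r \<bullet> straight q - r \<bullet> straight p)" for q
    by (simp add: \<phi>_def T_nth inner_diff_right)
  have "components (U \<inter> L) \<subseteq> {{q\<in>U. \<phi> q $ i = c} | c. True}" if LR: "L \<in> range leaf_set" for L
  proof (cases "U \<inter> L = {}")
    case False
    then obtain c q0 where L: "L = leaf_set c" and q0: "q0 \<in> U" "r \<bullet> straight q0 - c \<in> \<int>"
      using LR unfolding leaf_set_def by blast
    define e where "e = \<phi> q0 $ i"
    have bound: "\<bar>\<phi> q $ i\<bar> < 1" if "q \<in> U" for q
      using that by (auto simp: U_def mem_box_cart sum_Basis_nth abs_less_iff minus_less_iff)
    have "U \<inter> L = {q\<in>U. \<phi> q $ i = e}"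
    proof (intro set_eqI iffI)
      fix q assume q: "q \<in> U \<inter> L"
      then have "r \<bullet> straight q - c \<in> \<int>" by (simp add: L leaf_set_def)
      from Ints_diff[OF this q0(2)] have "r \<bullet> straight q - r \<bullet> straight q0 \<in> \<int>" by simp
      moreover have "\<bar>r \<bullet> straight q - r \<bullet> straight q0\<bar> < 1"
        using bound[of q] bound[OF q0(1)] q unfolding \<phi>i by auto
      ultimately have "r \<bullet> straight q = r \<bullet> straight q0"
        using Ints_nonzero_abs_less1 by fastforce
      then show "q \<in> {q\<in>U. \<phi> q $ i = e}" using q by (simp add: e_def \<phi>i)
    next
      fix q assume "q \<in> {q\<in>U. \<phi> q $ i = e}"
      then show "q \<in> U \<inter> L" using q0(2) by (simp add: e_def \<phi>i L leaf_set_def)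
    qed
    moreover have "connected {q\<in>U. \<phi> q $ i = e}"
    proof -
      have im: "{q\<in>U. \<phi> q $ i = e} = \<xi> ` (box (- One) One \<inter> {y. axis i 1 \<bullet> y = e})"
        unfolding U_eq by (auto simp: \<phi>\<xi> inner_axis_left image_iff)
      have conn: "connected (box (- One) One \<inter> {y :: real ^ 'n::_. axis i 1 \<bullet> y = e})"
        by (intro convex_connected convex_Int convex_box convex_hyperplane)
      show ?thesis
        unfolding im by (rule connected_continuous_image[OF smooth_on_UNIV_D(2)[OF smooth\<xi>] conn])
    qed
    ultimately have "components (U \<inter> L) = {{q\<in>U. \<phi> q $ i = e}}"
      using False by (simp add: components_eq_sing_iff)
    then show ?thesis by blast
  qed simp
  with \<open>p \<in> U\<close> chart show ?thesis
    by (intro exI[of _ U] exI[of _ \<phi>] exI[of _ i] conjI) simp_all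
qed

lemma leaf_foliation: "foliation (range leaf_set)"
  unfolding foliation_def
proof (intro conjI allI ballI)
  show "partition_on UNIV (range leaf_set)" by (rule leaf_set_partition)
  show "\<exists>C. connected C \<and> L = saturation C" if L: "L \<in> range leaf_set" for L
  proof -
    obtain c where "L = saturation (range (leaf c))"
      using L leaf_set_eq by auto
    moreover have "connected (range (leaf c))"
      by (intro connected_continuous_image smooth_on_UNIV_D(2)[OF leaf_smooth] connected_UNIV)
    ultimately show ?thesis by blast
  qed
qed (rule leaf_chart)

lemma leaf_foliation_by_tori:
  assumes "r = (\<chi> i. of_int (\<rho> $ i))" "\<And>c. P (leaf c)"
  shows "foliation_by_tori_in_class P \<rho> (range leaf_set)"
  unfolding foliation_by_tori_in_class_def
  using leaf_foliation leaf_embedding leaf_set_eq leaf_represents[OF assms(1)] assms(2) by blast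

end

section \<open>The calibration of the leaves\<close>

context leaf_family
begin

text \<open>This constant turns out to be the area of every leaf.\<close>

definition \<mu> :: real where "\<mu> = sqrt ((r $ a)\<^sup>2 + \<kappa>)"

text \<open>The differential of \<open>r \<bullet> straight x\<close>.\<close>

definition conormal :: "real ^ 'n::_ \<Rightarrow> real ^ 'n::_" where
  "conormal x = (\<chi> i. if i = a then r $ a * h' (x $ a) else r $ i)"

text \<open>The unit normal field: the metric dual of the conormal, whose length is \<open>\<mu> h'\<close>.\<close>

definition normal :: "real ^ 'n::_ \<Rightarrow> real ^ 'n::_" where
  "normal x = (\<chi> i. conormal x $ i / (\<gamma> i (x $ a) * (\<mu> * h' (x $ a))))"

lemma \<mu>_pos: "\<mu> > 0" and \<mu>_nz [simp]: "\<mu> \<noteq> 0" and \<mu>_squared: "\<mu>\<^sup>2 = (r $ a)\<^sup>2 + \<kappa>"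
  using norm_pos by (simp_all add: \<mu>_def)

lemma conormal_norm: "(\<Sum>i\<in>UNIV. (conormal x $ i)\<^sup>2 / \<gamma> i (x $ a)) = (\<mu> * h' (x $ a))\<^sup>2"
proof -
  have "(\<Sum>i\<in>UNIV. (conormal x $ i)\<^sup>2 / \<gamma> i (x $ a))
    = (conormal x $ a)\<^sup>2 / \<gamma> a (x $ a) + (\<Sum>i\<in>UNIV - {a}. (conormal x $ i)\<^sup>2 / \<gamma> i (x $ a))"
    by (rule sum.remove) auto
  also have "(\<Sum>i\<in>UNIV - {a}. (conormal x $ i)\<^sup>2 / \<gamma> i (x $ a)) = (\<Sum>i\<in>UNIV - {a}. (r $ i)\<^sup>2 / \<gamma> i (x $ a))"
    by (intro sum.cong) (auto simp: conormal_def)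
  also have "(conormal x $ a)\<^sup>2 / \<gamma> a (x $ a) = (r $ a)\<^sup>2 * (h' (x $ a))\<^sup>2"
    by (simp add: conormal_def \<gamma>_a power_mult_distrib)
  finally show ?thesis
    by (simp add: conormal_length power_mult_distrib \<mu>_squared distrib_right)
qed

lemma normal_g: "normal x \<bullet> (g x *v v) = conormal x \<bullet> v / (\<mu> * h' (x $ a))"
proof -
  have "normal x \<bullet> (g x *v v) = (\<Sum>i\<in>UNIV. conormal x $ i * v $ i / (\<mu> * h' (x $ a)))"
    unfolding g_inner by (intro sum.cong) (simp_all add: normal_def)
  then show ?thesis by (simp add: inner_vec_def sum_divide_distrib)
qed

lemma conormal_normal: "conormal x \<bullet> normal x = \<mu> * h' (x $ a)"
proof -
  have "conormal x \<bullet> normal x = (\<Sum>i\<in>UNIV. (conormal x $ i)\<^sup>2 / \<gamma> i (x $ a) / (\<mu> * h' (x $ a)))"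
    unfolding inner_vec_def by (intro sum.cong) (simp_all add: normal_def power2_eq_square)
  also have "\<dots> = \<mu> * h' (x $ a)"
    unfolding sum_divide_distrib[symmetric] conormal_norm by (simp add: power2_eq_square)
  finally show ?thesis .
qed

lemma normal_unit: "normal x \<bullet> (g x *v normal x) = 1"
  by (simp add: normal_g conormal_normal)

lemma normal_a: "normal x $ a = r $ a / \<mu>"
  by (simp add: normal_def conormal_def \<gamma>_a)

definition pull :: "real ^ 'n::_ \<Rightarrow> real ^ 'n::_ \<Rightarrow> real ^ 'n::_" where
  "pull x v = (\<chi> i. if i = a then h' (x $ a) * v $ a else v $ i)"

lemma push_pull: "push x (pull x v) = v"
  by (simp add: push_def pull_def vec_eq_iff)

lemma conormal_inner: "conormal x \<bullet> v = r \<bullet> pull x v"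
  unfolding inner_vec_def by (intro sum.cong) (simp_all add: conormal_def pull_def)

lemma conormal_push: "conormal x \<bullet> push x v = r \<bullet> v"
  unfolding inner_vec_def by (intro sum.cong) (simp_all add: conormal_def push_def)

lemma normal_tangent: "normal x \<bullet> (g x *v push x (A b)) = 0"
  by (simp add: normal_g conormal_push r_A)

text \<open>The tangent vectors of a leaf are the images of the kernel basis under the diagonal map \<open>push\<close> of
  determinant \<open>1 / h'\<close>.\<close>

lemma vol_tangent: "vol (Y # map (\<lambda>b. push x (A b)) (sorted_list_of_set UNIV)) = conormal x \<bullet> Y / h' (x $ a)"
proof -
  define D :: "real ^ 'n::_ ^ 'n::_" where "D = (\<chi> i j. if i = j then (if i = a then 1 / h' (x $ a) else 1) else 0)"
  have push: "push x v = D *v v" for v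
  proof -
    have "(D *v v) $ i = (\<Sum>j\<in>UNIV. if j = i then (if i = a then 1 / h' (x $ a) else 1) * v $ j else 0)" for i
      unfolding matrix_vector_mult_def D_def vec_lambda_beta by (intro sum.cong) auto
    then show ?thesis by (simp add: vec_eq_iff push_def)
  qed
  have "det D = (\<Prod>i\<in>UNIV. if i = a then 1 / h' (x $ a) else 1)"
    by (subst det_diagonal) (simp_all add: D_def)
  also have "\<dots> = 1 / h' (x $ a)" by simp
  finally have det: "det D = 1 / h' (x $ a)" .
  have "Y # map (\<lambda>b. push x (A b)) (sorted_list_of_set UNIV)
    = map ((*v) D) (pull x Y # map A (sorted_list_of_set UNIV))"
    using push_pull[of x Y] by (simp add: push)
  then show ?thesis
    by (simp only: vol_linear_image vol_Cons_hyperplane_basis det conormal_inner) simp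
qed

lemma vol_leaf: "vol (normal (leaf c t) # map (\<lambda>b. partial b (leaf c) t) (sorted_list_of_set UNIV)) = \<mu>"
  by (simp add: leaf_partial vol_tangent conormal_normal)

lemma det_induced_metric: "det (induced_metric g (leaf c) t) = \<mu>\<^sup>2"
proof -
  have "(vol (normal (leaf c t) # map (\<lambda>b. partial b (leaf c) t) (sorted_list_of_set UNIV)))\<^sup>2 * det (g (leaf c t))
    = det (induced_metric g (leaf c) t)"
    unfolding induced_metric_def
    by (rule vol_unit_normal_squared[OF card_n transpose_g normal_unit])
      (simp add: leaf_partial normal_tangent)
  then show ?thesis by (simp add: vol_leaf det_g)
qed

lemma area_leaf: "area g (leaf c) = \<mu>"
  using \<mu>_pos by (simp add: area_def det_induced_metric)

definition calibration :: "'n::_ form" where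
  "calibration x vs = vol (normal x # vs)"

lemma vol_Cons_sum:
  fixes Y :: "real ^ 'n::_"
  shows "vol (Y # vs) = (\<Sum>i\<in>UNIV. Y $ i * vol (axis i 1 # vs))"
proof (cases "Suc (length vs) = CARD('n)")
  case True
  have lin: "linear (\<lambda>v :: real ^ 'n::_. vol (v # vs))"
    using alternating_formD(2)[OF alternating_form_vol, of "Y # vs" 0] True by simp
  have "Y = (\<Sum>i\<in>UNIV. Y $ i *\<^sub>R axis i 1)"
    by (simp only: vec_eq_iff sum_axis_nth simp_thms)
  then have "vol (Y # vs) = vol ((\<Sum>i\<in>UNIV. Y $ i *\<^sub>R axis i 1) # vs)"
    by simp
  also have "\<dots> = (\<Sum>i\<in>UNIV. Y $ i * vol (axis i 1 # vs))"
    by (simp add: linear_sum[OF lin] linear_scale[OF lin])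
  finally show ?thesis .
qed (auto simp: vol_def)

text \<open>The components of the normal field as functions of \<open>x\<^sub>a\<close>.\<close>

definition \<nu> :: "'n \<Rightarrow> real \<Rightarrow> real" where
  "\<nu> i s = (if i = a then r $ a * h' s else r $ i) * inverse (\<gamma> i s * (\<mu> * h' s))"

lemma normal_nth: "normal x $ i = \<nu> i (x $ a)"
  by (simp add: normal_def \<nu>_def conormal_def divide_inverse)

lemma h'_smooth: "C_inf h'"
  by (rule C_inf_derivative[OF h_smooth h_deriv])

lemma \<nu>_smooth: "C_inf (\<nu> i)"
proof -
  have "C_inf (\<lambda>s. inverse (\<gamma> i s * (\<mu> * h' s)))"
    using \<gamma>_pos h'_pos \<mu>_pos
    by (intro C_inf_inverse C_inf_mult[OF \<gamma>_smooth C_inf_mult[OF C_inf_const h'_smooth]] mult_pos_pos)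
  moreover have "C_inf (\<lambda>s. if i = a then r $ a * h' s else r $ i)"
    using C_inf_mult[OF C_inf_const h'_smooth] C_inf_const by (cases "i = a") simp_all
  ultimately show ?thesis
    unfolding \<nu>_def[abs_def] using C_inf_mult by blast
qed

lemma calibration_ridge: "calibration x vs = (\<Sum>i\<in>UNIV. \<nu> i (axis a 1 \<bullet> x) *\<^sub>R vol (axis i 1 # vs))"
  unfolding calibration_def inner_axis_left by (subst vol_Cons_sum) (simp add: normal_nth)

lemma calibration_smooth: "smooth_form CARD('m) calibration"
  unfolding smooth_form_def
proof (intro conjI allI ballI)
  show "alternating_form CARD('m) (calibration x)" for x
    unfolding calibration_def using alternating_form_vol[where 'n = 'n]
    by (intro alternating_form_interior) (simp add: card_n)
  show "smooth_on UNIV (\<lambda>x. calibration x vs)" for vs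
    unfolding calibration_ridge by (rule smooth_ridge_sum) (rule \<nu>_smooth)
  show "calibration (x + z) = calibration x" if z: "z \<in> int_lattice" for x z
  proof -
    have za: "z $ a \<in> \<int>" using z by (simp add: int_lattice_def)
    have "normal (x + z) $ i = normal x $ i" for i
      unfolding normal_nth \<nu>_def using \<gamma>_int[OF za] h'_int[OF za] by simp
    then have "normal (x + z) = normal x" by (simp add: vec_eq_iff)
    then show ?thesis by (simp add: calibration_def[abs_def])
  qed
qed

text \<open>The unit normal field is divergence-free: its only nonconstant components do not involve their own
  coordinate.\<close>

lemma calibration_closed: "ext_deriv calibration = (\<lambda>x vs. 0)"
proof (intro ext)
  fix x :: "real ^ 'n::_" and vs :: "(real ^ 'n::_) list"
  define X' where "X' = (\<chi> i. deriv (\<nu> i) (x $ a))"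
  have D: "frechet_derivative (\<lambda>y. calibration y us) (at x) v = v $ a * vol (X' # us)" for us v
  proof -
    have "((\<lambda>y. \<Sum>i\<in>UNIV. \<nu> i (axis a 1 \<bullet> y) *\<^sub>R vol (axis i 1 # us)) has_derivative
      (\<lambda>v. \<Sum>i\<in>UNIV. (deriv (\<nu> i) (axis a 1 \<bullet> x) * (axis a 1 \<bullet> v)) *\<^sub>R vol (axis i 1 # us))) (at x)"
      by (rule ridge_sum_has_derivative) (rule C_inf_deriv(1)[OF \<nu>_smooth])
    from frechet_derivative_at[OF this, symmetric]
    have "frechet_derivative (\<lambda>y. calibration y us) (at x) v
      = (\<Sum>i\<in>UNIV. (deriv (\<nu> i) (x $ a) * v $ a) *\<^sub>R vol (axis i 1 # us))"
      unfolding calibration_ridge inner_axis_left by simp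
    also have "\<dots> = v $ a * (\<Sum>i\<in>UNIV. X' $ i * vol (axis i 1 # us))"
      by (simp add: X'_def sum_distrib_left mult_ac)
    also have "(\<Sum>i\<in>UNIV. X' $ i * vol (axis i 1 # us)) = vol (X' # us)"
      by (rule vol_Cons_sum[symmetric])
    finally show ?thesis .
  qed
  have "\<nu> a = (\<lambda>s. r $ a / \<mu>)"
    by (auto simp: \<nu>_def \<gamma>_a field_simps)
  then have X'a: "X' $ a = 0" by (simp add: X'_def)
  show "ext_deriv calibration x vs = 0"
  proof (cases "length vs = CARD('n)")
    case True
    have "linear (\<lambda>v. v $ a :: real)" by (rule linearI) simp_all
    from sum_wedge_flux[OF this True, of X'] show ?thesis
      unfolding ext_deriv_def D by (simp add: True X'a mult.assoc)
  next
    case False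
    have "vol (X' # take i vs @ drop (Suc i) vs) = 0" if "i < length vs" for i
      using False that by (simp add: vol_def)
    then show ?thesis unfolding ext_deriv_def D by simp
  qed
qed

lemma calibration_comass: "comass g CARD('m) calibration \<le> 1"
  unfolding comass_def
proof (rule Sup_least, elim CollectE exE conjE)
  fix y x and vs :: "(real ^ 'n::_) list"
  assume y: "y = ereal (calibration x vs)" and vs: "length vs = CARD('m)" "orthonormal_frame (g x) vs"
  have "(vol (normal x # vs))\<^sup>2 \<le> normal x \<bullet> (g x *v normal x)"
    by (rule vol_orthonormal_frame_le[OF _ transpose_g det_g g_nonneg vs(2)]) (simp add: card_n vs(1))
  then have "vol (normal x # vs) \<le> 1"
    unfolding normal_unit by (simp add: abs_square_le_1)
  then show "y \<le> 1" by (simp add: y calibration_def)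
qed

lemma torus_current_calibration: "torus_current (leaf c) calibration = \<mu>"
  by (simp add: torus_current_def calibration_def vol_leaf)

text \<open>The calibration is closed, so it takes the same value on all homologous currents.\<close>

lemma leaf_minimizing: "homologically_area_minimizing g (leaf c)"
  unfolding homologically_area_minimizing_def
proof (intro allI impI, elim conjE)
  fix S :: "'n form \<Rightarrow> real"
  assume "homologous CARD('m) S (torus_current (leaf c))"
  then obtain U where U: "current (Suc CARD('m)) U"
    and eq: "S calibration - torus_current (leaf c) calibration = U (ext_deriv calibration)"
    using calibration_smooth unfolding homologous_def by blast
  have "smooth_form (Suc CARD('m)) (\<lambda>(x :: real ^ 'n::_) vs. 0)"
    using smooth_ridge_sum[of "{}" _ UNIV]
    by (auto simp: smooth_form_def alternating_form_def intro: linearI)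
  then have "U (\<lambda>x vs. 0 * 0) = 0 * U (\<lambda>x vs. 0)"
    using U unfolding current_def by blast
  then have "S calibration = \<mu>"
    using eq by (simp add: calibration_closed torus_current_calibration)
  then have "ereal (area g (leaf c)) = ereal (S calibration)"
    by (simp add: area_leaf)
  also have "\<dots> \<le> mass g CARD('m) S"
    unfolding mass_def using calibration_smooth calibration_comass by (intro Sup_upper) auto
  finally show "ereal (area g (leaf c)) \<le> mass g CARD('m) S" .
qed

end

section \<open>Minimality of the leaves\<close>

lemma sum_swap_double:
  "(\<Sum>b\<in>P. \<Sum>d\<in>Q. \<Sum>i\<in>R. \<Sum>j\<in>S. f b d i j) = (\<Sum>i\<in>R. \<Sum>j\<in>S. \<Sum>b\<in>P. \<Sum>d\<in>Q. f b d i j)"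
proof -
  have "(\<Sum>b\<in>P. \<Sum>d\<in>Q. \<Sum>i\<in>R. \<Sum>j\<in>S. f b d i j) = (\<Sum>b\<in>P. \<Sum>i\<in>R. \<Sum>d\<in>Q. \<Sum>j\<in>S. f b d i j)"
    by (intro sum.cong refl sum.swap)
  also have "\<dots> = (\<Sum>i\<in>R. \<Sum>b\<in>P. \<Sum>d\<in>Q. \<Sum>j\<in>S. f b d i j)"
    by (rule sum.swap)
  also have "\<dots> = (\<Sum>i\<in>R. \<Sum>b\<in>P. \<Sum>j\<in>S. \<Sum>d\<in>Q. f b d i j)"
    by (intro sum.cong refl sum.swap)
  also have "\<dots> = (\<Sum>i\<in>R. \<Sum>j\<in>S. \<Sum>b\<in>P. \<Sum>d\<in>Q. f b d i j)"
    by (intro sum.cong refl sum.swap)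
  finally show ?thesis .
qed

context leaf_family
begin

lemma conormal_zero_imp_tangent:
  assumes "conormal x \<bullet> w = 0"
  shows "w = (\<Sum>b\<in>UNIV. (B b \<bullet> pull x w) *\<^sub>R push x (A b))"
proof -
  have lin: "linear (push x)"
    by (rule linearI) (auto simp: push_def vec_eq_iff add_divide_distrib)
  have "pull x w = (\<Sum>b\<in>UNIV. (B b \<bullet> pull x w) *\<^sub>R A b)"
    using expand[of "pull x w"] assms by (simp add: conormal_inner)
  then have "push x (pull x w) = push x (\<Sum>b\<in>UNIV. (B b \<bullet> pull x w) *\<^sub>R A b)"
    by simp
  then show ?thesis
    by (simp add: push_pull linear_sum[OF lin] linear_scale[OF lin])
qed

text \<open>The inverse of the induced metric is the inverse metric with the normal direction removed.\<close>

lemma induced_inverse: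
  fixes c t
  defines "x \<equiv> leaf c t" and "V \<equiv> \<lambda>b. partial b (leaf c) t"
    and "J \<equiv> matrix_inv (induced_metric g (leaf c) t)"
  shows "(\<Sum>b\<in>UNIV. \<Sum>d\<in>UNIV. J $ b $ d * V b $ i * V d $ j)
    = (if i = j then 1 / \<gamma> i (x $ a) else 0) - normal x $ i * normal x $ j"
proof -
  let ?I = "induced_metric g (leaf c) t"
  have V: "V b = push x (A b)" for b by (simp add: V_def x_def leaf_partial)
  have "invertible ?I"
    by (simp add: invertible_det_nz det_induced_metric)
  then obtain J' where "?I ** J' = mat 1" "J' ** ?I = mat 1"
    unfolding invertible_def by blast
  then have JI: "J ** ?I = mat 1"
    unfolding J_def by (simp add: matrix_inv_eqI)
  \<comment> \<open>\<open>Q\<close> and \<open>R\<close> are the two sides, turned into endomorphisms by \<open>g\<close>; they agree on the tangent vectors and on the normal.\<close>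
  define Q where "Q w = (\<Sum>b\<in>UNIV. \<Sum>d\<in>UNIV. (J $ b $ d * (V d \<bullet> (g x *v w))) *\<^sub>R V b)" for w
  define R where "R w = w - (normal x \<bullet> (g x *v w)) *\<^sub>R normal x" for w
  have lin: "linear (\<lambda>w. (f * (u \<bullet> (g x *v w))) *\<^sub>R v)" for f u v
    by (rule linearI) (simp_all add: matrix_vector_right_distrib inner_add_right distrib_left scaleR_add_left
        matrix_vector_mult_scaleR mult.left_commute)
  have linQ: "linear Q"
    unfolding Q_def by (intro linear_compose_sum ballI lin)
  have linR: "linear R"
    using linear_compose_sub[OF linear_ident lin[of 1 "normal x" "normal x"]] by (simp add: R_def[abs_def])
  have QV: "Q (V e) = V e" for e
  proof -
    have "Q (V e) = (\<Sum>b\<in>UNIV. (J ** ?I) $ b $ e *\<^sub>R V b)"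
      unfolding Q_def matrix_matrix_mult_def
      by (simp add: scaleR_sum_left induced_metric_def V_def x_def)
    also have "\<dots> = (\<Sum>b\<in>UNIV. if b = e then V b else 0)"
      unfolding JI by (intro sum.cong) (auto simp: mat_def)
    finally show ?thesis by simp
  qed
  have RV: "R (V e) = V e" for e
    by (simp add: R_def V normal_tangent)
  have "V d \<bullet> (g x *v normal x) = 0" for d
    unfolding V g_symmetric[of "push x (A d)"] by (rule normal_tangent)
  then have Qn: "Q (normal x) = 0" by (simp add: Q_def)
  have Rn: "R (normal x) = 0" by (simp add: R_def normal_unit)
  have QR: "Q w = R w" for w
  proof -
    define f where "f = conormal x \<bullet> w / (\<mu> * h' (x $ a))"
    define w0 where "w0 = w - f *\<^sub>R normal x"
    have "conormal x \<bullet> w0 = 0"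
      by (simp add: w0_def f_def inner_diff_right conormal_normal)
    then have w0: "w0 = (\<Sum>b\<in>UNIV. (B b \<bullet> pull x w0) *\<^sub>R V b)"
      unfolding V by (rule conormal_zero_imp_tangent)
    have "Q w0 = (\<Sum>b\<in>UNIV. (B b \<bullet> pull x w0) *\<^sub>R V b)"
      by (subst w0) (simp add: linear_sum[OF linQ] linear_scale[OF linQ] QV)
    moreover have "R w0 = (\<Sum>b\<in>UNIV. (B b \<bullet> pull x w0) *\<^sub>R V b)"
      by (subst w0) (simp add: linear_sum[OF linR] linear_scale[OF linR] RV)
    moreover have "w = w0 + f *\<^sub>R normal x" by (simp add: w0_def)
    ultimately show ?thesis
      by (simp add: linear_add[OF linQ] linear_add[OF linR] linear_scale[OF linQ] linear_scale[OF linR] Qn Rn)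
  qed
  define e where "e = (1 / \<gamma> j (x $ a)) *\<^sub>R axis j (1::real)"
  have ge: "v \<bullet> (g x *v e) = v $ j" for v
  proof -
    have "v \<bullet> (g x *v e) = (\<Sum>l\<in>UNIV. if l = j then v $ l else 0)"
      unfolding g_inner by (intro sum.cong) (auto simp: e_def axis_def)
    then show ?thesis by simp
  qed
  have "(\<Sum>b\<in>UNIV. \<Sum>d\<in>UNIV. J $ b $ d * V b $ i * V d $ j) = Q e $ i"
    by (simp add: Q_def ge mult_ac)
  also have "\<dots> = R e $ i" by (simp only: QR)
  also have "\<dots> = (if i = j then 1 / \<gamma> i (x $ a) else 0) - normal x $ i * normal x $ j"
    by (simp add: R_def ge) (simp add: e_def axis_def)
  finally show ?thesis .
qed

definition h'' :: "real \<Rightarrow> real" where "h'' = deriv h'"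

lemma h'_deriv: "(h' has_real_derivative h'' s) (at s)"
  unfolding h''_def by (rule C_inf_deriv(1)[OF h'_smooth])

text \<open>Differentiating \<open>f \<circ> leaf = const\<close> twice, for the function \<open>f\<close> with differential \<open>conormal\<close>, whose
  Hessian has the single entry \<open>r\<^sub>a h''\<close>.\<close>

lemma conormal_second_derivative:
  "conormal (leaf c t) \<bullet> partial b (partial d (leaf c)) t
    = - (r $ a * h'' (leaf c t $ a)) * partial b (leaf c) t $ a * partial d (leaf c) t $ a"
proof -
  let ?l = "\<lambda>t. affine_param (c *\<^sub>R M0) A t $ a"
  let ?s = "leaf c t $ a"
  have lin: "(?l has_derivative (\<lambda>v. (\<Sum>b\<in>UNIV. v $ b *\<^sub>R A b) $ a)) (at t)"
    by (rule bounded_linear.has_derivative[OF bounded_linear_vec_nth affine_param_has_derivative])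
  have "((\<lambda>y. inverse (h' (k y))) has_real_derivative
      - (h'' (k (?l t)) * inverse (h' (k (?l t)))) * (inverse (h' (k (?l t))))\<^sup>2) (at (?l t))"
    using DERIV_inverse'[OF DERIV_chain2[OF h'_deriv k_deriv], of "?l t"]
    by (simp add: power2_eq_square mult_ac)
  from has_derivative_compose[OF lin this[unfolded has_field_derivative_def]]
  have inv: "((\<lambda>t. inverse (h' (k (?l t)))) has_derivative
      (\<lambda>v. - (h'' ?s * inverse (h' ?s)) * (inverse (h' ?s))\<^sup>2 * (\<Sum>b\<in>UNIV. v $ b *\<^sub>R A b) $ a)) (at t)"
    by (simp add: leaf_a)
  have e1: "partial d (leaf c) = (\<lambda>t. A d + (A d $ a * (inverse (h' (k (?l t))) - 1)) *\<^sub>R axis a 1)"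
    by (auto simp: leaf_partial push_def leaf_a vec_eq_iff axis_def divide_inverse algebra_simps)
  have e2: "((\<lambda>t. A d + (A d $ a * (inverse (h' (k (?l t))) - 1)) *\<^sub>R axis a 1) has_derivative
      (\<lambda>v. 0 + (A d $ a * (- (h'' ?s * inverse (h' ?s)) * (inverse (h' ?s))\<^sup>2 * (\<Sum>b\<in>UNIV. v $ b *\<^sub>R A b) $ a - 0)) *\<^sub>R axis a 1)) (at t)"
    by (intro has_derivative_add has_derivative_const has_derivative_scaleR_left has_derivative_mult_right
        has_derivative_diff inv)
  have "partial b (partial d (leaf c)) t
    = (A d $ a * (- (h'' ?s * inverse (h' ?s)) * (inverse (h' ?s))\<^sup>2 * A b $ a)) *\<^sub>R axis a 1"
    by (simp only: partial_def[of b] e1 frechet_derivative_at[OF e2, symmetric] sum_axis_scale) simp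
  then show ?thesis
    by (simp add: leaf_partial inner_axis conormal_def push_def divide_inverse power2_eq_square)
qed

lemma sum_conormal_christoffel:
  "(\<Sum>l\<in>UNIV. conormal x $ l * christoffel g l i j x)
    = (if i = a then conormal x $ j * \<gamma>' j (x $ a) / (2 * \<gamma> j (x $ a)) else 0)
      + (if j = a then conormal x $ i * \<gamma>' i (x $ a) / (2 * \<gamma> i (x $ a)) else 0)
      - (if i = j then conormal x $ a * \<gamma>' i (x $ a) / 2 else 0)"
proof -
  let ?p = "conormal x" and ?s = "x $ a"
  have "(\<Sum>l\<in>UNIV. ?p $ l * christoffel g l i j x)
    = (\<Sum>l\<in>UNIV. (if l = j then (if i = a then ?p $ j * \<gamma>' j ?s / (2 * \<gamma> j ?s) else 0) else 0)
        + (if l = i then (if j = a then ?p $ i * \<gamma>' i ?s / (2 * \<gamma> i ?s) else 0) else 0)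
        - (if l = a then (if i = j then ?p $ a * \<gamma>' i ?s / 2 else 0) else 0))"
    by (intro sum.cong refl) (auto simp: christoffel_g \<gamma>_a add_divide_distrib diff_divide_distrib algebra_simps)
  then show ?thesis by (simp add: sum.distrib sum_subtractf)
qed

text \<open>Differentiating the identity for the length of \<open>r\<close> transverse to \<open>dx\<^sub>a\<close>.\<close>

lemma sum_conormal_log_deriv:
  "(\<Sum>i\<in>UNIV. (conormal x $ i)\<^sup>2 * \<gamma>' i (x $ a) / (\<gamma> i (x $ a))\<^sup>2) = - 2 * \<kappa> * h' (x $ a) * h'' (x $ a)"
proof -
  let ?s = "x $ a"
  have "((\<lambda>s. \<Sum>i\<in>UNIV - {a}. (r $ i)\<^sup>2 / \<gamma> i s) has_real_derivative
      (\<Sum>i\<in>UNIV - {a}. - ((r $ i)\<^sup>2 * \<gamma>' i ?s / (\<gamma> i ?s)\<^sup>2))) (at ?s)"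
  proof (rule DERIV_sum)
    fix i
    show "((\<lambda>s. (r $ i)\<^sup>2 / \<gamma> i s) has_real_derivative - ((r $ i)\<^sup>2 * \<gamma>' i ?s / (\<gamma> i ?s)\<^sup>2)) (at ?s)"
      using DERIV_divide[OF DERIV_const \<gamma>_deriv[of i ?s] \<gamma>_nz, of "(r $ i)\<^sup>2"]
      by (simp add: power2_eq_square)
  qed
  moreover have "((\<lambda>s. \<kappa> * (h' s)\<^sup>2) has_real_derivative 2 * \<kappa> * h' ?s * h'' ?s) (at ?s)"
    using DERIV_cmult[OF DERIV_power[OF h'_deriv[of ?s], of 2], of \<kappa>] by (simp add: mult_ac)
  ultimately have "(\<Sum>i\<in>UNIV - {a}. - ((r $ i)\<^sup>2 * \<gamma>' i ?s / (\<gamma> i ?s)\<^sup>2)) = 2 * \<kappa> * h' ?s * h'' ?s"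
    unfolding conormal_length by (rule DERIV_unique)
  moreover have "(\<Sum>i\<in>UNIV. (conormal x $ i)\<^sup>2 * \<gamma>' i ?s / (\<gamma> i ?s)\<^sup>2)
    = (\<Sum>i\<in>UNIV - {a}. (r $ i)\<^sup>2 * \<gamma>' i ?s / (\<gamma> i ?s)\<^sup>2)"
    by (subst sum.remove[of _ a]) (auto simp: \<gamma>'_a conormal_def intro!: sum.cong)
  ultimately show ?thesis by (simp add: sum_negf)
qed

text \<open>\<open>K\<close> is minus the covariant Hessian of \<open>f\<close>, hence \<open>\<mu> h'\<close> times the second fundamental form; its
  trace over the tangent space of a leaf vanishes.  The full trace is \<open>-r\<^sub>a h''\<close>, because the
  Christoffel terms sum up to the logarithmic derivative of \<open>det g\<close>.  The normal part has the same value by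
  the identity for \<open>q' = 2 \<kappa> h' h''\<close> and \<open>\<mu>\<^sup>2 = r\<^sub>a\<^sup>2 + \<kappa>\<close>.\<close>

lemma trace_second_fundamental_form:
  fixes x :: "real ^ 'n::_"
  defines "K \<equiv> \<lambda>i j. (if i = a \<and> j = a then - (r $ a * h'' (x $ a)) else 0)
      + (\<Sum>l\<in>UNIV. conormal x $ l * christoffel g l i j x)"
  shows "(\<Sum>i\<in>UNIV. \<Sum>j\<in>UNIV. K i j * ((if i = j then 1 / \<gamma> i (x $ a) else 0) - normal x $ i * normal x $ j)) = 0"
proof -
  let ?s = "x $ a" and ?p = "conormal x" and ?X = "normal x"
  let ?H = "r $ a * h'' (x $ a)"
  define E where "E = (\<Sum>i\<in>UNIV. (?p $ i)\<^sup>2 * \<gamma>' i ?s / (\<gamma> i ?s)\<^sup>2)"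
  have X: "?X $ i = ?p $ i / (\<gamma> i ?s * (\<mu> * h' ?s))" for i by (simp add: normal_def)
  have "(\<Sum>i\<in>UNIV. \<Sum>j\<in>UNIV. K i j * ((if i = j then 1 / \<gamma> i ?s else 0) - ?X $ i * ?X $ j))
    = (\<Sum>i\<in>UNIV. K i i / \<gamma> i ?s) - (\<Sum>i\<in>UNIV. \<Sum>j\<in>UNIV. K i j * (?X $ i * ?X $ j))"
  proof -
    have "(\<Sum>j\<in>UNIV. K i j * ((if i = j then 1 / \<gamma> i ?s else 0) - ?X $ i * ?X $ j))
      = K i i / \<gamma> i ?s - (\<Sum>j\<in>UNIV. K i j * (?X $ i * ?X $ j))" for i
    proof -
      have "(\<Sum>j\<in>UNIV. K i j * ((if i = j then 1 / \<gamma> i ?s else 0) - ?X $ i * ?X $ j))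
        = (\<Sum>j\<in>UNIV. (if j = i then K i j / \<gamma> i ?s else 0) - K i j * (?X $ i * ?X $ j))"
        by (intro sum.cong) (auto simp: right_diff_distrib)
      then show ?thesis by (simp add: sum_subtractf)
    qed
    then show ?thesis by (simp add: sum_subtractf)
  qed
  also have "(\<Sum>i\<in>UNIV. K i i / \<gamma> i ?s) = - ?H"
  proof -
    have "(\<Sum>i\<in>UNIV. K i i / \<gamma> i ?s)
      = (\<Sum>i\<in>UNIV. (if i = a then - ?H else 0) - ?p $ a / 2 * (\<gamma>' i ?s / \<gamma> i ?s))"
      by (intro sum.cong refl) (auto simp: K_def sum_conormal_christoffel \<gamma>_a \<gamma>'_a)
    also have "\<dots> = - ?H - ?p $ a / 2 * (\<Sum>i\<in>UNIV. \<gamma>' i ?s / \<gamma> i ?s)"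
      by (simp add: sum_subtractf sum_distrib_left)
    finally show ?thesis by (simp add: sum_log_deriv)
  qed
  also have "(\<Sum>i\<in>UNIV. \<Sum>j\<in>UNIV. K i j * (?X $ i * ?X $ j)) = - ?H * (?X $ a)\<^sup>2 + ?p $ a * E / (2 * (\<mu> * h' ?s)\<^sup>2)"
  proof -
    let ?u = "\<lambda>j. ?p $ j * \<gamma>' j ?s / (2 * \<gamma> j ?s) * ?X $ j"
    have u: "(\<Sum>j\<in>UNIV. ?u j) = E / (2 * (\<mu> * h' ?s))"
      unfolding E_def sum_divide_distrib by (intro sum.cong refl) (simp add: X power2_eq_square field_simps)
    have w: "(\<Sum>j\<in>UNIV. ?p $ a * \<gamma>' j ?s / 2 * (?X $ j)\<^sup>2) = ?p $ a * E / (2 * (\<mu> * h' ?s)\<^sup>2)"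
      unfolding E_def sum_divide_distrib sum_distrib_left by (intro sum.cong refl) (simp add: X power2_eq_square field_simps)
    have "(\<Sum>j\<in>UNIV. K i j * (?X $ i * ?X $ j))
      = (if i = a then - ?H * (?X $ a)\<^sup>2 + ?X $ a * (\<Sum>j\<in>UNIV. ?u j) else 0)
        + ?X $ a * ?u i - ?p $ a * \<gamma>' i ?s / 2 * (?X $ i)\<^sup>2" for i
    proof -
      have "(\<Sum>j\<in>UNIV. K i j * (?X $ i * ?X $ j))
        = (\<Sum>j\<in>UNIV. (if j = a then (if i = a then - ?H * (?X $ a)\<^sup>2 else 0) else 0)
          + (if i = a then ?X $ a * ?u j else 0) + (if j = a then ?X $ a * ?u i else 0)
          - (if j = i then ?p $ a * \<gamma>' i ?s / 2 * (?X $ i)\<^sup>2 else 0))"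
        unfolding K_def sum_conormal_christoffel
        by (intro sum.cong refl) (auto simp: algebra_simps power2_eq_square)
      then show ?thesis by (simp add: sum.distrib sum_subtractf sum_distrib_left)
    qed
    then have "(\<Sum>i\<in>UNIV. \<Sum>j\<in>UNIV. K i j * (?X $ i * ?X $ j))
      = - ?H * (?X $ a)\<^sup>2 + ?X $ a * (\<Sum>j\<in>UNIV. ?u j) + ?X $ a * (\<Sum>j\<in>UNIV. ?u j)
        - (\<Sum>j\<in>UNIV. ?p $ a * \<gamma>' j ?s / 2 * (?X $ j)\<^sup>2)"
      by (simp add: sum.distrib sum_subtractf sum_distrib_left)
    also have "\<dots> = - ?H * (?X $ a)\<^sup>2 + ?p $ a * E / (2 * (\<mu> * h' ?s)\<^sup>2)"
      unfolding u w by (simp add: X \<gamma>_a power2_eq_square field_simps)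
    finally show ?thesis .
  qed
  also have "E = - 2 * \<kappa> * h' ?s * h'' ?s"
    unfolding E_def by (rule sum_conormal_log_deriv)
  also have "- ?H - (- ?H * (?X $ a)\<^sup>2 + ?p $ a * (- 2 * \<kappa> * h' ?s * h'' ?s) / (2 * (\<mu> * h' ?s)\<^sup>2))
    = - ?H * (1 - ((r $ a)\<^sup>2 + \<kappa>) / \<mu>\<^sup>2)"
    by (simp add: normal_a conormal_def power2_eq_square field_simps)
  also have "\<dots> = 0"
    using \<mu>_pos by (simp flip: \<mu>_squared)
  finally show ?thesis .
qed

text \<open>The covector dual to a normal vector annihilates the tangent vectors and is therefore a multiple of the
  conormal.  The mean curvature is the corresponding multiple of the trace computed above.\<close>

lemma leaf_minimal: "minimal_hypersurface g (leaf c)"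
  unfolding minimal_hypersurface_def
proof (intro allI impI)
  fix t N assume N: "unit_normal g (leaf c) t N"
  define x where "x = leaf c t"
  define V where "V b = partial b (leaf c) t" for b
  define J where "J = matrix_inv (induced_metric g (leaf c) t)"
  define \<eta> where "\<eta> = g x *v N"
  define \<eta>' where "\<eta>' = (\<chi> i. if i = a then \<eta> $ a / h' (x $ a) else \<eta> $ i)"
  define \<sigma> where "\<sigma> = \<eta>' \<bullet> M0"
  have push: "\<eta> \<bullet> push x v = \<eta>' \<bullet> v" for v
    unfolding inner_vec_def by (intro sum.cong) (simp_all add: \<eta>'_def push_def)
  have "\<eta>' \<bullet> A b = 0" for b
    using N g_symmetric[of N x "push x (A b)"]
    by (simp add: unit_normal_def leaf_partial \<eta>_def inner_commute x_def flip: push)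
  then have "\<eta>' \<bullet> v = \<sigma> * (r \<bullet> v)" for v
    by (subst expand) (simp add: inner_add_right inner_sum_right \<sigma>_def)
  then have "\<eta>' = \<sigma> *\<^sub>R r"
    by (intro vector_eq_rdot[THEN iffD1]) simp
  then have \<eta>': "\<eta>' $ i = \<sigma> * r $ i" for i by simp
  have \<eta>: "\<eta> = \<sigma> *\<^sub>R conormal x"
  proof -
    have "\<eta> $ i = \<sigma> * conormal x $ i" for i
      using \<eta>'[of i] by (auto simp: \<eta>'_def conormal_def field_simps split: if_splits)
    then show ?thesis by (simp add: vec_eq_iff)
  qed
  have N_inner: "N \<bullet> (g x *v C) = \<sigma> * (conormal x \<bullet> C)" for C
    unfolding g_symmetric[of N x C] \<eta>_def[symmetric] \<eta> by (simp add: inner_commute)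
  let ?K = "\<lambda>i j. (if i = a \<and> j = a then - (r $ a * h'' (x $ a)) else 0)
      + (\<Sum>l\<in>UNIV. conormal x $ l * christoffel g l i j x)"
  have cov: "conormal x \<bullet> cov_hessian g (leaf c) b d t = (\<Sum>i\<in>UNIV. \<Sum>j\<in>UNIV. ?K i j * (V b $ i * V d $ j))" for b d
  proof -
    have "conormal x \<bullet> (\<chi> l. \<Sum>i\<in>UNIV. \<Sum>j\<in>UNIV. christoffel g l i j x * V b $ i * V d $ j)
      = (\<Sum>l\<in>UNIV. \<Sum>i\<in>UNIV. \<Sum>j\<in>UNIV. conormal x $ l * christoffel g l i j x * (V b $ i * V d $ j))"
      by (simp add: inner_vec_def sum_distrib_left mult.assoc)
    also have "\<dots> = (\<Sum>i\<in>UNIV. \<Sum>l\<in>UNIV. \<Sum>j\<in>UNIV. conormal x $ l * christoffel g l i j x * (V b $ i * V d $ j))"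
      by (rule sum.swap)
    also have "\<dots> = (\<Sum>i\<in>UNIV. \<Sum>j\<in>UNIV. (\<Sum>l\<in>UNIV. conormal x $ l * christoffel g l i j x) * (V b $ i * V d $ j))"
      unfolding sum_distrib_right by (intro sum.cong refl sum.swap)
    finally have 1: "conormal x \<bullet> (\<chi> l. \<Sum>i\<in>UNIV. \<Sum>j\<in>UNIV. christoffel g l i j x * V b $ i * V d $ j)
      = (\<Sum>i\<in>UNIV. \<Sum>j\<in>UNIV. (\<Sum>l\<in>UNIV. conormal x $ l * christoffel g l i j x) * (V b $ i * V d $ j))" .
    have "(\<Sum>j\<in>UNIV. (if i = a \<and> j = a then - (r $ a * h'' (x $ a)) else 0) * (V b $ i * V d $ j))
      = (if i = a then - (r $ a * h'' (x $ a)) * (V b $ a * V d $ a) else 0)" for i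
    proof -
      have "(\<Sum>j\<in>UNIV. (if i = a \<and> j = a then - (r $ a * h'' (x $ a)) else 0) * (V b $ i * V d $ j))
        = (\<Sum>j\<in>UNIV. if j = a then (if i = a then - (r $ a * h'' (x $ a)) * (V b $ a * V d $ a) else 0) else 0)"
        by (intro sum.cong) auto
      then show ?thesis by simp
    qed
    then have 2: "(\<Sum>i\<in>UNIV. \<Sum>j\<in>UNIV. (if i = a \<and> j = a then - (r $ a * h'' (x $ a)) else 0) * (V b $ i * V d $ j))
      = - (r $ a * h'' (x $ a)) * (V b $ a * V d $ a)"
      by simp
    have "conormal x \<bullet> cov_hessian g (leaf c) b d t = - (r $ a * h'' (x $ a)) * (V b $ a * V d $ a)
      + conormal x \<bullet> (\<chi> l. \<Sum>i\<in>UNIV. \<Sum>j\<in>UNIV. christoffel g l i j x * V b $ i * V d $ j)"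
      using conormal_second_derivative[of c t b d]
      by (simp add: cov_hessian_def inner_add_right V_def x_def mult.assoc)
    then show ?thesis
      unfolding 1 2[symmetric] by (simp add: distrib_right sum.distrib)
  qed
  have "mean_curvature g (leaf c) t N = (\<Sum>b\<in>UNIV. \<Sum>d\<in>UNIV. J $ b $ d * (\<sigma> *
      (\<Sum>i\<in>UNIV. \<Sum>j\<in>UNIV. ?K i j * (V b $ i * V d $ j))))"
    unfolding mean_curvature_def J_def[symmetric] x_def[symmetric] N_inner cov ..
  also have "\<dots> = \<sigma> * (\<Sum>b\<in>UNIV. \<Sum>d\<in>UNIV. \<Sum>i\<in>UNIV. \<Sum>j\<in>UNIV. ?K i j * (J $ b $ d * V b $ i * V d $ j))"
    by (simp only: sum_distrib_left mult_ac)
  also have "(\<Sum>b\<in>UNIV. \<Sum>d\<in>UNIV. \<Sum>i\<in>UNIV. \<Sum>j\<in>UNIV. ?K i j * (J $ b $ d * V b $ i * V d $ j))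
    = (\<Sum>i\<in>UNIV. \<Sum>j\<in>UNIV. ?K i j * (\<Sum>b\<in>UNIV. \<Sum>d\<in>UNIV. J $ b $ d * V b $ i * V d $ j))"
  proof -
    show ?thesis by (subst sum_swap_double) (simp only: sum_distrib_left)
  qed
  also have "\<dots> = 0"
    unfolding J_def V_def induced_inverse x_def[symmetric]
    using trace_second_fundamental_form[of x] by simp
  finally show "mean_curvature g (leaf c) t N = 0" by simp
qed

end

section \<open>The metric with foliations in all primitive classes\<close>

lemma (in torus_metric) primitive_class_foliation:
  fixes \<rho> :: "int ^ 'n::_"
  assumes card: "CARD('n) = Suc CARD('m::{finite,linorder})" "CARD('n) \<ge> 2" and "primitive_class \<rho>"
  shows "\<exists>\<F>. foliation_by_tori_in_class (\<lambda>F :: real ^ 'm::_ \<Rightarrow> real ^ 'n::_.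
           homologically_area_minimizing g F \<and> minimal_hypersurface g F) \<rho> \<F>"
proof -
  define r :: "real ^ 'n::_" where "r = (\<chi> i. of_int (\<rho> $ i))"
  obtain M0 and A B :: "'m \<Rightarrow> real ^ 'n::_" where basis: "hyperplane_basis r M0 A B"
    using hyperplane_basis_exists[OF assms] unfolding r_def by blast
  have "r \<noteq> 0" using hyperplane_basis.r_M0[OF basis] by auto
  then obtain h h' \<kappa> where h: "C_inf h" "\<And>s. (h has_real_derivative h' s) (at s)" "\<And>s. h' s > 0"
    "\<And>s. h (s + 1) = h s + 1" "(r $ a)\<^sup>2 + \<kappa> > 0"
    "\<And>s. (\<Sum>i\<in>UNIV - {a}. (r $ i)\<^sup>2 / \<gamma> i s) = \<kappa> * (h' s)\<^sup>2"
    using straightening_exists by blast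
  obtain k where k: "\<And>y. h (k y) = y" "\<And>s. k (h s) = s"
    "\<And>y. (k has_real_derivative inverse (h' (k y))) (at y)"
    using increasing_circle_map_inverse[of h h', OF h(2-4)] by blast
  interpret leaf_family a \<gamma> r M0 A B h h' k \<kappa>
    by (rule leaf_family.intro[OF torus_metric_axioms basis]) (intro leaf_family_axioms.intro h k)
  show ?thesis
    using leaf_foliation_by_tori[OF r_def, of "\<lambda>F. homologically_area_minimizing g F \<and> minimal_hypersurface g F"]
      leaf_minimizing leaf_minimal by blast
qed

lemma foliation_by_tori_in_class_mono:
  "foliation_by_tori_in_class P \<rho> \<F> \<Longrightarrow> (\<And>F. P F \<Longrightarrow> Q F) \<Longrightarrow> foliation_by_tori_in_class Q \<rho> \<F>"
  unfolding foliation_by_tori_in_class_def by blast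

theorem corollary1p3:
  assumes "CARD('n::{finite,linorder}) \<ge> 3"
    and "CARD('n) = Suc CARD('m::{finite,linorder})"
  shows "(\<exists>g :: real ^ 'n::_ \<Rightarrow> real ^ 'n::_ ^ 'n::_.
            Riemannian_metric g \<and> \<not> flat_metric g \<and>
            (\<forall>r. primitive_class r \<longrightarrow>
               (\<exists>\<F>. foliation_by_tori_in_class
                  (\<lambda>F :: real ^ 'm::_ \<Rightarrow> real ^ 'n::_. homologically_area_minimizing g F) r \<F>))) \<and>
         \<not> (\<forall>g :: real ^ 'n::_ \<Rightarrow> real ^ 'n::_ ^ 'n::_.
            Riemannian_metric g \<and>
            (\<forall>r. primitive_class r \<longrightarrow>
               (\<exists>\<F>. foliation_by_tori_in_class
                  (\<lambda>F :: real ^ 'm::_ \<Rightarrow> real ^ 'n::_. minimal_hypersurface g F) r \<F>)) \<longrightarrow>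
            flat_metric g)"
proof -
  let ?s = "sorted_list_of_set (UNIV :: 'n set)"
  have "?s ! 0 \<noteq> ?s ! 1" "?s ! 0 \<noteq> ?s ! 2" "?s ! 1 \<noteq> ?s ! 2"
    using assms(1) by (simp_all add: nth_eq_iff_index_eq)
  then obtain a b c :: 'n where abc: "a \<noteq> b" "a \<noteq> c" "b \<noteq> c"
    by blast
  interpret torus_metric a "wave_weight b c" by (rule wave_torus_metric[OF abc])
  have fol: "\<exists>\<F>. foliation_by_tori_in_class (\<lambda>F :: real ^ 'm::_ \<Rightarrow> real ^ 'n::_.
      homologically_area_minimizing g F \<and> minimal_hypersurface g F) r \<F>" if "primitive_class r" for r
    by (rule primitive_class_foliation) (use assms that in auto)
  have minimizing_fol: "\<exists>\<F>. foliation_by_tori_in_class (\<lambda>F :: real ^ 'm::_ \<Rightarrow> real ^ 'n::_.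
      homologically_area_minimizing g F) r \<F>" if "primitive_class r" for r
    using fol[OF that] by (auto elim!: foliation_by_tori_in_class_mono)
  have minimal_fol: "\<exists>\<F>. foliation_by_tori_in_class (\<lambda>F :: real ^ 'm::_ \<Rightarrow> real ^ 'n::_.
      minimal_hypersurface g F) r \<F>" if "primitive_class r" for r
    using fol[OF that] by (auto elim!: foliation_by_tori_in_class_mono)
  have nonflat: "\<not> flat_metric g" by (rule wave_metric_not_flat[OF abc])
  show ?thesis
    using Riemannian_metric_g nonflat minimizing_fol minimal_fol by blast
qed

end
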